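(* Let $0<\alpha<\frac12$ and let $\sigma_\alpha(n)=\sum_{d\mid n} d^{\alpha}$. Define $E_\alpha(x)$ for $x\ge 1$ by $$\sum_{n\le x}\sigma_\alpha(n)=\frac{x^{1+\alpha}}{1+\alpha}\zeta(1+\alpha)+x\,\zeta(1-\alpha)+E_\alpha(x).$$ Then $E_\alpha(x)=\Omega\!\left((x\ln x)^{\frac14+\frac{\alpha}{2}}\right)$ as $x\to+\infty$.
   Context: $\zeta$ denotes the Riemann zeta function. For positive $g$, $f(x)=\Omega(g(x))$ means $\limsup_{x\to\infty}|f(x)|/g(x)>0$. *)

theory Defs
  imports "HOL-Complex_Analysis.Complex_Analysis"
begin

(* The holomorphic continuation to the complex plane minus the point 1 of the Dirichlet series
   sum_{m >= 1} m^(-s).  By the identity theorem the value is uniquely determined at every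
   s other than 1; the value at the pole 1 is unspecified. *)
definition riemann_zeta :: "complex \<Rightarrow> complex" where
  "riemann_zeta = (SOME f. f holomorphic_on - {1} \<and>
     (\<forall>s. Re s > 1 \<longrightarrow> (\<lambda>n. of_nat (Suc n) powr (- s)) sums f s))"

definition divisor_sigma :: "real \<Rightarrow> nat \<Rightarrow> real" where
  "divisor_sigma \<alpha> n = (\<Sum>d | d dvd n. real d powr \<alpha>)"

(* The zeta function is real at real arguments other than 1, so Re only changes the type here. *)
definition divisor_error :: "real \<Rightarrow> real \<Rightarrow> real" where
  "divisor_error \<alpha> x =
     (\<Sum>n | 1 \<le> n \<and> real n \<le> x. divisor_sigma \<alpha> n)
     - (x powr (1 + \<alpha>) / (1 + \<alpha>) * Re (riemann_zeta (of_real (1 + \<alpha>)))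
        + x * Re (riemann_zeta (of_real (1 - \<alpha>))))"

(* The Hardy-Littlewood Omega, i.e. the negation of f = o(g).  The bigomega of
   HOL-Library.Landau_Symbols is Knuth's, which is strictly stronger (f \<ge> c g eventually). *)
definition is_Omega_at_top :: "(real \<Rightarrow> real) \<Rightarrow> (real \<Rightarrow> real) \<Rightarrow> bool" where
  "is_Omega_at_top f g \<longleftrightarrow> Limsup at_top (\<lambda>x. ereal (\<bar>f x\<bar> / g x)) > 0"

end

(* The kernel h(y) = (i (y - T^2))^(-5/2-alpha), with T = t + i eta, is concentrated near y = t^2.
   Summing sigma_alpha(n) h(n) over n = d m by the Lipschitz formula in m and by trapezoidal
   Poisson summation in d leads to the elementary integrals of x^(-5/2) exp(-a^2/x - b^2 x)
   (Bessel functions of half-integral order), and thereby to a Voronoi formula whose main term is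
   c T^(-2) times the sum of k^alpha sqrt(k l) exp(4 pi i sqrt(k l) T), with error O(|T|^(-5/2)).
   For eta^(-2) = 2 M, Dirichlet's approximation theorem supplies t with ln t = O(M) at which
   the terms with k l = O(M) are aligned, so this sum is of exact order eta^(-3-2 alpha).
   By partial summation the same quantity is, up to O(|T|^(-5/2)), the integral of E against -h':
   the terms x^(1+alpha) and x contribute a negligible amount whatever their coefficients, so the
   values of the zeta function play no role.  If E were o((x ln x)^(1/4+alpha/2)), that
   integral would be o(t^(-2) eta^(-3-2 alpha)). *)
theory Submission
  imports Defs
begin

text \<open>The exponent of the kernel is tuned so that \<alpha> leaves the special functions: the
  Lipschitz formula for the multiples of d produces d powr (- s), and for s = 5/2 + \<alpha> the
  weight d powr \<alpha> turns this into d powr (-5/2), whose Fourier integrals are elementary.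
  Centring at T^2 makes the phases 4 pi sqrt(n) t linear in t, as Dirichlet's theorem requires, and
  makes eta a damping of the long sums. The logarithm is the price of the alignment: t may be
  exponential in M, so M is comparable to ln t. With \<gamma> = 1/4 + \<alpha>/2, the bound (t^2
  M)^\<gamma> for the error times the norm (t eta)^(-2 \<gamma> - 2) of h' is t^(-2) M^(2 \<gamma> +
  1), exactly the size of the main term. As t is exponential in M, no power of t may be lost
  elsewhere. The integrals of y^\<alpha> h(y) and of h(y) over the half-line are therefore evaluated
  with their cancellation: absolute values would exceed the main term. The sums over negative
  lattice points are small since h is taken there far from its peak.\<close>

lemma FTC_Ioo:
  fixes f F :: "real \<Rightarrow> complex"
  assumes "a < b"
    and F: "\<And>x. a < x \<Longrightarrow> x < b \<Longrightarrow> (F has_vector_derivative f x) (at x)"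
    and f: "continuous_on {a<..<b} f"
    and int: "set_integrable lborel {a<..<b} f"
    and A: "(F \<longlongrightarrow> A) (at_right a)"
    and B: "(F \<longlongrightarrow> B) (at_left b)"
  shows "(LBINT x:{a<..<b}. f x) = B - A"
proof -
  have "(LBINT x=ereal a..ereal b. f x) = B - A"
  proof (rule interval_integral_FTC_integrable)
    show "isCont f x" if "ereal a < ereal x" "ereal x < ereal b" for x
      using f that by (simp add: continuous_on_eq_continuous_at)
    show "((F \<circ> real_of_ereal) \<longlongrightarrow> A) (at_right (ereal a))"
      using A by (simp add: ereal_tendsto_simps)
    show "((F \<circ> real_of_ereal) \<longlongrightarrow> B) (at_left (ereal b))"
      using B by (simp add: ereal_tendsto_simps)
  qed (use assms in auto)
  then show ?thesis
    using \<open>a < b\<close> by (simp add: interval_integral_Ioo)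
qed

section \<open>Integrals over the half-line and complex Gamma integrals\<close>

lemma FTC_Ioi:
  fixes f F :: "real \<Rightarrow> complex"
  assumes F: "\<And>x. a < x \<Longrightarrow> (F has_vector_derivative f x) (at x)"
    and f: "continuous_on {a<..} f"
    and int: "set_integrable lborel {a<..} f"
    and A: "(F \<longlongrightarrow> A) (at_right a)"
    and B: "(F \<longlongrightarrow> B) at_top"
  shows "(LBINT x:{a<..}. f x) = B - A"
proof -
  have "(LBINT x=ereal a..\<infinity>. f x) = B - A"
  proof (rule interval_integral_FTC_integrable)
    show "isCont f x" if "ereal a < ereal x" "ereal x < \<infinity>" for x
      using f that by (simp add: continuous_on_eq_continuous_at)
    show "((F \<circ> real_of_ereal) \<longlongrightarrow> A) (at_right (ereal a))"
      using A by (simp add: ereal_tendsto_simps)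
    show "((F \<circ> real_of_ereal) \<longlongrightarrow> B) (at_left \<infinity>)"
      using B by (simp add: ereal_tendsto_simps)
  qed (use assms in auto)
  then show ?thesis
    by (simp add: interval_integral_to_infinity_eq)
qed

lemma set_integrable_powr_at_0:
  fixes a c :: real
  assumes "a > -1" "c > 0"
  shows "set_integrable lborel {0<..<c} (\<lambda>x. x powr a)"
    and "(LBINT x:{0<..<c}. x powr a) = c powr (a + 1) / (a + 1)"
proof -
  have lim: "((\<lambda>x. x powr (a + 1) / (a + 1)) \<longlongrightarrow> 0 powr (a + 1) / (a + 1)) (at_right 0)"
    using assms by (intro tendsto_intros) (auto simp: eventually_at_filter)
  have lim2: "((\<lambda>x. x powr (a + 1) / (a + 1)) \<longlongrightarrow> c powr (a + 1) / (a + 1)) (at_left c)"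
    using assms by (intro tendsto_intros) auto
  have *: "set_integrable lborel (einterval 0 (ereal c)) (\<lambda>x. x powr a)
     \<and> (LBINT x=0..ereal c. x powr a) = c powr (a + 1) / (a + 1) - 0 powr (a + 1) / (a + 1)"
    by (intro conjI interval_integral_FTC_nonneg[where F = "\<lambda>x. x powr (a + 1) / (a + 1)"])
       (use assms lim lim2 in \<open>auto intro!: derivative_eq_intros continuous_intros
          simp: ereal_tendsto_simps zero_ereal_def\<close>)
  show "set_integrable lborel {0<..<c} (\<lambda>x. x powr a)"
    using * by (simp add: zero_ereal_def)
  show "(LBINT x:{0<..<c}. x powr a) = c powr (a + 1) / (a + 1)"
    using * assms by (simp add: interval_integral_Ioo zero_ereal_def)
qed

lemma set_integrable_powr_at_top:
  fixes a c :: real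
  assumes "a < -1" "c > 0"
  shows "set_integrable lborel {c<..} (\<lambda>x. x powr a)"
    and "(LBINT x:{c<..}. x powr a) = - (c powr (a + 1) / (a + 1))"
proof -
  have lim: "((\<lambda>x. x powr (a + 1) / (a + 1)) \<longlongrightarrow> c powr (a + 1) / (a + 1)) (at_right c)"
    using assms by (intro tendsto_intros) auto
  have lim2: "((\<lambda>x. x powr (a + 1) / (a + 1)) \<longlongrightarrow> 0) at_top"
    using assms by real_asymp
  have *: "set_integrable lborel (einterval c \<infinity>) (\<lambda>x. x powr a)
     \<and> (LBINT x=ereal c..\<infinity>. x powr a) = 0 - c powr (a + 1) / (a + 1)"
    by (intro conjI interval_integral_FTC_nonneg[where F = "\<lambda>x. x powr (a + 1) / (a + 1)"])
       (use assms lim lim2 in \<open>auto intro!: derivative_eq_intros continuous_intros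
          simp: ereal_tendsto_simps\<close>)
  show "set_integrable lborel {c<..} (\<lambda>x. x powr a)"
    using * by simp
  show "(LBINT x:{c<..}. x powr a) = - (c powr (a + 1) / (a + 1))"
    using * by (simp add: interval_integral_to_infinity_eq)
qed

lemma set_integrable_powr_split:
  fixes a b :: real
  assumes "a > -1" "b < -1"
  shows "set_integrable lborel {0<..} (\<lambda>x. if x < 1 then x powr a else x powr b)"
proof -
  have "set_integrable lborel ({0<..<1} \<union> ({1} \<union> {1<..})) (\<lambda>x. if x < 1 then x powr a else x powr b)"
  proof (intro set_integrable_Un)
    show "set_integrable lborel {0<..<1} (\<lambda>x. if x < 1 then x powr a else x powr b)"
      using set_integrable_powr_at_0(1)[OF assms(1), of 1]
      by (subst set_integrable_cong[where f' = "\<lambda>x. x powr a"]) auto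
    show "set_integrable lborel {1<..} (\<lambda>x. if x < 1 then x powr a else x powr b)"
      using set_integrable_powr_at_top(1)[OF assms(2), of 1]
      by (subst set_integrable_cong[where f' = "\<lambda>x. x powr b"]) auto
    have "set_integrable lborel {1} (\<lambda>x::real. 1::real)"
      by (auto simp: set_integrable_def)
    then show "set_integrable lborel {1} (\<lambda>x. if x < 1 then x powr a else x powr b)"
      by (rule set_integrable_cong[THEN iffD1, rotated -1]) auto
  qed auto
  also have "{0<..<1} \<union> ({1} \<union> {1<..}) = {0::real<..}" by auto
  finally show ?thesis .
qed

lemma set_integrable_powr_boundI:
  fixes f :: "real \<Rightarrow> 'a :: {banach, second_countable_topology}" and a b C :: real
  assumes "set_borel_measurable lborel {0<..} f" "a > -1" "b < -1"
    and 0: "\<And>x. 0 < x \<Longrightarrow> x < 1 \<Longrightarrow> norm (f x) \<le> C * x powr a"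
    and 1: "\<And>x. 1 \<le> x \<Longrightarrow> norm (f x) \<le> C * x powr b"
  shows "set_integrable lborel {0<..} f"
proof (rule set_integrable_bound)
  show "set_integrable lborel {0<..} (\<lambda>x. C * (if x < 1 then x powr a else x powr b))"
    using set_integrable_powr_split[of a b] assms by auto
  show "AE x in lborel. x \<in> {0<..} \<longrightarrow> norm (f x) \<le> norm (C * (if x < 1 then x powr a else x powr b))"
    using 0 1 by (intro AE_I2) (force intro: order_trans[OF _ abs_ge_self])
qed (use assms in auto)

lemma set_integrable_continuous_boundI:
  fixes f :: "real \<Rightarrow> 'a :: {banach, second_countable_topology}" and a b C :: real
  assumes "continuous_on {0<..} f" "a > -1" "b < -1"
    and 0: "\<And>x. 0 < x \<Longrightarrow> x < 1 \<Longrightarrow> norm (f x) \<le> C * x powr a"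
    and 1: "\<And>x. 1 \<le> x \<Longrightarrow> norm (f x) \<le> C * x powr b"
  shows "set_integrable lborel {0<..} f"
  by (rule set_integrable_powr_boundI[OF _ assms(2-5)])
     (use assms(1) in \<open>auto simp: set_borel_measurable_def
        intro!: borel_measurable_continuous_on_indicator\<close>)

lemma set_integral_norm_bound':
  fixes f :: "real \<Rightarrow> 'a :: {banach, second_countable_topology}"
  assumes "set_integrable lborel A g" "\<And>x. x \<in> A \<Longrightarrow> norm (f x) \<le> g x"
  shows "norm (LBINT x:A. f x) \<le> (LBINT x:A. g x)"
proof (cases "set_integrable lborel A f")
  case True
  then show ?thesis
    unfolding set_lebesgue_integral_def using assms
    by (intro Bochner_Integration.integral_norm_bound_integral) (auto simp: set_integrable_def indicator_def)
next
  \<comment> \<open>A function that is not integrable has the default integral 0; the bound survives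
    because \<open>g\<close> dominates a norm on \<open>A\<close>, so that its integral is
    nonnegative.\<close>
  case False
  have "0 \<le> (LBINT x:A. g x)"
    unfolding set_lebesgue_integral_def using assms(2)
    by (intro integral_nonneg_AE AE_I2) (auto simp: indicator_def intro: order_trans[OF norm_ge_zero])
  with False show ?thesis
    by (simp add: set_lebesgue_integral_def set_integrable_def not_integrable_integral_eq)
qed

lemma set_lebesgue_integral_sums:
  fixes f :: "nat \<Rightarrow> real \<Rightarrow> complex"
  assumes int: "\<And>i. set_integrable lborel A (f i)"
    and sm: "\<And>x. x \<in> A \<Longrightarrow> summable (\<lambda>i. norm (f i x))"
    and bd: "\<And>i. (LBINT x:A. norm (f i x)) \<le> M i" and M: "summable M"
  shows "set_integrable lborel A (\<lambda>x. \<Sum>i. f i x)"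
    and "(\<lambda>i. LBINT x:A. f i x) sums (LBINT x:A. (\<Sum>i. f i x))"
proof -
  let ?g = "\<lambda>i x. indicator A x *\<^sub>R f i x"
  have eq: "(\<lambda>x. \<Sum>i. ?g i x) = (\<lambda>x. indicator A x *\<^sub>R (\<Sum>i. f i x))"
    by (auto simp: fun_eq_iff indicator_def)
  have 1: "\<And>i. integrable lborel (?g i)" using int by (simp add: set_integrable_def)
  have 2: "AE x in lborel. summable (\<lambda>i. norm (?g i x))"
    using sm by (intro AE_I2) (auto simp: indicator_def)
  have 3: "summable (\<lambda>i. integral\<^sup>L lborel (\<lambda>x. norm (?g i x)))"
  proof (rule summable_comparison_test'[OF M])
    fix i
    have "integral\<^sup>L lborel (\<lambda>x. norm (?g i x)) = (LBINT x:A. norm (f i x))"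
      by (simp add: set_lebesgue_integral_def)
    moreover have "0 \<le> integral\<^sup>L lborel (\<lambda>x. norm (?g i x))" by simp
    ultimately show "norm (integral\<^sup>L lborel (\<lambda>x. norm (?g i x))) \<le> M i"
      using bd[of i] by simp
  qed
  from integrable_suminf[OF 1 2 3] show "set_integrable lborel A (\<lambda>x. \<Sum>i. f i x)"
    unfolding eq set_integrable_def .
  from sums_integral[OF 1 2 3] show "(\<lambda>i. LBINT x:A. f i x) sums (LBINT x:A. (\<Sum>i. f i x))"
    unfolding eq set_lebesgue_integral_def .
qed

lemma set_integral_dominated_at_top:
  fixes f :: "real \<Rightarrow> real \<Rightarrow> 'a :: {banach, second_countable_topology}"
  assumes "set_integrable lborel A g"
    and "\<And>e. set_borel_measurable lborel A (f e)" "set_borel_measurable lborel A h"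
    and "\<And>x. x \<in> A \<Longrightarrow> ((\<lambda>e. f e x) \<longlongrightarrow> h x) at_top"
    and "\<And>e x. x \<in> A \<Longrightarrow> e > 0 \<Longrightarrow> norm (f e x) \<le> g x"
  shows "((\<lambda>e. LBINT x:A. f e x) \<longlongrightarrow> (LBINT x:A. h x)) at_top"
  unfolding set_lebesgue_integral_def
proof (rule integral_dominated_convergence_at_top)
  show "integrable lborel (\<lambda>x. indicator A x *\<^sub>R g x)" using assms(1) by (simp add: set_integrable_def)
  show "\<forall>\<^sub>F e in at_top. AE x in lborel. norm (indicat_real A x *\<^sub>R f e x) \<le> indicat_real A x *\<^sub>R g x"
    using eventually_gt_at_top[of 0] by eventually_elim (use assms(5) in \<open>auto simp: indicator_def\<close>)
  show "AE x in lborel. ((\<lambda>e. indicat_real A x *\<^sub>R f e x) \<longlongrightarrow> indicat_real A x *\<^sub>R h x) at_top"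
    using assms(4) by (intro AE_I2) (auto simp: indicator_def)
qed (use assms(2,3) in \<open>auto simp: set_borel_measurable_def\<close>)

lemma set_integral_Ioi_scale:
  fixes f :: "real \<Rightarrow> 'a :: {banach, second_countable_topology}"
  assumes "c > 0"
  shows "set_integrable lborel {0<..} (\<lambda>x. f (c * x)) \<longleftrightarrow> set_integrable lborel {0<..} f"
    and "(LBINT x:{0<..}. f x) = c *\<^sub>R (LBINT x:{0<..}. f (c * x))"
proof -
  have eq: "indicator {0<..} (0 + c * x) *\<^sub>R f (0 + c * x) = indicator {0<..} x *\<^sub>R f (c * x)" for x
    using assms by (auto simp: indicator_def zero_less_mult_iff)
  show "set_integrable lborel {0<..} (\<lambda>x. f (c * x)) \<longleftrightarrow> set_integrable lborel {0<..} f"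
    using lborel_integrable_real_affine_iff[of c "\<lambda>x. indicator {0<..} x *\<^sub>R f x" 0] assms
    unfolding eq set_integrable_def by simp
  show "(LBINT x:{0<..}. f x) = c *\<^sub>R (LBINT x:{0<..}. f (c * x))"
    using lborel_integral_real_affine[of c "\<lambda>x. indicator {0<..} x *\<^sub>R f x" 0] assms
    unfolding eq set_lebesgue_integral_def by simp
qed

text \<open>The maximum is attained at x = r / l and equals (r / l) powr r times exp (- r). The
  inequality ln y \<le> y - 1 at y = l x / r gives this value, and the factor exp (- r) is given
  away.\<close>

lemma powr_exp_le:
  fixes x r l :: real
  assumes "x > 0" "r > 0" "l > 0"
  shows "x powr r * exp (- l * x) \<le> (r / l) powr r"
proof -
  have "ln (l * x / r) \<le> l * x / r - 1"
    using assms by (intro ln_le_minus_one) auto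
  hence "r * ln (l * x / r) \<le> l * x - r"
    using assms by (simp add: field_simps)
  hence "r * ln x + - l * x \<le> r * ln (r / l)"
    using assms by (simp add: ln_mult ln_div algebra_simps)
  thus ?thesis
    using assms by (simp add: powr_def exp_add [symmetric])
qed

lemma Gamma_integral_scaled:
  fixes q l :: real
  assumes "q > 0" "l > 0"
  shows "set_integrable lborel {0<..} (\<lambda>x. x powr (q - 1) * exp (- l * x))"
    and "(LBINT x:{0<..}. x powr (q - 1) * exp (- l * x)) = Gamma q * l powr (- q)"
proof -
  have int: "set_integrable lborel {0<..} (\<lambda>x. x powr (q - 1) * exp (- l * x))" if "l > 0" for l
  proof (rule set_integrable_continuous_boundI[where a = "q - 1" and b = "-2"
        and C = "max 1 (((q + 1) / l) powr (q + 1))"])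
    show "continuous_on {0<..} (\<lambda>x. x powr (q - 1) * exp (- l * x))"
      by (auto intro!: continuous_intros)
    show "norm (x powr (q - 1) * exp (- l * x)) \<le> max 1 (((q + 1) / l) powr (q + 1)) * x powr (q - 1)"
      if "0 < x" for x
      using that \<open>l > 0\<close> mult_mono[of "x powr (q - 1)" "x powr (q - 1)" "exp (- l * x)" "max 1 (((q + 1) / l) powr (q + 1))"]
      by (auto simp: abs_mult mult_ac le_max_iff_disj)
    show "norm (x powr (q - 1) * exp (- l * x)) \<le> max 1 (((q + 1) / l) powr (q + 1)) * x powr - 2"
      if "1 \<le> x" for x
    proof -
      have "x powr (q - 1) * exp (- l * x) = (x powr (q + 1) * exp (- l * x)) * x powr -2"
        using that by (simp add: powr_add [symmetric])
      also have "\<dots> \<le> max 1 (((q + 1) / l) powr (q + 1)) * x powr -2"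
        using powr_exp_le[of x "q + 1" l] that \<open>l > 0\<close> assms by (intro mult_right_mono) auto
      finally show ?thesis by simp
    qed
  qed (use assms in auto)
  from int[OF assms(2)] show "set_integrable lborel {0<..} (\<lambda>x. x powr (q - 1) * exp (- l * x))" .
  have 1: "(LBINT x:{0<..}. x powr (q - 1) * exp (- 1 * x)) = Gamma q"
  proof -
    have "((\<lambda>t. t powr (q - 1) * exp (- 1 * t)) has_integral Gamma q) {0<..}"
    proof -
      have "((\<lambda>t. t powr (q - 1) / exp t) has_integral Gamma q) {0..}"
        using Gamma_integral_real[OF assms(1)] .
      then have "((\<lambda>t. t powr (q - 1) * exp (- 1 * t)) has_integral Gamma q) {0..}"
        by (rule has_integral_eq[rotated]) (auto simp: exp_minus divide_simps)
      then have "((\<lambda>t. if t \<in> {0<..} then t powr (q - 1) * exp (- 1 * t) else 0) has_integral Gamma q) {0..}"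
        by (rule has_integral_spike[of "{0}", rotated 2]) auto
      then show ?thesis by (subst (asm) has_integral_restrict) auto
    qed
    then show ?thesis
      using set_borel_integral_eq_integral(2)[OF int[of 1]] by (simp add: integral_unique)
  qed
  have "Gamma q = l *\<^sub>R (LBINT x:{0<..}. (l * x) powr (q - 1) * exp (- 1 * (l * x)))"
    using set_integral_Ioi_scale(2)[OF assms(2), of "\<lambda>x. x powr (q - 1) * exp (- 1 * x)"] 1 by simp
  also have "(LBINT x:{0<..}. (l * x) powr (q - 1) * exp (- 1 * (l * x))) =
             (LBINT x:{0<..}. l powr (q - 1) * (x powr (q - 1) * exp (- l * x)))"
    using assms by (intro set_lebesgue_integral_cong) (auto simp: powr_mult)
  also have "\<dots> = l powr (q - 1) * (LBINT x:{0<..}. x powr (q - 1) * exp (- l * x))"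
    by simp
  finally have "Gamma q = (l * l powr (q - 1)) * (LBINT x:{0<..}. x powr (q - 1) * exp (- l * x))" by simp
  moreover have "l * l powr (q - 1) = l powr q"
    using assms by (simp add: powr_diff)
  ultimately show "(LBINT x:{0<..}. x powr (q - 1) * exp (- l * x)) = Gamma q * l powr (- q)"
    using assms by (simp add: powr_minus field_simps)
qed

text \<open>A positive real factor does not change the argument, so the principal branch is
  multiplicative here.\<close>

lemma cpowr_of_real_mult:
  fixes l a :: real and u :: complex
  assumes "l > 0"
  shows "(of_real l * u) powr of_real a = of_real (l powr a) * u powr of_real a"
proof (cases "u = 0")
  case False
  then have "Ln (of_real l * u) = of_real (ln l) + Ln u"
    using assms by (simp add: Ln_times_of_real Ln_of_real)
  then show ?thesis
    using False assms
    by (simp add: powr_def distrib_left exp_add exp_of_real powr_def[of l] flip: of_real_mult)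
qed (use assms in auto)

text \<open>Instead of rotating a contour, z is written as l (1 - v) with l > 0 real and norm v < 1.
  Expanding exp (l x v) turns the integral into real Gamma integrals, and their sum is the binomial
  series of (1 - v) powr (- p). The same series at norm v is the sum of the L1 norms, which
  justifies the termwise integration.\<close>

lemma Gamma_integral_complex_scaled:
  fixes p :: real and z :: complex
  assumes p: "p > 0" and z: "Re z > 0"
  shows "set_integrable lborel {0<..} (\<lambda>x. of_real (x powr (p - 1)) * exp (- of_real x * z))" (is ?th1)
    and "(LBINT x:{0<..}. of_real (x powr (p - 1)) * exp (- of_real x * z)) =
           of_real (Gamma p) * z powr (- of_real p)" (is ?th2)
proof -
  let ?g = "\<lambda>x. of_real (x powr (p - 1)) * exp (- of_real x * z)"
  have cont: "continuous_on {0<..} ?g" by (auto intro!: continuous_intros)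
  show ?th1
  proof (rule set_integrable_bound[OF Gamma_integral_scaled(1)[OF p z]])
    show "set_borel_measurable lborel {0<..} ?g"
      using cont by (auto simp: set_borel_measurable_def intro!: borel_measurable_continuous_on_indicator)
  qed (auto simp: norm_mult)
  \<comment> \<open>The disc with centre l that passes through 0 contains z exactly if l > (norm
    z)^2 / (2 Re z); twice this threshold is taken.\<close>
  define l where "l = (norm z)\<^sup>2 / Re z"
  have nz: "z \<noteq> 0" using z by auto
  have l: "l > 0" using z nz by (auto simp: l_def)
  define v where "v = 1 - z / of_real l"
  have v: "norm v < 1"
  proof -
    have "(norm v)\<^sup>2 = 1 - 2 * Re z / l + (norm z)\<^sup>2 / l\<^sup>2"
      using l unfolding cmod_power2 by (simp add: v_def power2_eq_square field_simps)
    also have "(norm z)\<^sup>2 / l\<^sup>2 = Re z / l"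
      using l z nz by (simp add: l_def power2_eq_square field_simps)
    finally have "(norm v)\<^sup>2 = 1 - Re z / l" by simp
    also have "\<dots> < 1\<^sup>2" using l z by simp
    finally show ?thesis by (rule power_less_imp_less_base) simp
  qed
  have zl: "z = of_real l * (1 - v)" using l by (simp add: v_def)
  have Gpj: "Gamma (p + real j) = pochhammer p j * Gamma p" for j
    using pochhammer_Gamma[of p j] p Gamma_real_pos[OF p] nonpos_Ints_nonpos[of p]
    by (force simp: field_simps)
  have gch: "((- of_real p) gchoose j) * (- u) ^ j = of_real (pochhammer p j / fact j) * u ^ j" for j and u :: complex
    by (simp add: gbinomial_pochhammer pochhammer_of_real power_minus[of u] mult_ac)
  define f where "f = (\<lambda>j x. of_real (x powr (p - 1) * exp (- l * x)) * (of_real (l * x) * v) ^ j / fact j)"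
  define c where "c = (\<lambda>j. of_real (Gamma p * l powr - p * (pochhammer p j / fact j)) * v ^ j :: complex)"
  have rint: "set_integrable lborel {0<..} (\<lambda>x. x powr (p + real j - 1) * exp (- l * x))"
    "(LBINT x:{0<..}. x powr (p + real j - 1) * exp (- l * x)) = Gamma (p + j) * l powr (-p - j)" for j
    using Gamma_integral_scaled[of "p + real j" l] p l by (auto simp: algebra_simps)
  have feq: "f j x = of_real (x powr (p + real j - 1) * exp (- l * x)) * (of_real l * v) ^ j / fact j"
    if "x > 0" for j x
    using that by (simp add: f_def powr_add powr_diff powr_realpow power_mult_distrib)
  have fint: "set_integrable lborel {0<..} (f j)" for j
  proof -
    have "complex_set_integrable lborel {0<..} (\<lambda>x. of_real (x powr (p + real j - 1) * exp (- l * x)))"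
      using rint(1)[of j] unfolding set_integrable_def complex_of_real_integrable_eq
      by (simp add: scaleR_conv_of_real flip: of_real_mult)
    then show ?thesis
      using feq by (subst set_integrable_cong[OF refl refl feq]) (auto simp: divide_inverse)
  qed
  have lj: "l powr (- p - real j) * l ^ j = l powr (- p)" for j
    using l by (simp add: powr_diff powr_realpow)
  have fval: "(LBINT x:{0<..}. f j x) = c j" for j
  proof -
    have "(LBINT x:{0<..}. f j x) =
       (LBINT x:{0<..}. of_real (x powr (p + real j - 1) * exp (- l * x)) * ((of_real l * v) ^ j / fact j))"
      by (intro set_lebesgue_integral_cong) (auto simp: feq)
    also have "\<dots> = of_real (Gamma (p + j) * l powr (-p - j)) * ((of_real l * v) ^ j / fact j)"
      using rint(2)[of j] by (subst set_integral_mult_left, subst set_integral_complex_of_real) simp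
    also have "\<dots> = c j"
      using arg_cong[OF lj[of j], of complex_of_real]
      by (simp add: c_def Gpj power_mult_distrib field_simps)
    finally show ?thesis .
  qed
  have nval: "(LBINT x:{0<..}. norm (f j x)) = norm (c j)" for j
  proof -
    have "(LBINT x:{0<..}. norm (f j x)) =
       (LBINT x:{0<..}. (x powr (p + real j - 1) * exp (- l * x)) * ((l * norm v) ^ j / fact j))"
      using l by (intro set_lebesgue_integral_cong) (auto simp: feq norm_mult norm_divide norm_power)
    also have "\<dots> = Gamma (p + j) * l powr (-p - j) * ((l * norm v) ^ j / fact j)"
      using rint(2)[of j] by simp
    also have "\<dots> = norm (c j)"
      using lj[of j] p Gamma_real_pos[OF p] pochhammer_nonneg[OF p, of j]
      by (simp add: c_def Gpj power_mult_distrib norm_mult norm_power norm_divide abs_mult field_simps)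
    finally show ?thesis .
  qed
  have csum: "c sums (of_real (Gamma p) * z powr (- of_real p))"
  proof -
    have "(\<lambda>j. of_real (pochhammer p j / fact j) * v ^ j) sums (1 + (- v)) powr (- of_real p)"
      using gen_binomial_complex[of "- v" "- of_real p"] v by (simp only: norm_minus_cancel gch)
    then have "(\<lambda>j. of_real (Gamma p * l powr -p) * (of_real (pochhammer p j / fact j) * v ^ j)) sums
        (of_real (Gamma p * l powr -p) * (1 + (- v)) powr (- of_real p))"
      by (rule sums_mult)
    also have "of_real (Gamma p * l powr -p) * (1 + (- v)) powr (- of_real p) =
       of_real (Gamma p) * z powr (- of_real p)"
      using cpowr_of_real_mult[OF l, of "1 - v" "-p"] by (subst zl) simp
    finally show ?thesis by (simp add: c_def mult_ac)
  qed
  have csumm: "summable (\<lambda>j. norm (c j))"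
  proof -
    have "(\<lambda>j. of_real (pochhammer p j / fact j) * (of_real (norm v) :: complex) ^ j) sums (1 + (- of_real (norm v))) powr (- of_real p)"
      using gen_binomial_complex[of "- of_real (norm v)" "- of_real p"] v by (simp only: norm_minus_cancel gch) simp
    then have "summable (\<lambda>j. complex_of_real (pochhammer p j / fact j * (norm v) ^ j))"
      by (simp add: sums_iff)
    then have "summable (\<lambda>j. pochhammer p j / fact j * (norm v) ^ j)"
      by (simp only: summable_complex_of_real)
    then have "summable (\<lambda>j. (Gamma p * l powr -p) * (pochhammer p j / fact j * (norm v) ^ j))"
      by (rule summable_mult)
    also have "(\<lambda>j. (Gamma p * l powr -p) * (pochhammer p j / fact j * (norm v) ^ j)) = (\<lambda>j. norm (c j))"
      using p Gamma_real_pos[OF p] pochhammer_nonneg[OF p]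
      by (auto simp: c_def norm_mult norm_power norm_divide abs_mult)
    finally show ?thesis .
  qed
  have fsum: "(\<lambda>j. f j x) sums ?g x" if "x > 0" for x
  proof -
    have "(\<lambda>j. of_real (x powr (p - 1) * exp (- l * x)) * ((of_real (l * x) * v) ^ j /\<^sub>R fact j)) sums
        (of_real (x powr (p - 1) * exp (- l * x)) * exp (of_real (l * x) * v))"
      by (intro sums_mult exp_converges)
    also have "of_real (x powr (p - 1) * exp (- l * x)) * exp (of_real (l * x) * v) =
        of_real (x powr (p - 1)) * exp (of_real (- l * x) + of_real (l * x) * v)"
      by (simp only: exp_add exp_of_real [symmetric] of_real_mult [of "x powr (p - 1)"] mult.assoc)
    also have "of_real (- l * x) + of_real (l * x) * v = - of_real x * z"
      by (subst zl) (simp add: algebra_simps)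
    finally show ?thesis by (simp add: f_def scaleR_conv_of_real divide_inverse mult_ac)
  qed
  have fnsum: "summable (\<lambda>j. norm (f j x))" if "x > 0" for x
  proof -
    have "summable (\<lambda>j. norm (of_real (x powr (p - 1) * exp (- l * x)) :: complex) * ((norm (of_real (l * x) * v)) ^ j /\<^sub>R fact j))"
      by (intro summable_mult summable_exp_generic)
    then show ?thesis by (simp add: f_def norm_mult norm_inverse norm_power divide_inverse mult_ac)
  qed
  have "(\<lambda>j. LBINT x:{0<..}. f j x) sums (LBINT x:{0<..}. (\<Sum>j. f j x))"
    by (rule set_lebesgue_integral_sums(2)[OF fint fnsum _ csumm]) (auto simp: nval)
  moreover have "(LBINT x:{0<..}. (\<Sum>j. f j x)) = (LBINT x:{0<..}. ?g x)"
    using fsum by (intro set_lebesgue_integral_cong) (auto simp: sums_iff)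
  ultimately show ?th2
    using csum by (simp add: fval sums_iff)
qed

section \<open>Trapezoidal Poisson summation\<close>

text \<open>In polar form, 1 - cis t = 2 sin (t / 2) cis ((t - pi) / 2). The first factor is
  positive and the angle lies strictly between - pi / 2 and pi / 2, so the principal logarithm reads
  it off.\<close>

lemma Im_Ln_one_minus_cis:
  assumes "0 < t" "t < 2 * pi"
  shows "Im (Ln (1 - cis t)) = (t - pi) / 2"
proof -
  have "1 - cis t = of_real (2 * sin (t / 2)) * cis ((t - pi) / 2)"
  proof (rule complex_eqI)
    have "cos ((t - pi) / 2) = sin (t / 2)" "sin ((t - pi) / 2) = - cos (t / 2)"
      by (simp_all add: diff_divide_distrib cos_diff sin_diff)
    moreover have "cos t = 1 - 2 * (sin (t / 2))\<^sup>2" "sin t = 2 * sin (t / 2) * cos (t / 2)"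
      using cos_double_sin[of "t / 2"] sin_double[of "t / 2"] by simp_all
    ultimately show "Re (1 - cis t) = Re (of_real (2 * sin (t / 2)) * cis ((t - pi) / 2))"
      "Im (1 - cis t) = Im (of_real (2 * sin (t / 2)) * cis ((t - pi) / 2))"
      by (simp_all add: power2_eq_square)
  qed
  moreover have "sin (t / 2) > 0" using assms by (intro sin_gt_zero) auto
  ultimately have "Ln (1 - cis t) = of_real (ln (2 * sin (t / 2))) + Ln (cis ((t - pi) / 2))"
    by (simp add: Ln_times_of_real Ln_of_real del: of_real_mult)
  also have "Ln (cis ((t - pi) / 2)) = \<i> * of_real ((t - pi) / 2)"
    unfolding cis_conv_exp using assms by (intro Ln_exp) (auto simp: field_simps)
  finally show ?thesis by simp
qed

lemma cis_series_term:
  fixes t :: real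
  shows "- (of_real (q ^ Suc n) * cis (real (Suc n) * t) / of_nat (Suc n)) =
         - of_real (q ^ Suc n / real (Suc n)) * cis (real (Suc n) * t)"
  by (metis mult_minus_left of_real_divide of_real_of_nat_eq times_divide_eq_left)

lemma has_vector_derivative_cis_scaled:
  "((\<lambda>t. cis (a * t)) has_vector_derivative (\<i> * of_real a * cis (a * t))) (at t)"
proof -
  have "((\<lambda>t. exp (\<i> * of_real a * t)) has_field_derivative
          \<i> * of_real a * exp (\<i> * of_real a * of_real t)) (at (of_real t))"
    by (auto intro!: derivative_eq_intros)
  from has_vector_derivative_real_field[OF this] show ?thesis
    by (simp add: cis_conv_exp mult_ac)
qed

text \<open>The logarithmic series is integrated term by term from 0 to \<theta> and its imaginary
  part is taken. The damping q < 1 dominates it by a geometric series, uniformly in t.\<close>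

lemma one_minus_cis_series_integral:
  fixes q \<theta> :: real
  assumes q: "0 < q" "q < 1" and \<theta>: "0 < \<theta>"
  shows "(\<lambda>n. q ^ Suc n * (cos (Suc n * \<theta>) - 1) / (Suc n)\<^sup>2) sums
           (LBINT t:{0<..<\<theta>}. Im (Ln (1 - of_real q * cis t)))"
proof -
  define f :: "nat \<Rightarrow> real \<Rightarrow> complex" where "f = (\<lambda>n t. - ((of_real q * cis t) ^ Suc n / of_nat (Suc n)))"
  have fsum: "(\<lambda>n. f n t) sums Ln (1 - of_real q * cis t)" for t
  proof -
    have "(\<lambda>n. - ((- (- of_real q * cis t)) ^ n) / of_nat n) sums ln (1 + (- of_real q * cis t))"
      using q by (intro Ln_series') (auto simp: norm_mult)
    from sums_split_initial_segment[OF this, of 1] show ?thesis by (simp add: f_def)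
  qed
  have feq: "f n t = - of_real (q ^ Suc n / Suc n) * cis (real (Suc n) * t)" for n and t :: real
  proof -
    have "(of_real q * cis t) ^ Suc n = of_real (q ^ Suc n) * cis (real (Suc n) * t)"
      unfolding power_mult_distrib Complex.DeMoivre of_real_power ..
    then have "f n t = - (of_real (q ^ Suc n) * cis (real (Suc n) * t) / of_nat (Suc n))"
      by (metis f_def)
    then show ?thesis by (simp only: cis_series_term)
  qed
  have nf: "norm (f n t) \<le> q ^ Suc n" for n and t :: real
  proof -
    have "norm (f n t) = q ^ Suc n / Suc n"
      using q unfolding feq norm_mult norm_minus_cancel norm_of_real norm_cis by simp
    also have "\<dots> \<le> q ^ Suc n / 1" using q by (intro divide_left_mono) auto
    finally show ?thesis by simp
  qed
  have cont: "continuous_on A (f n)" for A n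
    unfolding feq by (intro continuous_intros continuous_on_cis)
  have fint: "set_integrable lborel {0<..<\<theta>} (f n)" for n
    by (rule set_integrable_subset[OF borel_integrable_atLeastAtMost'[OF cont, of 0 \<theta>]]) auto
  have val: "(LBINT t:{0<..<\<theta>}. f n t) = - of_real (q ^ Suc n / (Suc n)\<^sup>2) * (cis (real (Suc n) * \<theta>) - 1) / \<i>" for n
  proof -
    let ?F = "\<lambda>t. (- of_real (q ^ Suc n / (real (Suc n))\<^sup>2) / \<i>) * cis (real (Suc n) * t)"
    have "(?F has_vector_derivative f n t) (at t)" for t
    proof -
      have "(- of_real (q ^ Suc n / (real (Suc n))\<^sup>2) / \<i>) * (\<i> * of_real (real (Suc n)) * cis (real (Suc n) * t)) = f n t"
      proof -
        have "(- complex_of_real (a / (r\<^sup>2)) / \<i>) * (\<i> * of_real r * z) = - of_real (a / r) * z" for a r z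
          by (simp add: power2_eq_square field_simps)
        then show ?thesis by (simp only: feq)
      qed
      with has_vector_derivative_mult_right[OF has_vector_derivative_cis_scaled[of "real (Suc n)" t]]
      show ?thesis by metis
    qed
    note F = this
    have "continuous_on UNIV ?F" by (intro continuous_intros continuous_on_cis)
    then have lim: "(?F \<longlongrightarrow> ?F x) (at x within S)" for x S
      by (metis UNIV_I continuous_on_def tendsto_within_subset subset_UNIV)
    have "(LBINT t:{0<..<\<theta>}. f n t) = ?F \<theta> - ?F 0"
      by (rule FTC_Ioo[OF \<theta> F cont fint lim lim])
    also have "\<dots> = (- of_real (q ^ Suc n / (real (Suc n))\<^sup>2) / \<i>) * (cis (real (Suc n) * \<theta>) - 1)"
      by (simp only: right_diff_distrib mult_zero_right cis_zero)
    finally show ?thesis by (simp only: times_divide_eq_left of_nat_power)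
  qed
  have sumq0: "summable (\<lambda>n. q ^ Suc n)"
    using summable_geometric[of q] q by (simp add: summable_Suc_iff del: power_Suc)
  have sumq: "summable (\<lambda>n. q ^ Suc n * \<theta>)"
    by (intro summable_mult2 sumq0)
  have "(\<lambda>n. LBINT t:{0<..<\<theta>}. f n t) sums (LBINT t:{0<..<\<theta>}. (\<Sum>n. f n t))"
  proof (rule set_lebesgue_integral_sums(2)[OF fint _ _ sumq])
    show "summable (\<lambda>n. norm (f n t))" for t
      by (rule summable_comparison_test'[OF sumq0]) (use nf in simp)
    show "(LBINT t:{0<..<\<theta>}. norm (f n t)) \<le> q ^ Suc n * \<theta>" for n
    proof -
      have "(LBINT t:{0<..<\<theta>}. norm (f n t)) \<le> (LBINT t:{0<..<\<theta>}. q ^ Suc n)"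
      proof (rule set_integral_mono)
        show "set_integrable lborel {0<..<\<theta>} (\<lambda>t. q ^ Suc n)"
          by (rule set_integrable_subset[OF borel_integrable_atLeastAtMost'[of 0 \<theta>]]) auto
      qed (rule set_integrable_norm[OF fint] nf)+
      also have "\<dots> = q ^ Suc n * \<theta>" using \<theta> by (simp add: set_integral_const)
      finally show ?thesis .
    qed
  qed
  then have "(\<lambda>n. Im (LBINT t:{0<..<\<theta>}. f n t)) sums Im (LBINT t:{0<..<\<theta>}. (\<Sum>n. f n t))"
    by (rule sums_Im)
  also have "(\<lambda>n. Im (LBINT t:{0<..<\<theta>}. f n t)) = (\<lambda>n. q ^ Suc n * (cos (Suc n * \<theta>) - 1) / (Suc n)\<^sup>2)"
  proof (rule ext)
    fix n :: nat
    have "Im (- of_real r * (z - 1) / \<i>) = r * (Re z - 1)" for r z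
      by (simp add: Im_divide)
    then show "Im (LBINT t:{0<..<\<theta>}. f n t) = q ^ Suc n * (cos (Suc n * \<theta>) - 1) / (Suc n)\<^sup>2"
      unfolding val by (simp only: cis.simps times_divide_eq_left)
  qed
  also have "(\<lambda>t. \<Sum>n. f n t) = (\<lambda>t. Ln (1 - of_real q * cis t))"
    using fsum by (auto simp: sums_iff)
  also have "Im (LBINT t:{0<..<\<theta>}. Ln (1 - of_real q * cis t)) = (LBINT t:{0<..<\<theta>}. Im (Ln (1 - of_real q * cis t)))"
  proof -
    have "set_integrable lborel {0<..<\<theta>} (\<lambda>t. Ln (1 - of_real q * cis t))"
    proof (rule set_integrable_subset[OF borel_integrable_atLeastAtMost'[of 0 \<theta>]])
      show "continuous_on {0..\<theta>} (\<lambda>t. Ln (1 - of_real q * cis t))"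
      proof (intro continuous_intros continuous_on_cis)
        show "1 - of_real q * cis t \<notin> \<real>\<^sub>\<le>\<^sub>0" for t
        proof -
          have "q * cos t < 1"
            using q mult_left_mono[of "cos t" 1 q] cos_le_one[of t] by linarith
          then show ?thesis using q by (auto simp: complex_nonpos_Reals_iff)
        qed
      qed
    qed auto
    then show ?thesis
      unfolding set_integrable_def set_lebesgue_integral_def
      by (subst integral_Im [symmetric]) auto
  qed
  finally show ?thesis .
qed

text \<open>The limit q to 1 in the damped identity. For the series Tannery's theorem applies with
  the majorant 2 / n^2; for the integral dominated convergence applies with the majorant pi, as the
  imaginary part of a principal logarithm is at most pi in absolute value. The integral of (t - pi)
  / 2 gives the terms in \<theta>, and the Basel sum restores the constant term.\<close>

lemma cos_series_quadratic:
  fixes \<theta> :: real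
  assumes \<theta>: "0 \<le> \<theta>" "\<theta> \<le> 2 * pi"
  shows "(\<lambda>n. cos (Suc n * \<theta>) / (Suc n)\<^sup>2) sums (pi\<^sup>2 / 6 + \<theta>\<^sup>2 / 4 - pi * \<theta> / 2)"
proof (cases "\<theta> = 0")
  case True
  then show ?thesis using inverse_squares_sums by (simp add: add_ac)
next
  case False
  then have \<theta>: "0 < \<theta>" "\<theta> \<le> 2 * pi" using assms by auto
  define q where "q = (\<lambda>j. 1 - 1 / (real j + 2))"
  have q: "0 < q j" "q j < 1" for j by (auto simp: q_def field_simps)
  have qlim: "q \<longlonglongrightarrow> 1" unfolding q_def by real_asymp
  have sq: "summable (\<lambda>n. 1 / (real (Suc n))\<^sup>2)"
    using inverse_squares_sums by (auto simp: sums_iff add_ac)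
  define a where "a = (\<lambda>n (j::nat). q j ^ Suc n * (cos (Suc n * \<theta>) - 1) / (Suc n)\<^sup>2)"
  have lim1: "(\<lambda>j. \<Sum>n. a n j) \<longlonglongrightarrow> (\<Sum>n. (cos (Suc n * \<theta>) - 1) / (Suc n)\<^sup>2)"
  proof (rule tannerys_theorem[THEN conjunct2, THEN conjunct2])
    show "summable (\<lambda>n. 2 * (1 / (real (Suc n))\<^sup>2))" by (intro summable_mult sq)
    have "norm (a n j) \<le> 2 * (1 / (real (Suc n))\<^sup>2)" for n j
    proof -
      have "norm (a n j) = q j ^ Suc n * \<bar>cos (Suc n * \<theta>) - 1\<bar> * (1 / (real (Suc n))\<^sup>2)"
        using q[of j] by (simp add: a_def abs_mult del: of_nat_Suc power_Suc)
      also have "\<dots> \<le> 1 * 2 * (1 / (real (Suc n))\<^sup>2)"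
      proof (intro mult_mono power_le_one)
        show "\<bar>cos (Suc n * \<theta>) - 1\<bar> \<le> 2"
          using cos_ge_minus_one[of "Suc n * \<theta>"] cos_le_one[of "Suc n * \<theta>"] by linarith
      qed (use q[of j] in auto)
      finally show ?thesis by simp
    qed
    then show "\<forall>\<^sub>F (k, n) in sequentially \<times>\<^sub>F sequentially. norm (a k n) \<le> 2 * (1 / (real (Suc k))\<^sup>2)"
      by (intro always_eventually) auto
    show "a n \<longlonglongrightarrow> (cos (Suc n * \<theta>) - 1) / (Suc n)\<^sup>2" for n
      unfolding a_def using qlim by (auto intro!: tendsto_eq_intros simp del: power_Suc)
  qed auto
  have eq: "(\<Sum>n. a n j) = (LBINT t:{0<..<\<theta>}. Im (Ln (1 - of_real (q j) * cis t)))" for j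
    using one_minus_cis_series_integral[OF q[of j] \<theta>(1)] by (simp add: a_def sums_iff)
  have lim2: "(\<lambda>j. LBINT t:{0<..<\<theta>}. Im (Ln (1 - of_real (q j) * cis t))) \<longlonglongrightarrow> (LBINT t:{0<..<\<theta>}. (t - pi) / 2)"
    unfolding set_lebesgue_integral_def
  proof (rule integral_dominated_convergence[where w = "\<lambda>t. indicator {0<..<\<theta>} t * pi"])
    show "integrable lborel (\<lambda>t. indicat_real {0<..<\<theta>} t * pi)"
      using \<theta> by (intro integrable_mult_left integrable_real_indicator) auto
    show "(\<lambda>t. indicat_real {0<..<\<theta>} t *\<^sub>R ((t - pi) / 2)) \<in> borel_measurable lborel" by measurable
    show "(\<lambda>t. indicat_real {0<..<\<theta>} t *\<^sub>R Im (Ln (1 - of_real (q j) * cis t))) \<in> borel_measurable lborel" for j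
      unfolding cis_conv_exp by measurable
    show "AE t in lborel. norm (indicat_real {0<..<\<theta>} t *\<^sub>R Im (Ln (1 - of_real (q j) * cis t)))
            \<le> indicat_real {0<..<\<theta>} t * pi" for j
    proof (intro AE_I2)
      fix t
      have "q j * cos t < 1"
        using q[of j] mult_left_mono[of "cos t" 1 "q j"] cos_le_one[of t] by linarith
      then have "1 - of_real (q j) * cis t \<noteq> 0" by (auto simp: complex_eq_iff)
      then show "norm (indicat_real {0<..<\<theta>} t *\<^sub>R Im (Ln (1 - of_real (q j) * cis t)))
            \<le> indicat_real {0<..<\<theta>} t * pi"
        using mpi_less_Im_Ln[of "1 - of_real (q j) * cis t"] Im_Ln_le_pi[of "1 - of_real (q j) * cis t"]
        by (auto simp: indicator_def)
    qed
    show "AE t in lborel. (\<lambda>j. indicat_real {0<..<\<theta>} t *\<^sub>R Im (Ln (1 - of_real (q j) * cis t)))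
            \<longlonglongrightarrow> indicat_real {0<..<\<theta>} t *\<^sub>R ((t - pi) / 2)"
    proof (intro AE_I2)
      fix t
      show "(\<lambda>j. indicat_real {0<..<\<theta>} t *\<^sub>R Im (Ln (1 - of_real (q j) * cis t)))
            \<longlonglongrightarrow> indicat_real {0<..<\<theta>} t *\<^sub>R ((t - pi) / 2)"
      proof (cases "t \<in> {0<..<\<theta>}")
        case True
        then have t: "0 < t" "t < 2 * pi" using \<theta> by auto
        have "cos t < 1"
          using cos_double_sin[of "t / 2"] sin_gt_zero[of "t / 2"] t by simp
        then have "1 - cis t \<notin> \<real>\<^sub>\<le>\<^sub>0" by (auto simp: complex_nonpos_Reals_iff)
        then have "(\<lambda>j. Im (Ln (1 - of_real (q j) * cis t))) \<longlonglongrightarrow> Im (Ln (1 - of_real 1 * cis t))"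
          using qlim by (intro tendsto_intros) auto
        then show ?thesis using True Im_Ln_one_minus_cis[OF t] by simp
      qed auto
    qed
  qed
  have val: "(LBINT t:{0<..<\<theta>}. (t - pi) / 2) = \<theta>\<^sup>2 / 4 - pi * \<theta> / 2"
  proof -
    have "(LBINT t:{0<..<\<theta>}. complex_of_real ((t - pi) / 2)) =
       of_real (\<theta>\<^sup>2 / 4 - pi * \<theta> / 2) - of_real (0\<^sup>2 / 4 - pi * 0 / 2)"
    proof (rule FTC_Ioo[OF \<theta>(1)])
      show "((\<lambda>t. complex_of_real (t\<^sup>2 / 4 - pi * t / 2)) has_vector_derivative
              complex_of_real ((t - pi) / 2)) (at t)" for t
        by (rule has_vector_derivative_of_real)
           (auto intro!: derivative_eq_intros simp: field_simps)
      show "set_integrable lborel {0<..<\<theta>} (\<lambda>t. complex_of_real ((t - pi) / 2))"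
        by (rule set_integrable_subset[OF borel_integrable_atLeastAtMost'[of 0 \<theta>]]) (auto intro!: continuous_intros)
    qed (auto intro!: continuous_intros tendsto_eq_intros)
    then show ?thesis by (simp only: set_integral_complex_of_real of_real_eq_iff flip: of_real_diff) simp
  qed
  have "(\<Sum>n. (cos (Suc n * \<theta>) - 1) / (Suc n)\<^sup>2) = \<theta>\<^sup>2 / 4 - pi * \<theta> / 2"
    using LIMSEQ_unique[OF lim1 lim2[folded eq]] val by simp
  moreover have "summable (\<lambda>n. (cos (Suc n * \<theta>) - 1) / (real (Suc n))\<^sup>2)"
  proof (rule summable_comparison_test'[OF summable_mult[OF sq, of 2]])
    fix n :: nat
    have "\<bar>cos (Suc n * \<theta>) - 1\<bar> \<le> 2"
      using cos_ge_minus_one[of "Suc n * \<theta>"] cos_le_one[of "Suc n * \<theta>"] by linarith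
    then have "\<bar>cos (Suc n * \<theta>) - 1\<bar> / (real (Suc n))\<^sup>2 \<le> 2 / (real (Suc n))\<^sup>2"
      by (intro divide_right_mono) auto
    then show "norm ((cos (Suc n * \<theta>) - 1) / (real (Suc n))\<^sup>2) \<le> 2 * (1 / (real (Suc n))\<^sup>2)"
      by (simp del: of_nat_Suc)
  qed
  ultimately have "(\<lambda>n. (cos (Suc n * \<theta>) - 1) / (Suc n)\<^sup>2) sums (\<theta>\<^sup>2 / 4 - pi * \<theta> / 2)"
    by (simp add: sums_iff)
  from sums_add[OF this inverse_squares_sums] show ?thesis
    by (simp add: diff_divide_distrib add_ac add_diff_eq)
qed

text \<open>Half the difference between \<open>1 / 6\<close> and the second periodic Bernoulli function: integrating
  \<open>bern * f''\<close> by parts over a unit interval gives the error of the trapezoidal rule.\<close>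

definition bern :: "real \<Rightarrow> real" where "bern x = (frac x - (frac x)\<^sup>2) / 2"

lemma bern_nonneg: "bern x \<ge> 0" and bern_le: "bern x \<le> 1 / 8"
proof -
  have f: "0 \<le> frac x" "frac x < 1" by (auto simp: frac_ge_0 frac_lt_1)
  then have "(frac x)\<^sup>2 \<le> frac x * 1" unfolding power2_eq_square by (intro mult_left_mono) auto
  then show "bern x \<ge> 0" by (simp add: bern_def)
  have "0 \<le> (frac x - 1 / 2)\<^sup>2" by simp
  then show "bern x \<le> 1 / 8" by (simp add: bern_def power2_eq_square algebra_simps)
qed

lemma borel_measurable_bern [measurable]: "bern \<in> borel_measurable borel"
  unfolding bern_def [abs_def] frac_def by measurable

text \<open>The quadratic cosine series at \<theta> = 2 pi frac x, divided by 2 pi^2. The constant 1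
  / 12 is the mean of \<open>bern\<close> over a period.\<close>

lemma bern_fourier:
  "(\<lambda>l. cos (2 * pi * Suc l * x) / (2 * pi\<^sup>2 * (Suc l)\<^sup>2)) sums (1 / 12 - bern x)"
proof -
  have sm: "(\<lambda>n. cos (Suc n * (2 * pi * frac x)) / (Suc n)\<^sup>2) sums (pi\<^sup>2 / 6 + (2 * pi * frac x)\<^sup>2 / 4 - pi * (2 * pi * frac x) / 2)"
    using frac_ge_0[of x] frac_lt_1[of x] by (intro cos_series_quadratic) auto
  have "(\<lambda>n. cos (Suc n * (2 * pi * frac x)) / (Suc n)\<^sup>2 / (2 * pi\<^sup>2)) sums (1 / 12 - bern x)"
  proof -
    have "(pi\<^sup>2 / 6 + (2 * pi * u)\<^sup>2 / 4 - pi * (2 * pi * u) / 2) / (2 * pi\<^sup>2) = 1 / 12 - (u - u\<^sup>2) / 2" for u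
      by (simp add: power2_eq_square add_divide_distrib diff_divide_distrib)
    from sums_divide[OF sm, of "2 * pi\<^sup>2", unfolded this] show ?thesis
      by (simp add: bern_def mult_ac)
  qed
  moreover have "cos (Suc n * (2 * pi * frac x)) = cos (2 * pi * Suc n * x)" for n
  proof -
    have "Suc n * (2 * pi * frac x) = 2 * pi * Suc n * x + of_int (- (int (Suc n) * \<lfloor>x\<rfloor>)) * (2 * pi)"
      by (simp add: frac_def algebra_simps)
    also have "\<dots> = 2 * pi * Suc n * x + 2 * pi * of_int (- (int (Suc n) * \<lfloor>x\<rfloor>))"
      by (simp only: mult.commute)
    finally show ?thesis
      by (simp only: cos_add cos_int_2pin sin_int_2pin mult_zero_right mult_1_right diff_zero)
  qed
  ultimately show ?thesis by (simp add: mult_ac del: of_nat_Suc)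
qed

lemma tendsto_set_integral_Ioo_at_top:
  fixes f :: "real \<Rightarrow> complex"
  assumes f: "set_integrable lborel {0<..} f"
  shows "((\<lambda>X. LBINT x:{0<..<X}. f x) \<longlongrightarrow> (LBINT x:{0<..}. f x)) at_top"
  unfolding set_lebesgue_integral_def
proof (rule integral_dominated_convergence_at_top)
  show "integrable lborel (\<lambda>x. norm (indicator {0<..} x *\<^sub>R f x))"
    using f unfolding set_integrable_def by (rule integrable_norm)
  show "(\<lambda>x. indicat_real {0<..} x *\<^sub>R f x) \<in> borel_measurable lborel"
    using f unfolding set_integrable_def by auto
  show "(\<lambda>x. indicat_real {0<..<X} x *\<^sub>R f x) \<in> borel_measurable lborel" for X
  proof -
    have "set_integrable lborel {0<..<X} f" by (rule set_integrable_subset[OF f]) auto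
    then show ?thesis by (auto simp: set_integrable_def)
  qed
  show "AE x in lborel. ((\<lambda>X. indicat_real {0<..<X} x *\<^sub>R f x) \<longlongrightarrow> indicat_real {0<..} x *\<^sub>R f x) at_top"
  proof (rule AE_I2)
    fix x :: real
    show "((\<lambda>X. indicat_real {0<..<X} x *\<^sub>R f x) \<longlongrightarrow> indicat_real {0<..} x *\<^sub>R f x) at_top"
      using eventually_gt_at_top[of x]
      by (intro tendsto_eventually) (auto elim!: eventually_mono simp: indicator_def)
  qed
qed (auto simp: indicator_def)

lemma tendsto_set_integral_Ioo_sequentially:
  fixes f :: "real \<Rightarrow> complex"
  assumes "set_integrable lborel {0<..} f"
  shows "(\<lambda>n. LBINT x:{0<..<real n}. f x) \<longlonglongrightarrow> (LBINT x:{0<..}. f x)"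
  by (rule filterlim_compose[OF tendsto_set_integral_Ioo_at_top[OF assms] filterlim_real_sequentially])

lemma set_integral_Ioo_Suc:
  fixes f :: "real \<Rightarrow> complex"
  assumes f: "set_integrable lborel {0<..} f"
  shows "(LBINT x:{0<..<real (Suc n)}. f x) = (LBINT x:{0<..<real n}. f x) + (LBINT x:{real n<..<real (Suc n)}. f x)"
proof -
  have "interval_lebesgue_integrable lborel (min (ereal 0) (min (ereal n) (ereal (Suc n)))) (max (ereal 0) (max (ereal n) (ereal (Suc n)))) f"
  proof -
    have "set_integrable lborel {0<..<real (Suc n)} f" by (rule set_integrable_subset[OF f]) auto
    then show ?thesis by (auto simp: interval_lebesgue_integrable_def min_def max_def)
  qed
  from interval_integral_sum[OF this] show ?thesis
    by (simp add: interval_integral_Ioo)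
qed

lemma set_borel_measurable_continuous:
  fixes f :: "real \<Rightarrow> 'a :: {banach, second_countable_topology}"
  assumes "continuous_on {0<..} f"
  shows "set_borel_measurable lborel {0<..} f"
  using assms by (auto simp: set_borel_measurable_def intro!: borel_measurable_continuous_on_indicator)

text \<open>A class of functions for which Poisson summation on the half-line has no boundary terms:
  f and f' vanish at 0 and at infinity, and \<open>f 0 = 0\<close> removes the half end term of the
  trapezoidal sum at 0. It is instantiated by x powr (s - 1) exp (- x z) and by x powr (-5/2) exp (-
  B / x).\<close>

locale halfline_C2 =
  fixes f f1 f2 :: "real \<Rightarrow> complex"
  assumes d1: "\<And>x. x > 0 \<Longrightarrow> (f has_vector_derivative f1 x) (at x)"
    and d2: "\<And>x. x > 0 \<Longrightarrow> (f1 has_vector_derivative f2 x) (at x)"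
    and cont2: "continuous_on {0<..} f2"
    and int: "set_integrable lborel {0<..} f"
    and int2: "set_integrable lborel {0<..} f2"
    and lim0: "(f \<longlongrightarrow> 0) (at_right 0)" and lim1_0: "(f1 \<longlongrightarrow> 0) (at_right 0)"
    and lim_top: "(f \<longlongrightarrow> 0) at_top" and lim1_top: "(f1 \<longlongrightarrow> 0) at_top"
    and zero: "f 0 = 0"
begin

lemma cont: "continuous_on {0<..} f"
  using d1 by (auto intro!: continuous_at_imp_continuous_on has_vector_derivative_continuous)

lemma int_bern: "set_integrable lborel {0<..} (\<lambda>x. of_real (bern x) * f2 x)"
proof (rule set_integrable_bound[OF int2])
  have "(\<lambda>x. indicator {0<..} x *\<^sub>R f2 x) \<in> borel_measurable lborel"
    using int2 by (auto simp: set_integrable_def)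
  then have "(\<lambda>x. of_real (bern x) * (indicator {0<..} x *\<^sub>R f2 x)) \<in> borel_measurable lborel"
    by measurable
  then show "set_borel_measurable lborel {0<..} (\<lambda>x. of_real (bern x) * f2 x)"
    by (simp add: set_borel_measurable_def)
  show "AE x in lborel. x \<in> {0<..} \<longrightarrow> norm (of_real (bern x) * f2 x) \<le> norm (f2 x)"
  proof (intro AE_I2 impI)
    fix x :: real
    have "bern x * norm (f2 x) \<le> 1 * norm (f2 x)"
      using bern_le[of x] by (intro mult_right_mono) auto
    then show "norm (of_real (bern x) * f2 x) \<le> norm (f2 x)"
      using bern_nonneg[of x] by (simp add: norm_mult)
  qed
qed

text \<open>Two integrations by parts over a unit interval, combined into one
  antiderivative.\<close>

lemma trapezoid_step:
  "(LBINT x:{real d<..<real (Suc d)}. of_real (bern x) * f2 x) =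
     f d / 2 + f (Suc d) / 2 - (LBINT x:{real d<..<real (Suc d)}. f x)"
proof -
  define I where "I = {real d<..<real (Suc d)}"
  have sub: "I \<subseteq> {0<..}" by (auto simp: I_def)
  define b where "b = (\<lambda>x. (x - real d - (x - real d)\<^sup>2) / 2)"
  have bb: "bern x = b x" if "x \<in> I" for x
  proof -
    have "frac x = x - real d"
      using that by (auto simp: I_def frac_unique_iff)
    then show ?thesis by (simp add: b_def bern_def)
  qed
  have i2: "set_integrable lborel I (\<lambda>x. of_real (b x) * f2 x)"
    using set_integrable_subset[OF int_bern _ sub]
    by (subst set_integrable_cong[where f' = "\<lambda>x. of_real (bern x) * f2 x"]) (auto simp: bb I_def)
  have i0: "set_integrable lborel I f"
    using set_integrable_subset[OF int _ sub] by (auto simp: I_def)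
  \<comment> \<open>The value of the limit is irrelevant: in the antiderivative f' is multiplied by
    \<open>b\<close>, which vanishes at both ends of the interval. Only a finite limit has to exist,
    also at d = 0.\<close>
  have "\<exists>L. (f1 \<longlongrightarrow> L) (at_right (real d))"
  proof (cases "d = 0")
    case False
    then have "isCont f1 (real d)" using d2[of "real d"] has_vector_derivative_continuous by auto
    then show ?thesis by (auto simp: isCont_def intro: tendsto_within_subset)
  qed (use lim1_0 in auto)
  then obtain L where L: "(f1 \<longlongrightarrow> L) (at_right (real d))" ..
  have fd: "(f \<longlongrightarrow> f (real d)) (at_right (real d))"
  proof (cases "d = 0")
    case False
    then have "isCont f (real d)" using d1[of "real d"] has_vector_derivative_continuous by auto
    then show ?thesis by (auto simp: isCont_def intro: tendsto_within_subset)
  qed (use lim0 zero in auto)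
  have "isCont f (real (Suc d))" "isCont f1 (real (Suc d))"
    using d1[of "real (Suc d)"] d2[of "real (Suc d)"] has_vector_derivative_continuous by fastforce+
  then have fSd: "(f \<longlongrightarrow> f (real (Suc d))) (at_left (real (Suc d)))"
      "(f1 \<longlongrightarrow> f1 (real (Suc d))) (at_left (real (Suc d)))"
    by (auto simp only: isCont_def intro: tendsto_within_subset)
  \<comment> \<open>This is b f' - b' f, whose derivative is b f'' + f because b'' = -1. At the left
    and right end b' is 1/2 and -1/2, which leaves the two half end values.\<close>
  let ?F = "\<lambda>x. of_real (b x) * f1 x - of_real (1 / 2 - (x - real d)) * f x"
  have "(LBINT x:I. of_real (b x) * f2 x + f x) = f (Suc d) / 2 - (- (f d / 2))"
    unfolding I_def
  proof (rule FTC_Ioo)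
    show "real d < real (Suc d)" by simp
    fix x assume "real d < x" "x < real (Suc d)"
    then have x: "x > 0" by linarith
    have b': "(b has_real_derivative (1 / 2 - (x - real d))) (at x)"
      unfolding b_def
      by (auto intro!: derivative_eq_intros simp: field_simps)
    have b'': "((\<lambda>x. 1 / 2 - (x - real d)) has_real_derivative (-1)) (at x)"
      by (auto intro!: derivative_eq_intros)
    have "(?F has_vector_derivative
       (of_real (b x) * f2 x + of_real (1 / 2 - (x - real d)) * f1 x) -
       (of_real (1 / 2 - (x - real d)) * f1 x + of_real (-1) * f x)) (at x)"
      by (intro has_vector_derivative_diff has_vector_derivative_mult d1 d2 x
            has_vector_derivative_of_real b' b'')
    then show "(?F has_vector_derivative of_real (b x) * f2 x + f x) (at x)"
      by simp
  next
    show "continuous_on {real d<..<real (Suc d)} (\<lambda>x. of_real (b x) * f2 x + f x)"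
      using sub unfolding I_def b_def
      by (intro continuous_intros continuous_on_subset[OF cont2] continuous_on_subset[OF cont]) auto
    show "set_integrable lborel {real d<..<real (Suc d)} (\<lambda>x. of_real (b x) * f2 x + f x)"
      using i2 i0 by (simp add: I_def)
    have "(?F \<longlongrightarrow> of_real ((real d - real d - (real d - real d)\<^sup>2) / 2) * L - of_real (1 / 2 - (real d - real d)) * f d)
       (at_right (real d))"
      unfolding b_def by (intro tendsto_intros L fd) auto
    then show "(?F \<longlongrightarrow> - (f (real d) / 2)) (at_right (real d))" by simp
    have "(?F \<longlongrightarrow> of_real ((real (Suc d) - real d - (real (Suc d) - real d)\<^sup>2) / 2) * f1 (Suc d)
       - of_real (1 / 2 - (real (Suc d) - real d)) * f (Suc d)) (at_left (real (Suc d)))"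
      unfolding b_def by (intro tendsto_intros fSd) auto
    then show "(?F \<longlongrightarrow> f (real (Suc d)) / 2) (at_left (real (Suc d)))" by simp
  qed
  moreover have "(LBINT x:I. of_real (b x) * f2 x + f x) = (LBINT x:I. of_real (b x) * f2 x) + (LBINT x:I. f x)"
    by (rule set_integral_add(2)[OF i2 i0])
  moreover have "(LBINT x:I. of_real (b x) * f2 x) = (LBINT x:I. of_real (bern x) * f2 x)"
    by (rule set_lebesgue_integral_cong) (auto simp: bb I_def)
  ultimately show ?thesis by (simp add: I_def algebra_simps)
qed

lemma trapezoid:
  "(\<Sum>d=1..X. f (real d)) - f (real X) / 2 - (LBINT x:{0<..<real X}. f x) =
     (LBINT x:{0<..<real X}. of_real (bern x) * f2 x)"
proof (induction X)
  case 0
  then show ?case by (simp add: zero set_lebesgue_integral_def)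
next
  case (Suc X)
  show ?case
    unfolding set_integral_Ioo_Suc[OF int_bern] set_integral_Ioo_Suc[OF int] trapezoid_step Suc.IH [symmetric]
    by (simp add: algebra_simps)
qed

text \<open>The bound is uniform in X; it is the domination that allows X to tend to infinity inside
  a series of such integrals.\<close>

lemma trapezoid_bound:
  "norm (LBINT x:{0<..<real X}. of_real (bern x) * f2 x) \<le> (LBINT x:{0<..}. norm (f2 x))"
proof -
  have "norm (LBINT x:{0<..<real X}. of_real (bern x) * f2 x) =
        norm (LBINT x:{0<..}. indicator {0<..<real X} x *\<^sub>R (of_real (bern x) * f2 x))"
    unfolding set_lebesgue_integral_def
    by (intro arg_cong[of _ _ norm] Bochner_Integration.integral_cong) (auto simp: indicator_def)
  also have "\<dots> \<le> (LBINT x:{0<..}. norm (f2 x))"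
  proof (rule set_integral_norm_bound'[OF set_integrable_norm[OF int2]])
    fix x :: real
    have "bern x * norm (f2 x) \<le> 1 * norm (f2 x)"
      using bern_le[of x] by (intro mult_right_mono) auto
    then show "norm (indicator {0<..<real X} x *\<^sub>R (of_real (bern x) * f2 x)) \<le> norm (f2 x)"
      using bern_nonneg[of x] by (simp add: norm_mult indicator_def)
  qed
  finally show ?thesis .
qed

text \<open>The function cos (c x) f' + c sin (c x) f is an antiderivative of cos (c x) f'' + c^2
  cos (c x) f. It vanishes at both ends, because f and f' do while the trigonometric factors stay
  bounded.\<close>

lemma fourier_by_parts:
  fixes c :: real
  shows "set_integrable lborel {0<..} (\<lambda>x. of_real (cos (c * x)) * f2 x)"
    and "set_integrable lborel {0<..} (\<lambda>x. of_real (cos (c * x)) * f x)"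
    and "(LBINT x:{0<..}. of_real (cos (c * x)) * f2 x) = - of_real (c\<^sup>2) * (LBINT x:{0<..}. of_real (cos (c * x)) * f x)"
proof -
  have *: "set_integrable lborel {0<..} (\<lambda>x. of_real (cos (c * x)) * g x)"
    if g: "set_integrable lborel {0<..} g" "continuous_on {0<..} g" for g :: "real \<Rightarrow> complex"
  proof (rule set_integrable_bound[OF g(1)])
    show "set_borel_measurable lborel {0<..} (\<lambda>x. of_real (cos (c * x)) * g x)"
      using g(2) by (intro set_borel_measurable_continuous continuous_intros)
    show "AE x in lborel. x \<in> {0<..} \<longrightarrow> norm (of_real (cos (c * x)) * g x) \<le> norm (g x)"
      by (intro AE_I2) (auto simp: norm_mult intro!: mult_left_le_one_le)
  qed
  show i2: "set_integrable lborel {0<..} (\<lambda>x. of_real (cos (c * x)) * f2 x)"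
    by (rule *[OF int2 cont2])
  show i0: "set_integrable lborel {0<..} (\<lambda>x. of_real (cos (c * x)) * f x)"
    by (rule *[OF int cont])
  let ?F = "\<lambda>x. of_real (cos (c * x)) * f1 x + of_real (c * sin (c * x)) * f x"
  have i0': "set_integrable lborel {0<..} (\<lambda>x. of_real (c\<^sup>2) * (of_real (cos (c * x)) * f x))"
    using i0 by simp
  have "(LBINT x:{0<..}. of_real (cos (c * x)) * f2 x + of_real (c\<^sup>2) * (of_real (cos (c * x)) * f x)) = 0 - 0"
  proof (rule FTC_Ioi)
    fix x :: real assume x: "0 < x"
    have c: "((\<lambda>x. cos (c * x)) has_real_derivative - (c * sin (c * x))) (at x)"
      by (auto intro!: derivative_eq_intros)
    have s: "((\<lambda>x. c * sin (c * x)) has_real_derivative c\<^sup>2 * cos (c * x)) (at x)"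
      by (auto intro!: derivative_eq_intros simp: power2_eq_square)
    have "(?F has_vector_derivative
        (of_real (cos (c * x)) * f2 x + of_real (- (c * sin (c * x))) * f1 x) +
        (of_real (c * sin (c * x)) * f1 x + of_real (c\<^sup>2 * cos (c * x)) * f x)) (at x)"
      by (intro has_vector_derivative_add has_vector_derivative_mult d1 d2 x has_vector_derivative_of_real c s)
    then show "(?F has_vector_derivative of_real (cos (c * x)) * f2 x + of_real (c\<^sup>2) * (of_real (cos (c * x)) * f x)) (at x)"
      by (simp add: algebra_simps)
  next
    show "continuous_on {0<..} (\<lambda>x. of_real (cos (c * x)) * f2 x + of_real (c\<^sup>2) * (of_real (cos (c * x)) * f x))"
      by (intro continuous_intros cont2 cont)
    show "set_integrable lborel {0<..} (\<lambda>x. of_real (cos (c * x)) * f2 x + of_real (c\<^sup>2) * (of_real (cos (c * x)) * f x))"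
      by (intro set_integral_add(1) i2 i0')
    have bc1: "Bfun (\<lambda>x. complex_of_real (cos (c * x))) F" for F
      by (rule BfunI[of _ 1]) (auto intro!: always_eventually)
    have bc2: "Bfun (\<lambda>x. complex_of_real (c * sin (c * x))) F" for F
      by (rule BfunI[of _ "\<bar>c\<bar>"])
         (auto intro!: always_eventually mult_left_le simp: norm_of_real abs_mult simp del: of_real_mult)
    note bc = bc1 bc2
    have z: "((\<lambda>x. g x * h x) \<longlongrightarrow> 0) F" if "Bfun g F" "(h \<longlongrightarrow> 0) F" for F and g h :: "real \<Rightarrow> complex"
      using bounded_bilinear.Bfun_prod_Zfun[OF bounded_bilinear_mult, of g F h] that
      by (simp add: tendsto_Zfun_iff)
    have "(?F \<longlongrightarrow> 0 + 0) (at_right 0)"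
      by (intro tendsto_add z bc lim0 lim1_0)
    then show "(?F \<longlongrightarrow> 0) (at_right 0)" by simp
    have "(?F \<longlongrightarrow> 0 + 0) at_top"
      by (intro tendsto_add z bc lim_top lim1_top)
    then show "(?F \<longlongrightarrow> 0) at_top" by simp
  qed
  moreover have "(LBINT x:{0<..}. of_real (cos (c * x)) * f2 x + of_real (c\<^sup>2) * (of_real (cos (c * x)) * f x)) =
     (LBINT x:{0<..}. of_real (cos (c * x)) * f2 x) + of_real (c\<^sup>2) * (LBINT x:{0<..}. of_real (cos (c * x)) * f x)"
    unfolding set_integral_mult_right [symmetric] by (rule set_integral_add(2)[OF i2 i0'])
  ultimately show "(LBINT x:{0<..}. of_real (cos (c * x)) * f2 x) = - of_real (c\<^sup>2) * (LBINT x:{0<..}. of_real (cos (c * x)) * f x)"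
    by (simp add: eq_neg_iff_add_eq_0)
qed

text \<open>The Fourier series of \<open>bern\<close> is inserted and integrated term by term. The
  coefficient 1 / (2 pi^2 l^2) meets the factor (2 pi l)^2 from the two integrations by parts, which
  leaves 2. The mean value 1 / 12 drops out because the integral of f'' is zero.\<close>

lemma poisson:
  "(\<lambda>l. 2 * (LBINT x:{0<..}. of_real (cos (2 * pi * real (Suc l) * x)) * f x)) sums
     (LBINT x:{0<..}. of_real (bern x) * f2 x)"
proof -
  define c where "c = (\<lambda>l. 1 / (2 * pi\<^sup>2 * (real (Suc l))\<^sup>2))"
  have c0: "c l \<ge> 0" for l by (simp add: c_def)
  define g where "g = (\<lambda>l x. of_real (c l) * (of_real (cos (2 * pi * real (Suc l) * x)) * f2 x))"
  have sc: "summable c"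
  proof -
    have "summable (\<lambda>l. 1 / (2 * pi\<^sup>2) * (1 / (real (Suc l))\<^sup>2))"
      using inverse_squares_sums by (intro summable_mult) (auto simp: sums_iff add_ac)
    then show ?thesis by (simp add: c_def)
  qed
  have gint: "set_integrable lborel {0<..} (g l)" for l
    unfolding g_def using fourier_by_parts(1) by simp
  have ng: "norm (g l x) \<le> c l * norm (f2 x)" for l x
    using c0[of l] by (auto simp: g_def norm_mult intro!: mult_left_mono mult_left_le_one_le)
  have gs: "(\<lambda>l. g l x) sums (of_real (1 / 12 - bern x) * f2 x)" for x
  proof -
    have "(\<lambda>l. of_real (cos (2 * pi * Suc l * x) / (2 * pi\<^sup>2 * (Suc l)\<^sup>2)) * f2 x) sums (of_real (1 / 12 - bern x) * f2 x)"
      by (intro sums_mult2 sums_of_real bern_fourier)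
    also have "(\<lambda>l. of_real (cos (2 * pi * Suc l * x) / (2 * pi\<^sup>2 * (Suc l)\<^sup>2)) * f2 x) = (\<lambda>l. g l x)"
      by (simp add: g_def c_def fun_eq_iff)
    finally show ?thesis .
  qed
  have "(\<lambda>l. LBINT x:{0<..}. g l x) sums (LBINT x:{0<..}. (\<Sum>l. g l x))"
  proof (rule set_lebesgue_integral_sums(2)[OF gint])
    show "summable (\<lambda>l. norm (g l x))" for x
      by (rule summable_comparison_test'[OF summable_mult2[OF sc, of "norm (f2 x)"]]) (use ng in simp)
    show "(LBINT x:{0<..}. norm (g l x)) \<le> c l * (LBINT x:{0<..}. norm (f2 x))" for l
      unfolding set_integral_mult_right [symmetric]
    proof (rule set_integral_mono)
      show "set_integrable lborel {0<..} (\<lambda>x. c l * norm (f2 x))"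
        by (intro set_integrable_mult_right set_integrable_norm int2)
    qed (rule set_integrable_norm[OF gint] ng)+
    show "summable (\<lambda>l. c l * (LBINT x:{0<..}. norm (f2 x)))"
      by (intro summable_mult2 sc)
  qed
  also have "(\<lambda>x. \<Sum>l. g l x) = (\<lambda>x. of_real (1 / 12) * f2 x - of_real (bern x) * f2 x)"
    using gs by (auto simp: sums_iff fun_eq_iff of_real_diff left_diff_distrib simp del: of_real_divide)
  also have "(LBINT x:{0<..}. of_real (1 / 12) * f2 x - of_real (bern x) * f2 x) =
       (LBINT x:{0<..}. of_real (1 / 12) * f2 x) - (LBINT x:{0<..}. of_real (bern x) * f2 x)"
    by (intro set_integral_diff int_bern set_integrable_mult_right int2)
  also have "(LBINT x:{0<..}. of_real (1 / 12) * f2 x) = 0"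
    using FTC_Ioi[OF d2 cont2 int2 lim1_0 lim1_top] by simp
  finally have "(\<lambda>l. - (LBINT x:{0<..}. g l x)) sums - (0 - (LBINT x:{0<..}. of_real (bern x) * f2 x))"
    by (rule sums_minus)
  moreover have "- (LBINT x:{0<..}. g l x) = 2 * (LBINT x:{0<..}. of_real (cos (2 * pi * real (Suc l) * x)) * f x)" for l
  proof -
    have "c l * (2 * pi * real (Suc l))\<^sup>2 = 2"
      by (simp add: c_def power_mult_distrib power2_eq_square del: of_nat_Suc)
    then have c2: "complex_of_real (c l) * of_real ((2 * pi * real (Suc l))\<^sup>2) = 2"
      by (metis of_real_mult of_real_numeral)
    have "- (LBINT x:{0<..}. g l x) = - (of_real (c l) * (LBINT x:{0<..}. of_real (cos (2 * pi * real (Suc l) * x)) * f2 x))"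
      by (simp only: g_def set_integral_mult_right)
    also have "\<dots> = of_real (c l) * of_real ((2 * pi * real (Suc l))\<^sup>2) * (LBINT x:{0<..}. of_real (cos (2 * pi * real (Suc l) * x)) * f x)"
      by (subst fourier_by_parts(3)) (simp only: mult_minus_left mult_minus_right minus_minus mult.assoc)
    finally show ?thesis by (simp only: c2)
  qed
  ultimately show ?thesis by simp
qed

end

section \<open>The Bessel integral of half-integral order\<close>

text \<open>The entire primitive of exp (- z^2) that vanishes at 0, that is, sqrt pi / 2 times the
  complex error function.\<close>

definition cerf :: "complex \<Rightarrow> complex" where
  "cerf = (SOME E. (\<forall>z. (E has_field_derivative exp (- z\<^sup>2)) (at z)) \<and> E 0 = 0)"

lemma cerf_deriv: "(cerf has_field_derivative exp (- z\<^sup>2)) (at z)"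
  and cerf_0: "cerf 0 = 0"
proof -
  have h: "(\<lambda>z::complex. exp (- z\<^sup>2)) holomorphic_on UNIV" by (intro holomorphic_intros)
  obtain g where g': "\<And>z. z \<in> UNIV \<Longrightarrow> (g has_field_derivative exp (- z\<^sup>2)) (at (z::complex) within UNIV)"
    by (rule holomorphic_convex_primitive'[OF convex_UNIV open_UNIV h]) (rule that)
  then have g: "\<And>z. (g has_field_derivative exp (- z\<^sup>2)) (at z)" by auto
  have "\<exists>E::complex \<Rightarrow> complex. (\<forall>z. (E has_field_derivative exp (- z\<^sup>2)) (at z)) \<and> E 0 = 0"
    by (rule exI[of _ "\<lambda>z. g z - g 0"]) (auto intro!: derivative_eq_intros g)
  from someI_ex[OF this] show "(cerf has_field_derivative exp (- z\<^sup>2)) (at z)" "cerf 0 = 0"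
    unfolding cerf_def [symmetric] by auto
qed

lemmas cerf_deriv' [derivative_intros] = DERIV_chain2[OF cerf_deriv]

lemma isCont_cerf: "isCont cerf z"
  using cerf_deriv DERIV_isCont by blast

lemma cerf_minus: "cerf (- z) = - cerf z"
proof -
  have "((\<lambda>z. cerf z + cerf (- z)) has_field_derivative 0) (at z within UNIV)" for z
    by (auto intro!: derivative_eq_intros)
  then have "\<exists>c. \<forall>z\<in>UNIV. cerf z + cerf (- z) = c"
    by (intro has_field_derivative_zero_constant) auto
  then obtain c where c: "\<And>z. cerf z + cerf (- z) = c" by auto
  with c[of 0] have "c = 0" by (simp add: cerf_0)
  with c[of z] show ?thesis by (simp add: eq_neg_iff_add_eq_0 add.commute)
qed

text \<open>Two descriptions of the sector |arg c| < pi / 4, in which exp (- z^2) decays.\<close>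

lemma Re_square_pos_iff:
  fixes c :: complex
  assumes "Re c > 0"
  shows "Re (c\<^sup>2) > 0 \<longleftrightarrow> \<bar>Im c\<bar> < Re c"
proof -
  have "Re (c\<^sup>2) = (Re c)\<^sup>2 - (Im c)\<^sup>2" by (simp add: power2_eq_square)
  also have "\<dots> > 0 \<longleftrightarrow> \<bar>Im c\<bar>\<^sup>2 < (Re c)\<^sup>2" by simp
  also have "\<dots> \<longleftrightarrow> \<bar>Im c\<bar> < Re c"
    using assms by (metis abs_ge_zero less_eq_real_def power2_abs power2_less_imp_less power_strict_mono pos2)
  finally show ?thesis .
qed

text \<open>Along the ray c sqrt x the derivative of \<open>cerf\<close> is c / 2 times x powr
  (-1/2) exp (- c^2 x), so the limit is a complex Gamma integral with exponent 1/2. Since Re c > 0,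
  the principal square root of c^2 is c itself, and the dependence on c cancels.\<close>

lemma cerf_ray:
  assumes c: "Re c > 0" "Re (c\<^sup>2) > 0"
  shows "((\<lambda>x. cerf (c * of_real (sqrt x))) \<longlongrightarrow> of_real (sqrt pi / 2)) at_top"
proof -
  let ?g = "\<lambda>x. c / 2 * (of_real (x powr (1 / 2 - 1)) * exp (- of_real x * c\<^sup>2))"
  have int: "set_integrable lborel {0<..} ?g"
    using Gamma_integral_complex_scaled(1)[of "1/2" "c\<^sup>2"] c by (intro set_integrable_mult_right) auto
  have "(LBINT x:{0<..}. ?g x) = c / 2 * (of_real (Gamma (1 / 2)) * (c\<^sup>2) powr (- of_real (1 / 2)))"
    using Gamma_integral_complex_scaled(2)[of "1/2" "c\<^sup>2"] c by simp
  also have "(c\<^sup>2) powr (- of_real (1 / 2)) = 1 / c"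
  proof -
    have "c \<noteq> 0" using c by auto
    have "csqrt (c\<^sup>2) = c" using c by (intro csqrt_square) auto
    moreover have "(c\<^sup>2) powr (1 / 2) = csqrt (c\<^sup>2)" using \<open>c \<noteq> 0\<close> by (simp add: csqrt_conv_powr)
    ultimately have e: "(c\<^sup>2) powr (1 / 2) = c" by metis
    have "complex_of_real (1 / 2) = 1 / 2" by simp
    then show ?thesis by (simp only: powr_minus e inverse_eq_divide)
  qed
  finally have val: "(LBINT x:{0<..}. ?g x) = of_real (sqrt pi / 2)"
    using c by (auto simp: Gamma_one_half_real)
  have eq: "(LBINT x:{0<..<X}. ?g x) = cerf (c * of_real (sqrt X)) - cerf (c * of_real (sqrt 0))" if X: "X > 0" for X
  proof (rule FTC_Ioo[OF X])
    show "set_integrable lborel {0<..<X} ?g"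
      by (rule set_integrable_subset[OF int]) auto
    show "continuous_on {0<..<X} ?g" by (auto intro!: continuous_intros)
    have "isCont (\<lambda>x. cerf (c * of_real (sqrt x))) x" for x
      by (intro continuous_intros isCont_o2[OF _ isCont_cerf])
    then show "((\<lambda>x. cerf (c * of_real (sqrt x))) \<longlongrightarrow> cerf (c * of_real (sqrt 0))) (at_right 0)"
      "((\<lambda>x. cerf (c * of_real (sqrt x))) \<longlongrightarrow> cerf (c * of_real (sqrt X))) (at_left X)"
      unfolding isCont_def by (meson tendsto_within_subset subset_UNIV)+
    fix x :: real assume x: "0 < x" "x < X"
    have "((\<lambda>x. complex_of_real (sqrt x)) has_vector_derivative of_real (inverse (sqrt x) / 2)) (at x)"
      using x by (intro has_vector_derivative_of_real) (auto intro!: derivative_eq_intros)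
    note r = this
    have d: "((\<lambda>z. cerf (c * z)) has_field_derivative c * exp (- (c * w)\<^sup>2)) (at w)" for w
      by (auto intro!: derivative_eq_intros)
    from field_vector_diff_chain_at[OF r d]
    have "((\<lambda>x. cerf (c * of_real (sqrt x))) has_vector_derivative
        of_real (inverse (sqrt x) / 2) * (c * exp (- (c * of_real (sqrt x))\<^sup>2))) (at x)"
      by (simp only: o_def)
    moreover have "(c * of_real (sqrt x))\<^sup>2 = of_real x * c\<^sup>2"
      using x by (simp add: power_mult_distrib flip: of_real_power)
    moreover have "x powr (1 / 2 - 1) = inverse (sqrt x)"
    proof -
      have "x powr (1 / 2 - 1) = x powr (- (1 / 2))" by simp
      also have "\<dots> = inverse (x powr (1 / 2))" by (rule powr_minus)
      finally show ?thesis using x by (simp only: powr_half_sqrt less_imp_le)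
    qed
    ultimately show "((\<lambda>x. cerf (c * of_real (sqrt x))) has_vector_derivative ?g x) (at x)"
      by (simp add: mult_ac)
  qed
  have "((\<lambda>X. LBINT x:{0<..<X}. ?g x) \<longlongrightarrow> of_real (sqrt pi / 2)) at_top"
    using tendsto_set_integral_Ioo_at_top[OF int] val by simp
  then show ?thesis
  proof (rule Lim_transform_eventually)
    show "\<forall>\<^sub>F X in at_top. (LBINT x:{0<..<X}. ?g x) = cerf (c * of_real (sqrt X))"
      using eventually_gt_at_top[of 0] by eventually_elim (simp only: eq real_sqrt_zero of_real_0 mult_zero_right cerf_0 diff_zero)
  qed
qed

text \<open>In the closed sector around the positive axis the derivative of \<open>cerf\<close> is
  bounded by 1. For large x both the point on the ray and the shifted point lie in this sector, so
  the shift by e / sqrt x changes the value by at most norm e / sqrt x.\<close>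

lemma cerf_shifted_ray:
  assumes c: "Re c > 0" "Re (c\<^sup>2) > 0"
  shows "((\<lambda>x. cerf (c * of_real (sqrt x) + e / of_real (sqrt x))) \<longlongrightarrow> of_real (sqrt pi / 2)) at_top"
proof -
  \<comment> \<open>An intersection of two half-planes, hence convex, as the mean value estimate
    requires.\<close>
  define S where "S = {z. \<bar>Im z\<bar> \<le> Re z}"
  have S: "convex S"
  proof -
    have "S = {z. 1 * Im z \<le> Re z} \<inter> {z. - Re z \<le> Im z}" by (auto simp: S_def)
    also have "\<dots> = {z. inner (Complex (-1) 1) z \<le> 0} \<inter> {z. inner (Complex (-1) (-1)) z \<le> 0}"
      by (auto simp: inner_complex_def)
    finally show ?thesis by (auto intro!: convex_Int convex_halfspace_le)
  qed
  have bd: "norm (exp (- z\<^sup>2)) \<le> 1" if "z \<in> S" for z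
  proof -
    have "(Im z)\<^sup>2 \<le> (Re z)\<^sup>2" using that by (auto simp: S_def intro!: power2_le_imp_le simp flip: abs_le_square_iff)
    then show ?thesis by (simp add: power2_eq_square)
  qed
  define d where "d = Re c - \<bar>Im c\<bar>"
  have d: "d > 0" using Re_square_pos_iff[OF c(1)] c(2) by (simp add: d_def)
  have lim: "((\<lambda>x. cerf (c * of_real (sqrt x) + e / of_real (sqrt x)) - cerf (c * of_real (sqrt x))) \<longlongrightarrow> 0) at_top"
  proof (rule Lim_null_comparison)
    show "((\<lambda>x. norm e / sqrt x) \<longlongrightarrow> 0) at_top" by real_asymp
    show "\<forall>\<^sub>F x in at_top. norm (cerf (c * of_real (sqrt x) + e / of_real (sqrt x)) - cerf (c * of_real (sqrt x))) \<le> norm e / sqrt x"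
      using eventually_gt_at_top[of 0] eventually_ge_at_top[of "2 * norm e / d"]
    proof eventually_elim
      case (elim x)
      have x1: "c * of_real (sqrt x) \<in> S"
        using elim d by (auto simp: S_def d_def abs_mult intro!: mult_right_mono)
      have "2 * norm e \<le> x * d" using elim d by (simp add: field_simps)
      then have "2 * norm e / sqrt x \<le> sqrt x * d"
        using elim by (simp add: field_simps)
      moreover have "\<bar>Re (e / of_real (sqrt x))\<bar> \<le> norm e / sqrt x" "\<bar>Im (e / of_real (sqrt x))\<bar> \<le> norm e / sqrt x"
        using elim abs_Re_le_cmod[of "e / of_real (sqrt x)"] abs_Im_le_cmod[of "e / of_real (sqrt x)"]
        by (simp_all add: norm_divide)
      moreover have "Re (c * of_real (sqrt x)) - \<bar>Im (c * of_real (sqrt x))\<bar> = sqrt x * d"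
        using elim by (simp add: d_def abs_mult algebra_simps)
      ultimately have x2: "c * of_real (sqrt x) + e / of_real (sqrt x) \<in> S"
        unfolding S_def mem_Collect_eq plus_complex.simps by linarith
      have "norm (cerf (c * of_real (sqrt x) + e / of_real (sqrt x)) - cerf (c * of_real (sqrt x)))
         \<le> 1 * norm (c * of_real (sqrt x) + e / of_real (sqrt x) - c * of_real (sqrt x))"
        by (rule field_differentiable_bound[OF S _ bd x2 x1])
           (auto intro: has_field_derivative_at_within cerf_deriv)
      then show ?case using elim by (simp add: norm_divide)
    qed
  qed
  from tendsto_add[OF lim cerf_ray[OF c]] show ?thesis by simp
qed

lemma cerf_shifted_ray_0:
  assumes c: "Re c > 0" "Re (c\<^sup>2) > 0"
  shows "((\<lambda>x. cerf (c / of_real (sqrt x) + e * of_real (sqrt x))) \<longlongrightarrow> of_real (sqrt pi / 2)) (at_right 0)"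
proof -
  from filterlim_compose[OF cerf_shifted_ray[OF c, of e] filterlim_inverse_at_top_right]
  show ?thesis
    by (simp only: real_sqrt_inverse of_real_inverse divide_inverse inverse_inverse_eq)
qed

lemma powr_exp_inverse_le:
  fixes r p x :: real
  assumes "r > 0" "p < 0" "x > 0"
  shows "x powr p * exp (- r / x) \<le> (- p / r) powr (- p)"
proof -
  have "(1 / x) powr (- p) = x powr p"
    using assms by (simp add: powr_divide powr_minus_divide)
  with powr_exp_le[of "1 / x" "- p" r] assms show ?thesis by simp
qed

lemma set_integrable_powr_exp_inverse:
  fixes r p :: real
  assumes r: "r > 0" and p: "p < -1"
  shows "set_integrable lborel {0<..} (\<lambda>x. x powr p * exp (- r / x))"
proof -
  define C where "C = max 1 ((- p / r) powr (- p))"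
  show ?thesis
  proof (rule set_integrable_continuous_boundI[where a = 0 and b = p and C = C])
    show "continuous_on {0<..} (\<lambda>x. x powr p * exp (- r / x))"
      by (auto intro!: continuous_intros)
    show "norm (x powr p * exp (- r / x)) \<le> C * x powr 0" if "0 < x" "x < 1" for x
      using powr_exp_inverse_le[of r p x] that r p by (simp add: C_def)
    show "norm (x powr p * exp (- r / x)) \<le> C * x powr p" if "1 \<le> x" for x
    proof -
      have "exp (- r / x) \<le> 1" using that r by simp
      also have "1 \<le> C" by (simp add: C_def)
      finally show ?thesis using mult_right_mono[of "exp (- r / x)" C "x powr p"] by (simp add: mult.commute)
    qed
  qed (use p in auto)
qed

text \<open>The majorant does not contain b, so the same function dominates a whole family of
  integrands when b is moved to the boundary Re (b^2) = 0.\<close>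

lemma bessel_integral_aux:
  fixes a b :: complex
  assumes a: "Re a > 0" "Re (a\<^sup>2) > 0" and b: "Re b > 0" "Re (b\<^sup>2) \<ge> 0"
  shows "set_integrable lborel {0<..} (\<lambda>x. of_real (x powr (-5/2)) * exp (- a\<^sup>2 / of_real x - b\<^sup>2 * of_real x))"
    and "set_integrable lborel {0<..} (\<lambda>x. x powr (-5/2) * exp (- Re (a\<^sup>2) / x))"
    and "\<And>x. x > 0 \<Longrightarrow> norm (of_real (x powr (-5/2)) * exp (- a\<^sup>2 / of_real x - b\<^sup>2 * of_real x))
            \<le> x powr (-5/2) * exp (- Re (a\<^sup>2) / x)"
proof -
  show i: "set_integrable lborel {0<..} (\<lambda>x. x powr (-5/2) * exp (- Re (a\<^sup>2) / x))"
    by (rule set_integrable_powr_exp_inverse[OF a(2)]) simp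
  show n: "norm (of_real (x powr (-5/2)) * exp (- a\<^sup>2 / of_real x - b\<^sup>2 * of_real x))
            \<le> x powr (-5/2) * exp (- Re (a\<^sup>2) / x)" if "x > 0" for x
  proof -
    have "Re (- u / of_real x - v * of_real x) = - Re u / x - Re v * x" for u v by simp
    then have "Re (- a\<^sup>2 / of_real x - b\<^sup>2 * of_real x) = - Re (a\<^sup>2) / x - Re (b\<^sup>2) * x" .
    also have "\<dots> \<le> - Re (a\<^sup>2) / x"
      using mult_nonneg_nonneg[OF b(2), of x] that by linarith
    finally show ?thesis
      unfolding norm_mult norm_of_real norm_exp_eq_Re by (intro mult_mono) auto
  qed
  show "set_integrable lborel {0<..} (\<lambda>x. of_real (x powr (-5/2)) * exp (- a\<^sup>2 / of_real x - b\<^sup>2 * of_real x))"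
  proof (rule set_integrable_bound[OF i])
    show "set_borel_measurable lborel {0<..} (\<lambda>x. of_real (x powr (-5/2)) * exp (- a\<^sup>2 / of_real x - b\<^sup>2 * of_real x))"
      by (intro set_borel_measurable_continuous continuous_intros) auto
    show "AE x in lborel. x \<in> {0<..} \<longrightarrow> norm (of_real (x powr (-5/2)) * exp (- a\<^sup>2 / of_real x - b\<^sup>2 * of_real x))
            \<le> norm (x powr (-5/2) * exp (- Re (a\<^sup>2) / x))"
      using n by (intro AE_I2) auto
  qed
qed

text \<open>The rational identity behind the derivative of the primitive in the next lemma, with e
  in place of exp (- a^2 / z^2 - b^2 z^2).\<close>

lemma bessel_primitive_algebra:
  fixes a b z e :: complex
  assumes z: "z \<noteq> 0" and a: "a \<noteq> 0"
  shows "((e * (2 * a\<^sup>2 / z ^ 3 - 2 * b\<^sup>2 * z)) * (z * a\<^sup>2) - e * a\<^sup>2) / ((z * a\<^sup>2) * (z * a\<^sup>2))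
      + (e * (b + a / z\<^sup>2) - e * (b - a / z\<^sup>2)) / (2 * a ^ 3)
      + b / a\<^sup>2 * (e * (b + a / z\<^sup>2) + e * (b - a / z\<^sup>2)) = 2 / z ^ 4 * e"
proof -
  have "(2 * a\<^sup>2 / z ^ 3) * (z * a\<^sup>2) = 2 * a\<^sup>2 * a\<^sup>2 / z\<^sup>2"
    using z by (simp add: power2_eq_square power3_eq_cube)
  then have "((e * (2 * a\<^sup>2 / z ^ 3 - 2 * b\<^sup>2 * z)) * (z * a\<^sup>2) - e * a\<^sup>2) =
     e * (2 * a\<^sup>2 * a\<^sup>2 / z\<^sup>2) - e * (2 * b\<^sup>2 * z * (z * a\<^sup>2)) - e * a\<^sup>2"
    by (simp only: left_diff_distrib right_diff_distrib mult.assoc)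
  then have "((e * (2 * a\<^sup>2 / z ^ 3 - 2 * b\<^sup>2 * z)) * (z * a\<^sup>2) - e * a\<^sup>2) / ((z * a\<^sup>2) * (z * a\<^sup>2)) =
     e * (2 * a\<^sup>2 * a\<^sup>2 / z\<^sup>2) / ((z * a\<^sup>2) * (z * a\<^sup>2)) - e * (2 * b\<^sup>2 * z * (z * a\<^sup>2)) / ((z * a\<^sup>2) * (z * a\<^sup>2)) - e * a\<^sup>2 / ((z * a\<^sup>2) * (z * a\<^sup>2))"
    by (simp only: diff_divide_distrib)
  also have "e * (2 * a\<^sup>2 * a\<^sup>2 / z\<^sup>2) / ((z * a\<^sup>2) * (z * a\<^sup>2)) = 2 / z ^ 4 * e"
    using z a by (simp add: power2_eq_square power4_eq_xxxx mult_ac)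
  also have "e * (2 * b\<^sup>2 * z * (z * a\<^sup>2)) / ((z * a\<^sup>2) * (z * a\<^sup>2)) = 2 * e * b\<^sup>2 / a\<^sup>2"
    using z a by (simp add: power2_eq_square)
  also have "e * a\<^sup>2 / ((z * a\<^sup>2) * (z * a\<^sup>2)) = e / (z\<^sup>2 * a\<^sup>2)"
    using z a by (simp add: power2_eq_square)
  finally have 1: "((e * (2 * a\<^sup>2 / z ^ 3 - 2 * b\<^sup>2 * z)) * (z * a\<^sup>2) - e * a\<^sup>2) / ((z * a\<^sup>2) * (z * a\<^sup>2)) =
     2 / z ^ 4 * e - 2 * e * b\<^sup>2 / a\<^sup>2 - e / (z\<^sup>2 * a\<^sup>2)" .
  have "e * (b + a / z\<^sup>2) - e * (b - a / z\<^sup>2) = 2 * e * a / z\<^sup>2"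
    by (simp add: algebra_simps)
  then have 2: "(e * (b + a / z\<^sup>2) - e * (b - a / z\<^sup>2)) / (2 * a ^ 3) = e / (z\<^sup>2 * a\<^sup>2)"
    using z a by (simp add: power2_eq_square power3_eq_cube)
  have "e * (b + a / z\<^sup>2) + e * (b - a / z\<^sup>2) = 2 * e * b"
    by (simp add: algebra_simps)
  then have 3: "b / a\<^sup>2 * (e * (b + a / z\<^sup>2) + e * (b - a / z\<^sup>2)) = 2 * e * b\<^sup>2 / a\<^sup>2"
    by (simp add: power2_eq_square)
  show ?thesis unfolding 1 2 3 by simp
qed

text \<open>The modified Bessel function of order 3/2 is elementary: after x = z^2 the integrand has
  an explicit primitive built from the exponential itself and from \<open>cerf\<close> at b z - a /
  z and b z + a / z.\<close>

lemma bessel_integral_strict: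
  fixes a b :: complex
  assumes a: "Re a > 0" "Re (a\<^sup>2) > 0" and b: "Re b > 0" "Re (b\<^sup>2) > 0"
  shows "(LBINT x:{0<..}. of_real (x powr (-5/2)) * exp (- a\<^sup>2 / of_real x - b\<^sup>2 * of_real x)) =
           of_real (sqrt pi) / a ^ 3 * exp (- 2 * a * b) * (1 / 2 + a * b)"
proof -
  have a0: "a \<noteq> 0" using a by auto
  \<comment> \<open>Completing the square shows exp (- 2 a b) exp (- (b z - a / z)^2) = exp (- a^2 /
    z^2 - b^2 z^2), and the same with both signs changed. The derivatives of the two
    \<open>cerf\<close> terms are thus multiples of this exponential by b + a / z^2 and b - a / z^2;
    their sum and difference are combined with the derivative of the first term.\<close>
  define h where "h = (\<lambda>z. exp (- a\<^sup>2 / z\<^sup>2 - b\<^sup>2 * z\<^sup>2) / (z * a\<^sup>2)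
      + (exp (- 2 * a * b) * cerf (b * z - a / z) - exp (2 * a * b) * cerf (b * z + a / z)) / (2 * a ^ 3)
      + b / a\<^sup>2 * (exp (- 2 * a * b) * cerf (b * z - a / z) + exp (2 * a * b) * cerf (b * z + a / z)))"
  have h': "(h has_field_derivative (2 / z ^ 4 * exp (- a\<^sup>2 / z\<^sup>2 - b\<^sup>2 * z\<^sup>2))) (at z)" if z: "z \<noteq> 0" for z
  proof -
    define e where "e = exp (- a\<^sup>2 / z\<^sup>2 - b\<^sup>2 * z\<^sup>2)"
    have sq: "(b * z - a / z)\<^sup>2 = a\<^sup>2 / z\<^sup>2 + b\<^sup>2 * z\<^sup>2 - 2 * a * b"
      "(b * z + a / z)\<^sup>2 = a\<^sup>2 / z\<^sup>2 + b\<^sup>2 * z\<^sup>2 + 2 * a * b"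
      using z by (simp_all add: power2_diff power2_sum power_mult_distrib power_divide)
    have e1: "exp (- 2 * a * b) * exp (- (b * z - a / z)\<^sup>2) = e"
      unfolding e_def exp_add [symmetric] sq by simp
    have e2: "exp (2 * a * b) * exp (- (b * z + a / z)\<^sup>2) = e"
      unfolding e_def exp_add [symmetric] sq by simp
    have De: "((\<lambda>z. exp (- a\<^sup>2 / z\<^sup>2 - b\<^sup>2 * z\<^sup>2)) has_field_derivative e * (2 * a\<^sup>2 / z ^ 3 - 2 * b\<^sup>2 * z)) (at z)"
      unfolding e_def using z
      by (auto intro!: derivative_eq_intros simp: power2_eq_square power3_eq_cube field_simps)
    have Dz: "((\<lambda>z. z * a\<^sup>2) has_field_derivative a\<^sup>2) (at z)"
      by (auto intro!: derivative_eq_intros)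
    have P1: "((\<lambda>z. cerf (b * z - a / z)) has_field_derivative exp (- (b * z - a / z)\<^sup>2) * (b + a / z\<^sup>2)) (at z)"
      using z by (auto intro!: derivative_eq_intros simp: power2_eq_square)
    have P2: "((\<lambda>z. cerf (b * z + a / z)) has_field_derivative exp (- (b * z + a / z)\<^sup>2) * (b - a / z\<^sup>2)) (at z)"
      using z by (auto intro!: derivative_eq_intros simp: power2_eq_square)
    have za: "z * a\<^sup>2 \<noteq> 0" using z a0 by simp
    have "(h has_field_derivative
        ((e * (2 * a\<^sup>2 / z ^ 3 - 2 * b\<^sup>2 * z)) * (z * a\<^sup>2) - e * a\<^sup>2) / ((z * a\<^sup>2) * (z * a\<^sup>2))
      + (exp (- 2 * a * b) * (exp (- (b * z - a / z)\<^sup>2) * (b + a / z\<^sup>2))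
         - exp (2 * a * b) * (exp (- (b * z + a / z)\<^sup>2) * (b - a / z\<^sup>2))) / (2 * a ^ 3)
      + b / a\<^sup>2 * (exp (- 2 * a * b) * (exp (- (b * z - a / z)\<^sup>2) * (b + a / z\<^sup>2))
         + exp (2 * a * b) * (exp (- (b * z + a / z)\<^sup>2) * (b - a / z\<^sup>2)))) (at z)"
      unfolding h_def
      using DERIV_add[OF DERIV_add[OF DERIV_divide[OF De Dz za]
          DERIV_cdivide[OF DERIV_diff[OF DERIV_cmult[OF P1, of "exp (- 2 * a * b)"] DERIV_cmult[OF P2, of "exp (2 * a * b)"]], of "2 * a ^ 3"]]
          DERIV_cmult[OF DERIV_add[OF DERIV_cmult[OF P1, of "exp (- 2 * a * b)"] DERIV_cmult[OF P2, of "exp (2 * a * b)"]], of "b / a\<^sup>2"]]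
      unfolding e_def .
    also have "((e * (2 * a\<^sup>2 / z ^ 3 - 2 * b\<^sup>2 * z)) * (z * a\<^sup>2) - e * a\<^sup>2) / ((z * a\<^sup>2) * (z * a\<^sup>2))
      + (exp (- 2 * a * b) * (exp (- (b * z - a / z)\<^sup>2) * (b + a / z\<^sup>2))
         - exp (2 * a * b) * (exp (- (b * z + a / z)\<^sup>2) * (b - a / z\<^sup>2))) / (2 * a ^ 3)
      + b / a\<^sup>2 * (exp (- 2 * a * b) * (exp (- (b * z - a / z)\<^sup>2) * (b + a / z\<^sup>2))
         + exp (2 * a * b) * (exp (- (b * z + a / z)\<^sup>2) * (b - a / z\<^sup>2))) =
         ((e * (2 * a\<^sup>2 / z ^ 3 - 2 * b\<^sup>2 * z)) * (z * a\<^sup>2) - e * a\<^sup>2) / ((z * a\<^sup>2) * (z * a\<^sup>2))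
      + (e * (b + a / z\<^sup>2) - e * (b - a / z\<^sup>2)) / (2 * a ^ 3)
      + b / a\<^sup>2 * (e * (b + a / z\<^sup>2) + e * (b - a / z\<^sup>2))"
      by (simp only: e1 e2 mult.assoc [symmetric])
    also have "\<dots> = 2 / z ^ 4 * e"
      by (rule bessel_primitive_algebra[OF z a0])
    finally show ?thesis by (simp add: e_def)
  qed
  let ?f = "\<lambda>x. of_real (x powr (-5/2)) * exp (- a\<^sup>2 / of_real x - b\<^sup>2 * of_real x)"
  let ?P = "of_real (sqrt pi / 2) :: complex"
  have n: "norm (exp (- a\<^sup>2 / (of_real (sqrt x))\<^sup>2 - b\<^sup>2 * (of_real (sqrt x))\<^sup>2) / (of_real (sqrt x) * a\<^sup>2)) =
        exp (- Re (a\<^sup>2) / x - Re (b\<^sup>2) * x) / (sqrt x * norm (a\<^sup>2))" if "x > 0" for x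
  proof -
    have s: "(complex_of_real (sqrt x))\<^sup>2 = of_real x"
      using that by (simp flip: of_real_power)
    have "Re (- u / of_real x - v * of_real x) = - Re u / x - Re v * x" for u v by simp
    then have r: "Re (- a\<^sup>2 / of_real x - b\<^sup>2 * of_real x) = - Re (a\<^sup>2) / x - Re (b\<^sup>2) * x" .
    show ?thesis
      using that unfolding s norm_divide norm_mult norm_exp_eq_Re r by simp
  qed
  \<comment> \<open>Between 0 and infinity only \<open>cerf\<close> at b z - a / z changes, from -
    sqrt pi / 2 to sqrt pi / 2. Hence exp (2 a b) cancels and exp (- 2 a b) survives.\<close>
  have "(LBINT x:{0<..}. ?f x) =
     (0 + (exp (- 2 * a * b) * ?P - exp (2 * a * b) * ?P) / (2 * a ^ 3)
      + b / a\<^sup>2 * (exp (- 2 * a * b) * ?P + exp (2 * a * b) * ?P)) -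
     (0 + (exp (- 2 * a * b) * (- ?P) - exp (2 * a * b) * ?P) / (2 * a ^ 3)
      + b / a\<^sup>2 * (exp (- 2 * a * b) * (- ?P) + exp (2 * a * b) * ?P))"
  proof (rule FTC_Ioi[where F = "\<lambda>x. h (of_real (sqrt x))"])
    fix x :: real assume x: "0 < x"
    have "((\<lambda>x. complex_of_real (sqrt x)) has_vector_derivative of_real (inverse (sqrt x) / 2)) (at x)"
      using x by (intro has_vector_derivative_of_real) (auto intro!: derivative_eq_intros)
    from field_vector_diff_chain_at[OF this h'] x
    have "((\<lambda>x. h (of_real (sqrt x))) has_vector_derivative
        of_real (inverse (sqrt x) / 2) * (2 / of_real (sqrt x) ^ 4 * exp (- a\<^sup>2 / (of_real (sqrt x))\<^sup>2 - b\<^sup>2 * (of_real (sqrt x))\<^sup>2))) (at x)"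
      unfolding o_def by simp
    moreover have "complex_of_real (sqrt x) ^ 2 = of_real x"
      using x by (simp flip: of_real_power)
    moreover have "complex_of_real (x powr (-5/2)) = of_real (inverse (sqrt x) / 2) * (2 / of_real (sqrt x) ^ 4)"
    proof -
      have "x powr (-5/2) = (x powr (1/2)) powr (-5)" using x by (simp add: powr_powr)
      also have "\<dots> = inverse (sqrt x ^ 5)"
        using x by (simp add: powr_half_sqrt powr_minus powr_numeral)
      also have "\<dots> = inverse (sqrt x) / 2 * (2 / sqrt x ^ 4)"
        by (simp add: field_simps eval_nat_numeral)
      finally show ?thesis by simp
    qed
    ultimately show "((\<lambda>x. h (of_real (sqrt x))) has_vector_derivative ?f x) (at x)"
      by (simp add: mult.assoc)
  next
    show "continuous_on {0<..} ?f" by (intro continuous_intros) auto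
    show "set_integrable lborel {0<..} ?f" using bessel_integral_aux(1)[of a b] a b by simp
    have t1: "((\<lambda>x. exp (- a\<^sup>2 / (of_real (sqrt x))\<^sup>2 - b\<^sup>2 * (of_real (sqrt x))\<^sup>2) / (of_real (sqrt x) * a\<^sup>2)) \<longlongrightarrow> 0) at_top"
    proof (rule tendsto_norm_zero_cancel)
      have "((\<lambda>x. exp (- r / x - s * x) / (sqrt x * n)) \<longlongrightarrow> 0) at_top" if "r > 0" "s > 0" "n > 0" for r s n :: real
        using that by real_asymp
      from this[OF a(2) b(2), of "norm (a\<^sup>2)"] a0
      have "((\<lambda>x. exp (- Re (a\<^sup>2) / x - Re (b\<^sup>2) * x) / (sqrt x * norm (a\<^sup>2))) \<longlongrightarrow> 0) at_top"
        by (metis zero_less_norm_iff power_not_zero)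
      then show "((\<lambda>x. norm (exp (- a\<^sup>2 / (of_real (sqrt x))\<^sup>2 - b\<^sup>2 * (of_real (sqrt x))\<^sup>2) / (of_real (sqrt x) * a\<^sup>2))) \<longlongrightarrow> 0) at_top"
      proof (rule Lim_transform_eventually)
        show "\<forall>\<^sub>F x in at_top. exp (- Re (a\<^sup>2) / x - Re (b\<^sup>2) * x) / (sqrt x * norm (a\<^sup>2)) =
           norm (exp (- a\<^sup>2 / (of_real (sqrt x))\<^sup>2 - b\<^sup>2 * (of_real (sqrt x))\<^sup>2) / (of_real (sqrt x) * a\<^sup>2))"
          using eventually_gt_at_top[of 0] by eventually_elim (rule n [symmetric])
      qed
    qed
    have t0: "((\<lambda>x. exp (- a\<^sup>2 / (of_real (sqrt x))\<^sup>2 - b\<^sup>2 * (of_real (sqrt x))\<^sup>2) / (of_real (sqrt x) * a\<^sup>2)) \<longlongrightarrow> 0) (at_right 0)"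
    proof (rule tendsto_norm_zero_cancel)
      have "((\<lambda>x. exp (- r / x - s * x) / (sqrt x * n)) \<longlongrightarrow> 0) (at_right 0)" if "r > 0" "s > 0" "n > 0" for r s n :: real
        using that by real_asymp
      from this[OF a(2) b(2), of "norm (a\<^sup>2)"] a0
      have "((\<lambda>x. exp (- Re (a\<^sup>2) / x - Re (b\<^sup>2) * x) / (sqrt x * norm (a\<^sup>2))) \<longlongrightarrow> 0) (at_right 0)"
        by (metis zero_less_norm_iff power_not_zero)
      then show "((\<lambda>x. norm (exp (- a\<^sup>2 / (of_real (sqrt x))\<^sup>2 - b\<^sup>2 * (of_real (sqrt x))\<^sup>2) / (of_real (sqrt x) * a\<^sup>2))) \<longlongrightarrow> 0) (at_right 0)"
      proof (rule Lim_transform_eventually)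
        show "\<forall>\<^sub>F x in at_right 0. exp (- Re (a\<^sup>2) / x - Re (b\<^sup>2) * x) / (sqrt x * norm (a\<^sup>2)) =
           norm (exp (- a\<^sup>2 / (of_real (sqrt x))\<^sup>2 - b\<^sup>2 * (of_real (sqrt x))\<^sup>2) / (of_real (sqrt x) * a\<^sup>2))"
          using eventually_at_right_less[of 0] by eventually_elim (rule n [symmetric])
      qed
    qed
    have m1: "((\<lambda>x. cerf (b * of_real (sqrt x) - a / of_real (sqrt x))) \<longlongrightarrow> ?P) at_top"
      using cerf_shifted_ray[OF b, of "- a"] by simp
    have m2: "((\<lambda>x. cerf (b * of_real (sqrt x) + a / of_real (sqrt x))) \<longlongrightarrow> ?P) at_top"
      using cerf_shifted_ray[OF b, of a] by simp
    have m3: "((\<lambda>x. cerf (b * of_real (sqrt x) - a / of_real (sqrt x))) \<longlongrightarrow> - ?P) (at_right 0)"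
    proof -
      have "((\<lambda>x. - cerf (a / of_real (sqrt x) + (- b) * of_real (sqrt x))) \<longlongrightarrow> - ?P) (at_right 0)"
        by (intro tendsto_minus cerf_shifted_ray_0 a)
      then show ?thesis unfolding cerf_minus [symmetric] by simp
    qed
    have m4: "((\<lambda>x. cerf (b * of_real (sqrt x) + a / of_real (sqrt x))) \<longlongrightarrow> ?P) (at_right 0)"
      using cerf_shifted_ray_0[OF a, of b] by (simp add: add.commute)
    show "((\<lambda>x. h (of_real (sqrt x))) \<longlongrightarrow> (0 + (exp (- 2 * a * b) * ?P - exp (2 * a * b) * ?P) / (2 * a ^ 3)
      + b / a\<^sup>2 * (exp (- 2 * a * b) * ?P + exp (2 * a * b) * ?P))) at_top"
      unfolding h_def using a0 by (intro tendsto_add tendsto_diff tendsto_divide tendsto_mult tendsto_const t1 m1 m2) auto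
    show "((\<lambda>x. h (of_real (sqrt x))) \<longlongrightarrow> (0 + (exp (- 2 * a * b) * (- ?P) - exp (2 * a * b) * ?P) / (2 * a ^ 3)
      + b / a\<^sup>2 * (exp (- 2 * a * b) * (- ?P) + exp (2 * a * b) * ?P))) (at_right 0)"
      unfolding h_def using a0 by (intro tendsto_add tendsto_diff tendsto_divide tendsto_mult tendsto_const t0 m3 m4) auto
  qed
  also have "\<dots> = of_real (sqrt pi) / a ^ 3 * exp (- 2 * a * b) * (1 / 2 + a * b)"
    using a0 by (simp add: power2_eq_square power3_eq_cube field_simps)
  finally show ?thesis .
qed

text \<open>The boundary case Re (b^2) = 0 is the one that occurs in Fourier integrals, where b^2 is
  purely imaginary. It follows by dominated convergence along b + 1 / (n + 1), which moves b into
  the open sector.\<close>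

lemma bessel_integral:
  fixes a b :: complex
  assumes a: "Re a > 0" "Re (a\<^sup>2) > 0" and b: "Re b > 0" "Re (b\<^sup>2) \<ge> 0"
  shows "(LBINT x:{0<..}. of_real (x powr (-5/2)) * exp (- a\<^sup>2 / of_real x - b\<^sup>2 * of_real x)) =
           of_real (sqrt pi) / a ^ 3 * exp (- 2 * a * b) * (1 / 2 + a * b)"
proof -
  define B where "B = (\<lambda>n. b + of_real (inverse (real (Suc n))))"
  have B: "Re (B n) > 0" "Re ((B n)\<^sup>2) > 0" for n
  proof -
    show "Re (B n) > 0" using b by (simp add: B_def add_pos_nonneg)
    have "Re ((B n)\<^sup>2) = Re (b\<^sup>2) + 2 * Re b * inverse (real (Suc n)) + (inverse (real (Suc n)))\<^sup>2"
    proof -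
      have "Re ((b + of_real e)\<^sup>2) = Re (b\<^sup>2) + 2 * Re b * e + e\<^sup>2" for e
        by (simp add: power2_eq_square algebra_simps)
      then show ?thesis unfolding B_def .
    qed
    also have "\<dots> > 0" using b by (intro add_nonneg_pos add_nonneg_nonneg) auto
    finally show "Re ((B n)\<^sup>2) > 0" .
  qed
  have Blim: "B \<longlonglongrightarrow> b"
  proof -
    have "B \<longlonglongrightarrow> b + of_real 0" unfolding B_def
      by (intro tendsto_intros LIMSEQ_inverse_real_of_nat)
    then show ?thesis by simp
  qed
  let ?f = "\<lambda>b x. of_real (x powr (-5/2)) * exp (- a\<^sup>2 / of_real x - b\<^sup>2 * of_real x)"
  have "(\<lambda>n. LBINT x:{0<..}. ?f (B n) x) \<longlonglongrightarrow> (LBINT x:{0<..}. ?f b x)"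
    unfolding set_lebesgue_integral_def
  proof (rule integral_dominated_convergence)
    show "integrable lborel (\<lambda>x. indicator {0<..} x *\<^sub>R (x powr (-5/2) * exp (- Re (a\<^sup>2) / x)))"
      using bessel_integral_aux(2)[OF a b] by (simp add: set_integrable_def)
    show "(\<lambda>x. indicat_real {0<..} x *\<^sub>R ?f b x) \<in> borel_measurable lborel"
      "(\<lambda>x. indicat_real {0<..} x *\<^sub>R ?f (B n) x) \<in> borel_measurable lborel" for n
      using bessel_integral_aux(1)[OF a b] bessel_integral_aux(1)[OF a B(1)[of n] less_imp_le[OF B(2)[of n]]]
      by (auto simp: set_integrable_def)
    show "AE x in lborel. (\<lambda>n. indicat_real {0<..} x *\<^sub>R ?f (B n) x) \<longlonglongrightarrow> indicat_real {0<..} x *\<^sub>R ?f b x"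
      by (intro AE_I2 tendsto_intros Blim)
    show "AE x in lborel. norm (indicat_real {0<..} x *\<^sub>R ?f (B n) x) \<le> indicat_real {0<..} x *\<^sub>R (x powr (-5/2) * exp (- Re (a\<^sup>2) / x))" for n
      using bessel_integral_aux(3)[OF a B(1)[of n] less_imp_le[OF B(2)[of n]]]
      by (intro AE_I2) (auto simp: indicator_def)
  qed
  moreover have "(\<lambda>n. LBINT x:{0<..}. ?f (B n) x) \<longlonglongrightarrow> of_real (sqrt pi) / a ^ 3 * exp (- 2 * a * b) * (1 / 2 + a * b)"
    unfolding bessel_integral_strict[OF a B]
    by (intro tendsto_intros Blim)
  ultimately show ?thesis by (rule LIMSEQ_unique)
qed

section \<open>Powers times exponentials: derivatives, limits and integrability\<close>

lemma has_vector_derivative_powr_exp: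
  fixes z :: complex
  assumes x: "x > 0"
  shows "((\<lambda>x. of_real (x powr p) * exp (- of_real x * z)) has_vector_derivative
           of_real p * (of_real (x powr (p - 1)) * exp (- of_real x * z)) - z * (of_real (x powr p) * exp (- of_real x * z))) (at x)"
proof -
  have "((\<lambda>w. exp (- w * z)) has_field_derivative (- z * exp (- of_real x * z))) (at (of_real x))"
    by (auto intro!: derivative_eq_intros)
  from has_vector_derivative_real_field[OF this]
  have e: "((\<lambda>x. exp (- of_real x * z)) has_vector_derivative (- z * exp (- of_real x * z))) (at x)" .
  have "((\<lambda>x. x powr p) has_real_derivative p * x powr (p - 1)) (at x)"
    using x by (auto intro!: derivative_eq_intros)
  from has_vector_derivative_mult[OF has_vector_derivative_of_real[OF this] e]
  have "((\<lambda>x. of_real (x powr p) * exp (- of_real x * z)) has_vector_derivative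
     of_real (x powr p) * (- z * exp (- of_real x * z)) + of_real (p * x powr (p - 1)) * exp (- of_real x * z)) (at x)" .
  then show ?thesis by (simp add: algebra_simps)
qed

lemma tendsto_powr_exp:
  assumes z: "Re z > 0"
  shows "p > 0 \<Longrightarrow> ((\<lambda>x. of_real (x powr p) * exp (- of_real x * z)) \<longlongrightarrow> 0) (at_right 0)"
    and "((\<lambda>x. of_real (x powr p) * exp (- of_real x * z)) \<longlongrightarrow> 0) at_top"
proof -
  have n: "norm (of_real (x powr p) * exp (- of_real x * z)) = x powr p * exp (- (x * Re z))" for x
    by (simp add: norm_mult)
  have l0: "((\<lambda>x. x powr p * exp (- (x * r))) \<longlongrightarrow> 0) (at_right 0)" if "p > 0" "r > 0" for r :: real
    using that by real_asymp
  have lt: "((\<lambda>x. x powr p * exp (- (x * r))) \<longlongrightarrow> 0) at_top" if "r > 0" for r :: real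
    using that by real_asymp
  show "((\<lambda>x. of_real (x powr p) * exp (- of_real x * z)) \<longlongrightarrow> 0) (at_right 0)" if "p > 0"
    by (rule tendsto_norm_zero_cancel) (unfold n, rule l0[OF that z])
  show "((\<lambda>x. of_real (x powr p) * exp (- of_real x * z)) \<longlongrightarrow> 0) at_top"
    by (rule tendsto_norm_zero_cancel) (unfold n, rule lt[OF z])
qed

lemma has_vector_derivative_powr_exp_inverse:
  fixes B :: complex
  assumes x: "x > 0"
  shows "((\<lambda>x. of_real (x powr p) * exp (- B / of_real x)) has_vector_derivative
           of_real p * (of_real (x powr (p - 1)) * exp (- B / of_real x)) + B * (of_real (x powr (p - 2)) * exp (- B / of_real x))) (at x)"
proof -
  have "((\<lambda>w. exp (- B / w)) has_field_derivative (B / (of_real x)\<^sup>2 * exp (- B / of_real x))) (at (of_real x))"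
    using x by (auto intro!: derivative_eq_intros simp: power2_eq_square)
  from has_vector_derivative_real_field[OF this]
  have e: "((\<lambda>x. exp (- B / of_real x)) has_vector_derivative (B / (of_real x)\<^sup>2 * exp (- B / of_real x))) (at x)" .
  have "((\<lambda>x. x powr p) has_real_derivative p * x powr (p - 1)) (at x)"
    using x by (auto intro!: derivative_eq_intros)
  from has_vector_derivative_mult[OF has_vector_derivative_of_real[OF this] e]
  have d: "((\<lambda>x. of_real (x powr p) * exp (- B / of_real x)) has_vector_derivative
     of_real (x powr p) * (B / (of_real x)\<^sup>2 * exp (- B / of_real x)) + of_real (p * x powr (p - 1)) * exp (- B / of_real x)) (at x)" .
  have "x powr (p - 2) = x powr p / x ^ 2"
    using x by (simp add: powr_diff powr_numeral)
  then have "complex_of_real (x powr (p - 2)) = of_real (x powr p) / (of_real x)\<^sup>2" by simp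
  then show ?thesis using d by (simp add: algebra_simps)
qed

lemma tendsto_powr_exp_inverse:
  assumes B: "Re B > 0"
  shows "((\<lambda>x. of_real (x powr p) * exp (- B / of_real x)) \<longlongrightarrow> 0) (at_right 0)"
    and "p < 0 \<Longrightarrow> ((\<lambda>x. of_real (x powr p) * exp (- B / of_real x)) \<longlongrightarrow> 0) at_top"
proof -
  have n: "norm (of_real (x powr p) * exp (- B / of_real x)) = x powr p * exp (- (Re B / x))" for x
    by (simp add: norm_mult)
  have l0: "((\<lambda>x. x powr p * exp (- (r / x))) \<longlongrightarrow> 0) (at_right 0)" if "r > 0" for r :: real
    using that by real_asymp
  have lt: "((\<lambda>x. x powr p * exp (- (r / x))) \<longlongrightarrow> 0) at_top" if "p < 0" "r > 0" for r :: real
    using that by real_asymp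
  show "((\<lambda>x. of_real (x powr p) * exp (- B / of_real x)) \<longlongrightarrow> 0) (at_right 0)"
    by (rule tendsto_norm_zero_cancel) (unfold n, rule l0[OF B])
  show "((\<lambda>x. of_real (x powr p) * exp (- B / of_real x)) \<longlongrightarrow> 0) at_top" if "p < 0"
    by (rule tendsto_norm_zero_cancel) (unfold n, rule lt[OF that B])
qed

lemma set_integrable_powr_exp_inverse_complex:
  assumes B: "Re B > 0" and p: "p < -1"
  shows "set_integrable lborel {0<..} (\<lambda>x. of_real (x powr p) * exp (- B / of_real x))"
proof (rule set_integrable_bound[OF set_integrable_powr_exp_inverse[OF B p]])
  show "set_borel_measurable lborel {0<..} (\<lambda>x. of_real (x powr p) * exp (- B / of_real x))"
    by (intro set_borel_measurable_continuous continuous_intros) auto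
qed (auto simp: norm_mult)

section \<open>The Lipschitz formula\<close>

lemma two_cos_integral:
  fixes f :: "real \<Rightarrow> complex"
  assumes "set_integrable lborel {0<..} (\<lambda>x. exp (\<i> * of_real (c * x)) * f x)"
    "set_integrable lborel {0<..} (\<lambda>x. exp (- \<i> * of_real (c * x)) * f x)"
  shows "2 * (LBINT x:{0<..}. of_real (cos (c * x)) * f x) =
      (LBINT x:{0<..}. exp (\<i> * of_real (c * x)) * f x) + (LBINT x:{0<..}. exp (- \<i> * of_real (c * x)) * f x)"
proof -
  have "2 * (of_real (cos (c * x)) * f x) = exp (\<i> * of_real (c * x)) * f x + exp (- \<i> * of_real (c * x)) * f x" for x
  proof -
    have "2 * complex_of_real (cos (c * x)) = exp (\<i> * of_real (c * x)) + exp (- \<i> * of_real (c * x))"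
      unfolding cos_of_real [symmetric] cos_exp_eq by simp
    then show ?thesis by (simp only: mult.assoc [symmetric] distrib_right)
  qed
  then show ?thesis
    unfolding set_integral_mult_right [symmetric] set_integral_add(2)[OF assms, symmetric]
    by (intro set_lebesgue_integral_cong) auto
qed

text \<open>Poisson summation for x powr (s - 1) exp (- x z). The two exponentials of each cosine
  shift z by plus and minus 2 pi i l, so every Fourier integral is a pair of Gamma integrals. The
  condition s > 2 makes f' vanish at 0 and keeps x powr (s - 3) integrable there.\<close>

lemma lipschitz_formula:
  fixes s :: real and z :: complex
  assumes s: "s > 2" and z: "Re z > 0"
  defines "g \<equiv> \<lambda>l. (z - 2 * pi * of_nat (Suc l) * \<i>) powr (- of_real s) + (z + 2 * pi * of_nat (Suc l) * \<i>) powr (- of_real s)"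
  shows "summable g"
    and "(\<lambda>d. of_real (real (Suc d) powr (s - 1)) * exp (- of_real (real (Suc d)) * z)) sums
           (of_real (Gamma s) * (z powr (- of_real s) + (\<Sum>l. g l)))"
proof -
  define P where "P = (\<lambda>p x. of_real (x powr p) * exp (- of_real x * z))"
  define f where "f = P (s - 1)"
  define f1 where "f1 = (\<lambda>x. of_real (s - 1) * P (s - 2) x - z * P (s - 1) x)"
  define f2 where "f2 = (\<lambda>x. of_real (s - 1) * (of_real (s - 2) * P (s - 3) x - z * P (s - 2) x)
     - z * (of_real (s - 1) * P (s - 2) x - z * P (s - 1) x))"
  have dP: "(P p has_vector_derivative of_real p * P (p - 1) x - z * P p x) (at x)" if "x > 0" for p x
    unfolding P_def by (rule has_vector_derivative_powr_exp[OF that])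
  have cP: "continuous_on {0<..} (P p)" for p
    unfolding P_def by (intro continuous_intros) auto
  have iP: "set_integrable lborel {0<..} (P p)" if "p > -1" for p
    using Gamma_integral_complex_scaled(1)[of "p + 1" z] that z unfolding P_def by simp
  have lP: "(P p \<longlongrightarrow> 0) (at_right 0)" if "p > 0" for p
    unfolding P_def by (rule tendsto_powr_exp(1)[OF z that])
  have lP': "(P p \<longlongrightarrow> 0) at_top" for p
    unfolding P_def by (rule tendsto_powr_exp(2)[OF z])
  interpret halfline_C2 f f1 f2
  proof
    show "(f has_vector_derivative f1 x) (at x)" if "x > 0" for x
      using dP[OF that, of "s - 1"] by (simp add: f_def f1_def)
    show "(f1 has_vector_derivative f2 x) (at x)" if "x > 0" for x
      using has_vector_derivative_diff[OF has_vector_derivative_mult_right[OF dP[OF that, of "s - 2"], of "of_real (s - 1)"]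
         has_vector_derivative_mult_right[OF dP[OF that, of "s - 1"], of z]]
      by (simp add: f1_def f2_def)
    show "continuous_on {0<..} f2" unfolding f2_def by (intro continuous_intros cP)
    show "set_integrable lborel {0<..} f" unfolding f_def using s by (intro iP) simp
    show "set_integrable lborel {0<..} f2"
      unfolding f2_def using s by (intro set_integral_diff(1) set_integrable_mult_right iP) auto
    show "(f \<longlongrightarrow> 0) (at_right 0)" unfolding f_def using s by (intro lP) simp
    show "(f \<longlongrightarrow> 0) at_top" unfolding f_def by (rule lP')
    have "(f1 \<longlongrightarrow> of_real (s - 1) * 0 - z * 0) (at_right 0)"
      unfolding f1_def using s by (intro tendsto_intros lP) auto
    then show "(f1 \<longlongrightarrow> 0) (at_right 0)" by simp
    have "(f1 \<longlongrightarrow> of_real (s - 1) * 0 - z * 0) at_top"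
      unfolding f1_def by (intro tendsto_intros lP')
    then show "(f1 \<longlongrightarrow> 0) at_top" by simp
    show "f 0 = 0" by (simp add: f_def P_def)
  qed
  have G: "set_integrable lborel {0<..} (\<lambda>x. exp (u * of_real x) * f x)"
    "(LBINT x:{0<..}. exp (u * of_real x) * f x) = of_real (Gamma s) * (z - u) powr (- of_real s)"
    if u: "Re u = 0" for u
  proof -
    have "exp (u * of_real x) * f x = of_real (x powr (s - 1)) * exp (- of_real x * (z - u))" for x
    proof -
      have "exp (u * of_real x) * f x = of_real (x powr (s - 1)) * (exp (u * of_real x) * exp (- of_real x * z))"
        by (simp add: f_def P_def)
      also have "exp (u * of_real x) * exp (- of_real x * z) = exp (- of_real x * (z - u))"
        unfolding exp_add [symmetric] by (simp add: algebra_simps)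
      finally show ?thesis .
    qed
    then show "set_integrable lborel {0<..} (\<lambda>x. exp (u * of_real x) * f x)"
     "(LBINT x:{0<..}. exp (u * of_real x) * f x) = of_real (Gamma s) * (z - u) powr (- of_real s)"
      using Gamma_integral_complex_scaled[of s "z - u"] s z u by simp_all
  qed
  have cosint: "2 * (LBINT x:{0<..}. of_real (cos (2 * pi * real (Suc l) * x)) * f x) = of_real (Gamma s) * g l" for l
  proof -
    define u where "u = \<i> * of_real (2 * pi * real (Suc l))"
    have u: "\<i> * of_real (2 * pi * real (Suc l) * x) = u * of_real x"
      "- \<i> * of_real (2 * pi * real (Suc l) * x) = (- u) * of_real x" for x
      by (simp_all add: u_def)
    have "Re u = 0" "Re (- u) = 0" by (simp_all add: u_def)
    note Gu = G[OF this(1)] G[OF this(2)]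
    have "2 * (LBINT x:{0<..}. of_real (cos (2 * pi * real (Suc l) * x)) * f x) =
        of_real (Gamma s) * (z - u) powr (- of_real s) + of_real (Gamma s) * (z - (- u)) powr (- of_real s)"
      using two_cos_integral[of "2 * pi * real (Suc l)" f] Gu unfolding u by simp
    also have "\<dots> = of_real (Gamma s) * g l"
    proof -
      have "z - 2 * pi * of_nat (Suc l) * \<i> = z - u" "z + 2 * pi * of_nat (Suc l) * \<i> = z - (- u)"
        by (simp_all add: u_def)
      then show ?thesis unfolding g_def by (simp only: distrib_left)
    qed
    finally show ?thesis .
  qed
  have ps: "(\<lambda>l. of_real (Gamma s) * g l) sums (LBINT x:{0<..}. of_real (bern x) * f2 x)"
    using poisson unfolding cosint .
  have G0: "of_real (Gamma s) \<noteq> (0 :: complex)"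
    using Gamma_real_pos[of s] s by (metis less_irrefl of_real_eq_0_iff order_less_trans zero_less_numeral)
  show sg: "summable g"
    using ps G0 by (auto simp: sums_iff)
  have val: "(LBINT x:{0<..}. of_real (bern x) * f2 x) = of_real (Gamma s) * (\<Sum>l. g l)"
    using ps sums_mult[OF summable_sums[OF sg], of "of_real (Gamma s)"] by (metis sums_unique2)
  \<comment> \<open>The trapezoidal error up to X tends to the Poisson series; adding back the
    integral and half the last term, which tends to 0, gives the plain series.\<close>
  have t1: "(\<lambda>X. (\<Sum>d=1..X. f (real d)) - f (real X) / 2 - (LBINT x:{0<..<real X}. f x)) \<longlonglongrightarrow> of_real (Gamma s) * (\<Sum>l. g l)"
    unfolding trapezoid val [symmetric] by (rule tendsto_set_integral_Ioo_sequentially[OF int_bern])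
  have t2: "(\<lambda>X. LBINT x:{0<..<real X}. f x) \<longlonglongrightarrow> of_real (Gamma s) * z powr (- of_real s)"
    using tendsto_set_integral_Ioo_sequentially[OF int] G(2)[of 0] by simp
  have t3: "(\<lambda>X. f (real X) / 2) \<longlonglongrightarrow> 0 / 2"
    by (intro tendsto_intros filterlim_compose[OF lim_top filterlim_real_sequentially]) auto
  have "(\<lambda>X. \<Sum>d=1..X. f (real d)) \<longlonglongrightarrow> of_real (Gamma s) * (\<Sum>l. g l) + 0 / 2 + of_real (Gamma s) * z powr (- of_real s)"
    using tendsto_add[OF tendsto_add[OF t1 t3] t2] by simp
  then have "(\<lambda>X. \<Sum>d<X. f (real (Suc d))) \<longlonglongrightarrow> of_real (Gamma s) * (z powr (- of_real s) + (\<Sum>l. g l))"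
    by (simp add: sum.shift_bounds_Suc_ivl sum.atLeast1_atMost_eq distrib_left add.commute)
  then show "(\<lambda>d. of_real (real (Suc d) powr (s - 1)) * exp (- of_real (real (Suc d)) * z)) sums
           (of_real (Gamma s) * (z powr (- of_real s) + (\<Sum>l. g l)))"
    by (simp only: sums_def f_def P_def)
qed

section \<open>The complex kernel and its sums over a lattice\<close>

definition kern :: "real \<Rightarrow> complex \<Rightarrow> real \<Rightarrow> complex" where
  "kern s w y = (\<i> * (of_real y - w)) powr (- of_real s)"

text \<open>The Lipschitz formula at z = - 2 pi i w / x: after extracting the positive factor 2 pi /
  x, the shifts of z by multiples of 2 pi i become the lattice points that are multiples of x. The
  sum of the kernel over the lattice thus equals x powr (- s) times an exponential series in w /
  x.\<close>

lemma lattice_sum_kern: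
  fixes s x :: real and w :: complex
  assumes s: "s > 2" and w: "Im w > 0" and x: "x > 0"
  shows "summable (\<lambda>m. kern s w (- x * real (Suc m)) + kern s w (x * real (Suc m)))"
    and "(\<lambda>k. of_real (real (Suc k) powr (s - 1)) * exp (2 * pi * \<i> * of_real (real (Suc k)) * w / of_real x)) sums
       (of_real (Gamma s * (2 * pi) powr (- s) * x powr s) *
         (kern s w 0 + (\<Sum>m. kern s w (- x * real (Suc m)) + kern s w (x * real (Suc m)))))"
proof -
  define z where "z = of_real (2 * pi / x) * (\<i> * (- w))"
  have z: "Re z > 0"
  proof -
    have "Re z = 2 * pi / x * Im w" by (simp add: z_def)
    then show ?thesis using w x by simp
  qed
  define g where "g = (\<lambda>l. (z - 2 * pi * of_nat (Suc l) * \<i>) powr (- of_real s) + (z + 2 * pi * of_nat (Suc l) * \<i>) powr (- of_real s))"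
  note L = lipschitz_formula[OF s z, folded g_def]
  have sc: "(of_real (2 * pi / x) * u) powr (- of_real s) = of_real ((2 * pi / x) powr (- s)) * u powr (- of_real s)" for u :: complex
    using cpowr_of_real_mult[of "2 * pi / x" u "- s"] x by simp
  have z0: "z powr (- of_real s) = of_real ((2 * pi / x) powr (- s)) * kern s w 0"
    unfolding z_def sc by (simp add: kern_def)
  have g: "g l = of_real ((2 * pi / x) powr (- s)) * (kern s w (- x * real (Suc l)) + kern s w (x * real (Suc l)))" for l
  proof -
    have "z - 2 * pi * of_nat (Suc l) * \<i> = of_real (2 * pi / x) * (\<i> * (of_real (- x * real (Suc l)) - w))"
      "z + 2 * pi * of_nat (Suc l) * \<i> = of_real (2 * pi / x) * (\<i> * (of_real (x * real (Suc l)) - w))"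
      using x by (simp_all add: z_def field_simps)
    then show ?thesis unfolding g_def kern_def by (simp only: sc distrib_left)
  qed
  have c0: "complex_of_real ((2 * pi / x) powr (- s)) \<noteq> 0" using x by simp
  show sm: "summable (\<lambda>m. kern s w (- x * real (Suc m)) + kern s w (x * real (Suc m)))"
    using L(1) c0 unfolding g by (simp only: summable_cmult_iff) simp
  have "(\<Sum>l. g l) = of_real ((2 * pi / x) powr (- s)) * (\<Sum>m. kern s w (- x * real (Suc m)) + kern s w (x * real (Suc m)))"
    unfolding g by (rule suminf_mult[OF sm])
  then have "of_real (Gamma s) * (z powr (- of_real s) + (\<Sum>l. g l)) = of_real (Gamma s * (2 * pi / x) powr (- s)) *
     (kern s w 0 + (\<Sum>m. kern s w (- x * real (Suc m)) + kern s w (x * real (Suc m))))"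
    unfolding z0 by (simp only: of_real_mult distrib_left mult.assoc)
  moreover have "Gamma s * (2 * pi / x) powr (- s) = Gamma s * (2 * pi) powr (- s) * x powr s"
    using x by (simp add: powr_divide powr_minus_divide)
  moreover have "- of_real (real (Suc d)) * z = 2 * pi * \<i> * of_real (real (Suc d)) * w / of_real x" for d
    by (simp add: z_def mult_ac del: of_nat_Suc)
  ultimately show "(\<lambda>k. of_real (real (Suc k) powr (s - 1)) * exp (2 * pi * \<i> * of_real (real (Suc k)) * w / of_real x)) sums
       (of_real (Gamma s * (2 * pi) powr (- s) * x powr s) *
         (kern s w 0 + (\<Sum>m. kern s w (- x * real (Suc m)) + kern s w (x * real (Suc m)))))"
    using L(2) by (simp only:)
qed

text \<open>The summand after the Lipschitz formula as a function of the real spacing x: the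
  exponential exp (2 pi i k w / x), divided by x powr s and multiplied by x powr \<alpha>, is of
  this form with B = - 2 pi i k w. \<open>fB1\<close> and \<open>fB2\<close> are its first two
  derivatives.\<close>

definition fB :: "complex \<Rightarrow> real \<Rightarrow> complex" where
  "fB B x = of_real (x powr (-5/2)) * exp (- B / of_real x)"

definition fB1 :: "complex \<Rightarrow> real \<Rightarrow> complex" where
  "fB1 B x = of_real (-5/2) * (of_real (x powr (-7/2)) * exp (- B / of_real x)) + B * (of_real (x powr (-9/2)) * exp (- B / of_real x))"

definition fB2 :: "complex \<Rightarrow> real \<Rightarrow> complex" where
  "fB2 B x =
     of_real (-5/2) * (of_real (-7/2) * (of_real (x powr (-9/2)) * exp (- B / of_real x)) + B * (of_real (x powr (-11/2)) * exp (- B / of_real x)))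
     + B * (of_real (-9/2) * (of_real (x powr (-11/2)) * exp (- B / of_real x)) + B * (of_real (x powr (-13/2)) * exp (- B / of_real x)))"

lemma halfline_C2_fB:
  assumes B: "Re B > 0"
  shows "halfline_C2 (fB B) (fB1 B) (fB2 B)"
proof
  define R where "R = (\<lambda>p x. of_real (x powr p) * exp (- B / of_real x))"
  have dR: "(R p has_vector_derivative of_real p * R (p - 1) x + B * R (p - 2) x) (at x)" if "x > 0" for p x
    unfolding R_def by (rule has_vector_derivative_powr_exp_inverse[OF that])
  have cR: "continuous_on {0<..} (R p)" for p
    unfolding R_def by (intro continuous_intros) auto
  have iR: "set_integrable lborel {0<..} (R p)" if "p < -1" for p
    unfolding R_def by (rule set_integrable_powr_exp_inverse_complex[OF B that])
  have lR: "(R p \<longlongrightarrow> 0) (at_right 0)" for p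
    unfolding R_def by (rule tendsto_powr_exp_inverse(1)[OF B])
  have lR': "(R p \<longlongrightarrow> 0) at_top" if "p < 0" for p
    unfolding R_def by (rule tendsto_powr_exp_inverse(2)[OF B that])
  have f: "fB B = R (-5/2)" by (simp add: fun_eq_iff fB_def R_def)
  have f1: "fB1 B = (\<lambda>x. of_real (-5/2) * R (-7/2) x + B * R (-9/2) x)"
    by (simp add: fun_eq_iff fB1_def R_def)
  have f2: "fB2 B = (\<lambda>x. of_real (-5/2) * (of_real (-7/2) * R (-9/2) x + B * R (-11/2) x)
     + B * (of_real (-9/2) * R (-11/2) x + B * R (-13/2) x))"
    by (simp only: fun_eq_iff fB2_def R_def) simp
  have e: "-5/2 - 1 = (-7/2::real)" "-5/2 - 2 = (-9/2::real)" "-7/2 - 1 = (-9/2::real)"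
    "-7/2 - 2 = (-11/2::real)" "-9/2 - 1 = (-11/2::real)" "-9/2 - 2 = (-13/2::real)" by simp_all
  show "(fB B has_vector_derivative fB1 B x) (at x)" if "x > 0" for x
    using dR[OF that, of "-5/2"] unfolding f f1 e .
  show "(fB1 B has_vector_derivative fB2 B x) (at x)" if "x > 0" for x
    using has_vector_derivative_add[OF has_vector_derivative_mult_right[OF dR[OF that, of "-7/2"], of "of_real (-5/2)"]
         has_vector_derivative_mult_right[OF dR[OF that, of "-9/2"], of B]]
    unfolding f1 f2 e .
  show "continuous_on {0<..} (fB2 B)" unfolding f2 by (intro continuous_intros cR)
  show "set_integrable lborel {0<..} (fB B)" unfolding f by (intro iR) simp
  show "set_integrable lborel {0<..} (fB2 B)"
    unfolding f2 by (intro set_integral_add(1) set_integrable_mult_right iR) auto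
  show "(fB B \<longlongrightarrow> 0) (at_right 0)" unfolding f by (rule lR)
  show "(fB B \<longlongrightarrow> 0) at_top" unfolding f by (intro lR') simp
  have "(fB1 B \<longlongrightarrow> of_real (-5/2) * 0 + B * 0) (at_right 0)" "(fB1 B \<longlongrightarrow> of_real (-5/2) * 0 + B * 0) at_top"
    unfolding f1 by (intro tendsto_intros lR lR'; simp)+
  then show "(fB1 B \<longlongrightarrow> 0) (at_right 0)" "(fB1 B \<longlongrightarrow> 0) at_top" by simp_all
  show "fB B 0 = 0" by (simp add: fB_def)
qed

text \<open>Under joint scaling of B and x the exponential is invariant, so \<open>fB\<close> is
  homogeneous of degree -5/2 and its second derivative of degree -9/2.\<close>

lemma fB2_scale:
  assumes k: "k > 0"  and y: "y > 0"
  shows "fB2 (of_real k * B) (k * y) = of_real (k powr (-9/2)) * fB2 B y"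
proof -
  have e: "- (of_real k * B) / of_real (k * y) = - B / of_real y"
    using k by simp
  have p: "(k * y) powr p = k powr p * y powr p" for p
    using k y by (simp add: powr_mult)
  have p1: "k * k powr (-11/2) = k powr (-9/2)"
    using powr_add[of k 1 "-11/2"] k by simp
  have p2: "k * (k * k powr (-13/2)) = k powr (-9/2)"
    using powr_add[of k 2 "-13/2"] k by (simp add: powr_numeral power2_eq_square)
  have c1: "of_real k * complex_of_real (k powr (-11/2)) = of_real (k powr (-9/2))"
    by (metis p1 of_real_mult)
  have c2: "of_real k * (of_real k * complex_of_real (k powr (-13/2))) = of_real (k powr (-9/2))"
    by (metis p2 of_real_mult)
  define q where "q = complex_of_real (k powr (-9/2))"
  define E where "E = exp (- B / of_real y)"
  define u v t where "u = complex_of_real (y powr (-9/2))" and "v = complex_of_real (y powr (-11/2))" and "t = complex_of_real (y powr (-13/2))"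
  define a b where "a = complex_of_real (k powr (-11/2))" and "b = complex_of_real (k powr (-13/2))"
  have "fB2 (of_real k * B) (k * y) =
     of_real (-5/2) * (of_real (-7/2) * ((q * u) * E) + (of_real k * B) * ((a * v) * E))
     + (of_real k * B) * (of_real (-9/2) * ((a * v) * E) + (of_real k * B) * ((b * t) * E))"
    unfolding fB2_def e q_def E_def u_def v_def t_def a_def b_def unfolding p of_real_mult ..
  also have "\<dots> = of_real (-5/2) * (of_real (-7/2) * ((q * u) * E) + (of_real k * a) * (B * (v * E)))
     + B * (of_real (-9/2) * ((of_real k * a) * (v * E))) + (of_real k * (of_real k * b)) * (B * (B * (t * E)))"
    by (simp only: distrib_left mult_ac add.assoc)
  also have "of_real k * a = q" using c1 by (simp add: a_def q_def)
  also have "of_real k * (of_real k * b) = q" using c2 by (simp add: b_def q_def)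
  also have "of_real (-5/2) * (of_real (-7/2) * ((q * u) * E) + q * (B * (v * E)))
     + B * (of_real (-9/2) * (q * (v * E))) + q * (B * (B * (t * E))) =
     q * (of_real (-5/2) * (of_real (-7/2) * (u * E) + B * (v * E)) + B * (of_real (-9/2) * (v * E) + B * (t * E)))"
    by (simp only: distrib_left mult_ac add.assoc)
  also have "\<dots> = q * fB2 B y"
    unfolding fB2_def E_def u_def v_def t_def ..
  finally show ?thesis by (simp add: q_def)
qed

text \<open>Homogeneity gives the exact dependence of the L1 norm on k. The power -7/2 is what makes
  the series with weights k powr (3/2 + \<alpha>) converge.\<close>

lemma fB2_norm_integral:
  assumes B: "Re B > 0" and k: "k > 0"
  shows "(LBINT x:{0<..}. norm (fB2 (of_real k * B) x)) = k powr (-7/2) * (LBINT x:{0<..}. norm (fB2 B x))"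
proof -
  have "(LBINT x:{0<..}. norm (fB2 (of_real k * B) x)) = k *\<^sub>R (LBINT y:{0<..}. norm (fB2 (of_real k * B) (k * y)))"
    by (rule set_integral_Ioi_scale(2)[OF k])
  also have "(LBINT y:{0<..}. norm (fB2 (of_real k * B) (k * y))) = (LBINT y:{0<..}. k powr (-9/2) * norm (fB2 B y))"
    using k by (intro set_lebesgue_integral_cong) (auto simp: fB2_scale norm_mult)
  also have "k *\<^sub>R \<dots> = (k * k powr (-9/2)) * (LBINT y:{0<..}. norm (fB2 B y))" by simp
  also have "k * k powr (-9/2) = k powr (-7/2)"
    using powr_add[of k 1 "-9/2"] k by simp
  finally show ?thesis .
qed

text \<open>The two exponentials of the cosine give Bessel integrals with a^2 = B and b^2 = - 2 pi i
  L or 2 pi i L, where L = l + 1. With r = sqrt (k L) the product a b is - 2 pi i r T in the former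
  case, which yields the oscillating exponential, and 2 pi r T in the latter, which yields one that
  decays in Re T.\<close>

lemma fB_fourier:
  fixes T :: complex and k :: nat
  assumes T: "Re T > 0" "Im T > 0" and k: "k > 0"
  defines "B \<equiv> of_real (real k) * (- 2 * pi * \<i> * T\<^sup>2)"
  shows "Re B > 0"
    and "2 * (LBINT x:{0<..}. of_real (cos (2 * pi * real (Suc l) * x)) * fB B x) =
       of_real (sqrt pi * (2 * pi * real k) powr (-3/2)) * cis (3 * pi / 4) / T ^ 3 *
       ((1 / 2 - 2 * pi * \<i> * of_real (sqrt (k * Suc l)) * T) * exp (4 * pi * \<i> * of_real (sqrt (k * Suc l)) * T)
        + (1 / 2 + 2 * pi * of_real (sqrt (k * Suc l)) * T) * exp (- 4 * pi * of_real (sqrt (k * Suc l)) * T))"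
proof -
  define L where "L = real (Suc l)"
  have L: "L > 0" by (simp add: L_def)
  define r where "r = sqrt (k * Suc l)"
  define rk where "rk = sqrt (2 * pi * k)"
  define rl where "rl = sqrt (2 * pi * L)"
  have rk: "rk > 0" "rk\<^sup>2 = 2 * pi * k" and rl: "rl > 0" "rl\<^sup>2 = 2 * pi * L"
    using k L by (simp_all add: rk_def rl_def)
  have gmean: "rk * rl = 2 * pi * r"
  proof -
    have "rk * rl = sqrt ((2 * pi * k) * (2 * pi * L))"
      by (simp only: rk_def rl_def real_sqrt_mult)
    also have "(2 * pi * k) * (2 * pi * L) = (2 * pi)\<^sup>2 * (k * Suc l)"
      by (simp add: L_def power2_eq_square algebra_simps)
    finally have "rk * rl = sqrt ((2 * pi)\<^sup>2) * r" by (simp only: r_def real_sqrt_mult)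
    then show ?thesis by (simp only: real_sqrt_abs) simp
  qed
  \<comment> \<open>The square roots are taken in the right half-plane: cis (- pi / 4) squares to -
    i, and T in the open first quadrant gives Re a > 0 and Re (a^2) = 4 pi k Re T Im T > 0.\<close>
  define a where "a = of_real rk * (cis (- pi / 4) * T)"
  define b where "b = of_real rl * cis (pi / 4)"
  define b' where "b' = of_real rl * cis (- pi / 4)"
  have c2: "(cis (pi / 4))\<^sup>2 = \<i>" "(cis (- pi / 4))\<^sup>2 = - \<i>"
    by (simp_all add: Complex.DeMoivre complex_eq_iff)
  have a2: "a\<^sup>2 = B"
    unfolding a_def power_mult_distrib c2 of_real_power [symmetric] rk(2) B_def by simp
  have b2: "b\<^sup>2 = of_real (2 * pi * L) * \<i>" "b'\<^sup>2 = - (of_real (2 * pi * L) * \<i>)"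
    unfolding b_def b'_def power_mult_distrib c2 of_real_power [symmetric] rl(2) by simp_all
  have s2: "cos (pi / 4) > 0" "sin (pi / 4) = cos (pi / 4)" by (simp_all add: cos_45 sin_45)
  have Rea: "Re a > 0"
  proof -
    have "Re a = rk * (cos (pi / 4) * (Re T + Im T))"
      using s2(2) by (simp add: a_def algebra_simps)
    then show ?thesis using rk(1) s2(1) T by simp
  qed
  have ReB: "Re B = real k * (4 * pi * (Re T * Im T))"
    by (simp add: B_def power2_eq_square)
  show B: "Re B > 0" unfolding ReB using k T by simp
  have Rea2: "Re (a\<^sup>2) > 0" unfolding a2 by (rule B)
  have Reb: "Re b > 0" "Re b' > 0" using s2 rl(1) by (simp_all add: b_def b'_def)
  have Reb2: "Re (b\<^sup>2) \<ge> 0" "Re (b'\<^sup>2) \<ge> 0" unfolding b2 by simp_all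
  have cc: "cis (- pi / 4) * cis (pi / 4) = 1" "cis (- pi / 4) * cis (- pi / 4) = - \<i>"
    using c2(2) by (simp_all add: cis_mult power2_eq_square)
  have ab: "a * b = 2 * pi * of_real r * T"
  proof -
    have "a * b = of_real (rk * rl) * (cis (- pi / 4) * cis (pi / 4)) * T"
      by (simp add: a_def b_def mult_ac)
    then show ?thesis unfolding cc gmean by simp
  qed
  have ab': "a * b' = - (2 * pi * \<i> * of_real r * T)"
  proof -
    have "a * b' = of_real (rk * rl) * (cis (- pi / 4) * cis (- pi / 4)) * T"
      by (simp add: a_def b'_def mult_ac)
    then show ?thesis unfolding cc gmean by simp
  qed
  have a3: "1 / a ^ 3 = of_real ((2 * pi * k) powr (-3/2)) * cis (3 * pi / 4) / T ^ 3"
  proof -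
    have "rk ^ 3 = (2 * pi * k) powr (3/2)"
      using k by (simp add: rk_def powr_half_sqrt [symmetric] powr_power)
    then have "1 / complex_of_real rk ^ 3 = of_real ((2 * pi * k) powr (-3/2))"
      by (simp add: powr_minus_divide flip: of_real_power)
    moreover have "1 / cis (- pi / 4) ^ 3 = cis (3 * pi / 4)"
    proof -
      have "cis (- pi / 4) ^ 3 * cis (3 * pi / 4) = 1"
        by (simp add: Complex.DeMoivre cis_mult)
      then show ?thesis by (simp add: field_simps)
    qed
    moreover have "1 / (x * (y * t)) = (1 / x) * (1 / y) / t" for x y t :: complex by simp
    ultimately show ?thesis
      unfolding a_def power_mult_distrib by metis
  qed
  have intp: "set_integrable lborel {0<..} (\<lambda>x. exp (- \<beta>\<^sup>2 * of_real x) * fB B x)"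
     "(LBINT x:{0<..}. exp (- \<beta>\<^sup>2 * of_real x) * fB B x) = of_real (sqrt pi) * (1 / a ^ 3) * (exp (- 2 * (a * \<beta>)) * (1 / 2 + a * \<beta>))"
    if \<beta>: "Re \<beta> > 0" "Re (\<beta>\<^sup>2) \<ge> 0" for \<beta>
  proof -
    have e: "of_real (x powr (-5/2)) * exp (- a\<^sup>2 / of_real x - \<beta>\<^sup>2 * of_real x) = exp (- \<beta>\<^sup>2 * of_real x) * fB B x" for x
    proof -
      have "exp (- a\<^sup>2 / of_real x - \<beta>\<^sup>2 * of_real x) = exp (- \<beta>\<^sup>2 * of_real x) * exp (- B / of_real x)"
        unfolding a2 exp_add [symmetric] by (simp add: algebra_simps)
      then show ?thesis by (simp add: fB_def)
    qed
    show "set_integrable lborel {0<..} (\<lambda>x. exp (- \<beta>\<^sup>2 * of_real x) * fB B x)"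
      using bessel_integral_aux(1)[OF Rea Rea2 \<beta>] unfolding e .
    show "(LBINT x:{0<..}. exp (- \<beta>\<^sup>2 * of_real x) * fB B x) = of_real (sqrt pi) * (1 / a ^ 3) * (exp (- 2 * (a * \<beta>)) * (1 / 2 + a * \<beta>))"
      using bessel_integral[OF Rea Rea2 \<beta>] unfolding e by (simp add: mult.assoc)
  qed
  have u: "\<i> * of_real (2 * pi * L * x) = - b'\<^sup>2 * of_real x" "- \<i> * of_real (2 * pi * L * x) = - b\<^sup>2 * of_real x" for x
    unfolding b2 by simp_all
  have "2 * (LBINT x:{0<..}. of_real (cos (2 * pi * L * x)) * fB B x) =
     of_real (sqrt pi) * (1 / a ^ 3) * (exp (- 2 * (a * b')) * (1 / 2 + a * b')) +
     of_real (sqrt pi) * (1 / a ^ 3) * (exp (- 2 * (a * b)) * (1 / 2 + a * b))"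
    using two_cos_integral[of "2 * pi * L" "fB B"] intp[OF Reb(1) Reb2(1)] intp[OF Reb(2) Reb2(2)]
    unfolding u by simp
  also have "\<dots> = of_real (sqrt pi) * (1 / a ^ 3) *
     ((1 / 2 - 2 * pi * \<i> * of_real r * T) * exp (4 * pi * \<i> * of_real r * T)
        + (1 / 2 + 2 * pi * of_real r * T) * exp (- 4 * pi * of_real r * T))"
  proof -
    have g: "p * (e1 * (1 / 2 + - X)) + p * (e2 * (1 / 2 + Y)) = p * ((1 / 2 - X) * e1 + (1 / 2 + Y) * e2)"
      for p e1 e2 X Y :: complex by (simp add: algebra_simps)
    have e: "- 2 * - (2 * pi * \<i> * of_real r * T) = 4 * pi * \<i> * of_real r * T"
      "- 2 * (2 * pi * of_real r * T) = - 4 * pi * of_real r * T" by simp_all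
    show ?thesis unfolding ab ab' e g ..
  qed
  also have "\<dots> = of_real (sqrt pi * (2 * pi * real k) powr (-3/2)) * cis (3 * pi / 4) / T ^ 3 *
       ((1 / 2 - 2 * pi * \<i> * of_real r * T) * exp (4 * pi * \<i> * of_real r * T)
        + (1 / 2 + 2 * pi * of_real r * T) * exp (- 4 * pi * of_real r * T))"
    unfolding a3 by simp
  finally show "2 * (LBINT x:{0<..}. of_real (cos (2 * pi * real (Suc l) * x)) * fB B x) =
       of_real (sqrt pi * (2 * pi * real k) powr (-3/2)) * cis (3 * pi / 4) / T ^ 3 *
       ((1 / 2 - 2 * pi * \<i> * of_real (sqrt (k * Suc l)) * T) * exp (4 * pi * \<i> * of_real (sqrt (k * Suc l)) * T)
        + (1 / 2 + 2 * pi * of_real (sqrt (k * Suc l)) * T) * exp (- 4 * pi * of_real (sqrt (k * Suc l)) * T))"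
    unfolding L_def r_def .
qed

section \<open>The Voronoi formula\<close>

lemma summable_Suc_powr: "p < -1 \<Longrightarrow> summable (\<lambda>k. real (Suc k) powr p)"
  using summable_real_powr_iff[of p] by (subst summable_Suc_iff) simp

text \<open>Iterated rather than unordered summation, so that estimates reduce to series in one
  variable. Unordered sums enter only where terms are regrouped by their product.\<close>

definition pair_summable :: "(nat \<Rightarrow> nat \<Rightarrow> complex) \<Rightarrow> bool" where
  "pair_summable F \<longleftrightarrow> (\<forall>d. summable (\<lambda>m. norm (F d m))) \<and> summable (\<lambda>d. \<Sum>m. norm (F d m))"

definition pair_sum :: "(nat \<Rightarrow> nat \<Rightarrow> complex) \<Rightarrow> complex" where
  "pair_sum F = (\<Sum>d. \<Sum>m. F d m)"

lemma pair_summable_productI: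
  assumes F: "\<And>d m. norm (F d m) \<le> a d * b m" and a: "summable a" and b: "summable b"
  shows "pair_summable F" and "norm (pair_sum F) \<le> suminf a * suminf b"
proof -
  have s1: "summable (\<lambda>m. norm (F d m))" for d
    by (rule summable_comparison_test'[OF summable_mult[OF b, of "a d"]]) (use F in simp)
  have le: "(\<Sum>m. norm (F d m)) \<le> a d * suminf b" for d
    unfolding suminf_mult[OF b, symmetric]
    by (rule suminf_le[OF F s1 summable_mult[OF b]])
  have nn: "0 \<le> (\<Sum>m. norm (F d m))" for d
    by (rule suminf_nonneg[OF s1]) simp
  have s2: "summable (\<lambda>d. \<Sum>m. norm (F d m))"
    by (rule summable_comparison_test'[OF summable_mult2[OF a, of "suminf b"]]) (use le nn in simp)
  show "pair_summable F" using s1 s2 by (simp add: pair_summable_def)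
  have n1: "norm (\<Sum>m. F d m) \<le> (\<Sum>m. norm (F d m))" for d
    by (rule summable_norm[OF s1])
  have s3: "summable (\<lambda>d. norm (\<Sum>m. F d m))"
    by (rule summable_comparison_test'[OF s2]) (use n1 in simp)
  have "norm (pair_sum F) \<le> (\<Sum>d. norm (\<Sum>m. F d m))"
    unfolding pair_sum_def by (rule summable_norm[OF s3])
  also have "\<dots> \<le> (\<Sum>d. a d * suminf b)"
    by (rule suminf_le[OF order_trans[OF n1 le] s3 summable_mult2[OF a]])
  also have "\<dots> = suminf a * suminf b" by (rule suminf_mult2[OF a, symmetric])
  finally show "norm (pair_sum F) \<le> suminf a * suminf b" .
qed

lemma pair_summable_inner:
  assumes "pair_summable F"
  shows "summable (\<lambda>m. F d m)" and "summable (\<lambda>d. \<Sum>m. F d m)"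
proof -
  have s1: "summable (\<lambda>m. norm (F d m))" for d using assms by (simp add: pair_summable_def)
  have s2: "summable (\<lambda>d. \<Sum>m. norm (F d m))" using assms by (simp add: pair_summable_def)
  show "summable (\<lambda>m. F d m)" by (rule summable_norm_cancel[OF s1])
  show "summable (\<lambda>d. \<Sum>m. F d m)"
    by (rule summable_comparison_test'[OF s2]) (use summable_norm[OF s1] in simp)
qed

lemma pair_has_sum:
  assumes F: "pair_summable F"
  shows "((\<lambda>(d, m). F d m) has_sum pair_sum F) UNIV"
proof -
  have s1: "summable (\<lambda>m. norm (F d m))" for d using F by (simp add: pair_summable_def)
  have s2: "summable (\<lambda>d. \<Sum>m. norm (F d m))" using F by (simp add: pair_summable_def)
  have "(\<lambda>p. norm ((\<lambda>(d, m). F d m) p)) summable_on Sigma UNIV (\<lambda>_. UNIV)"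
  proof (rule summable_on_SigmaI)
    show "((\<lambda>m. norm ((\<lambda>(d, m). F d m) (d, m))) has_sum (\<Sum>m. norm (F d m))) UNIV" for d
      using s1[of d] by (auto intro!: norm_summable_imp_has_sum summable_sums)
    show "(\<lambda>d. \<Sum>m. norm (F d m)) summable_on UNIV"
      using s2 suminf_nonneg[OF s1] by (intro norm_summable_imp_summable_on) simp
  qed auto
  then have "(\<lambda>(d, m). F d m) summable_on Sigma UNIV (\<lambda>_. UNIV)"
    by (rule abs_summable_summable)
  then obtain S where S: "((\<lambda>(d, m). F d m) has_sum S) (Sigma UNIV (\<lambda>_. UNIV))"
    by (auto simp: summable_on_def)
  have "((\<lambda>m. (\<lambda>(d, m). F d m) (d, m)) has_sum (\<Sum>m. F d m)) UNIV" for d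
    using s1[of d] by (auto intro!: norm_summable_imp_has_sum summable_sums summable_norm_cancel)
  from has_sum_SigmaD[OF S this] have "(\<lambda>d. \<Sum>m. F d m) sums S"
    by (rule has_sum_imp_sums)
  then have "S = pair_sum F" by (simp add: pair_sum_def sums_iff)
  with S show ?thesis by simp
qed

text \<open>Absolute convergence allows the pairs (d, m) to be collected by their product n. The
  fibre over n is the set of divisors of n, which produces \<open>divisor_sigma\<close>.\<close>

lemma divisor_sum_rearrange:
  fixes g :: "nat \<Rightarrow> complex"
  assumes F: "pair_summable (\<lambda>d m. of_real (real (Suc d) powr \<alpha>) * g (Suc d * Suc m))"
  shows "(\<lambda>n. of_real (divisor_sigma \<alpha> (Suc n)) * g (Suc n)) sums
           pair_sum (\<lambda>d m. of_real (real (Suc d) powr \<alpha>) * g (Suc d * Suc m))"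
proof -
  define F where "F = (\<lambda>(d, m). of_real (real (Suc d) powr \<alpha>) * g (Suc d * Suc m))"
  define S where "S = pair_sum (\<lambda>d m. of_real (real (Suc d) powr \<alpha>) * g (Suc d * Suc m))"
  have hs: "(F has_sum S) UNIV"
    using pair_has_sum[OF F] by (simp add: F_def S_def)
  define D where "D = Sigma (UNIV :: nat set) (\<lambda>n. {d. d dvd Suc n})"
  \<comment> \<open>Indices of the series are shifted by one: (n, d) stands for the number n + 1
    with its true divisor d, and is sent to the zero-based indices of d and of its cofactor.\<close>
  define j where "j = (\<lambda>(n, d). (d - 1, Suc n div d - 1))"
  have "bij_betw j D UNIV"
  proof (rule bij_betw_byWitness[where f' = "\<lambda>(d, m). (Suc d * Suc m - 1, Suc d)"])
    have "d > 0" if "d dvd Suc n" for n d using that by (auto intro: Nat.gr0I)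
    moreover have "Suc n div d > 0" if "d dvd Suc n" for n d
      using that by (auto simp: div_greater_zero_iff dvd_imp_le intro: Nat.gr0I)
    ultimately show "\<forall>a\<in>D. (\<lambda>(d, m). (Suc d * Suc m - 1, Suc d)) (j a) = a"
      by (auto simp: D_def j_def simp del: mult_Suc mult_Suc_right)
    show "\<forall>a'\<in>UNIV. j ((\<lambda>(d, m). (Suc d * Suc m - 1, Suc d)) a') = a'"
      by (auto simp: j_def simp del: mult_Suc mult_Suc_right)
    show "j ` D \<subseteq> UNIV" by simp
    show "(\<lambda>(d, m). (Suc d * Suc m - 1, Suc d)) ` UNIV \<subseteq> D"
      by (auto simp: D_def simp del: mult_Suc mult_Suc_right)
  qed
  from has_sum_reindex_bij_betw[OF this] hs have "((\<lambda>x. F (j x)) has_sum S) D" by blast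
  then have hs': "((\<lambda>(n, d). of_real (real d powr \<alpha>) * g (Suc n)) has_sum S) D"
  proof (rule has_sum_cong[THEN iffD1, rotated])
    fix x assume "x \<in> D"
    then obtain n d where x: "x = (n, d)" "d dvd Suc n" by (auto simp: D_def)
    then have "d > 0" by (auto intro: Nat.gr0I)
    moreover have "Suc n div d > 0" using x \<open>d > 0\<close> by (auto simp: div_greater_zero_iff dvd_imp_le)
    ultimately show "F (j x) = (case x of (n, d) \<Rightarrow> of_real (real d powr \<alpha>) * g (Suc n))"
      using x by (simp add: F_def j_def del: mult_Suc mult_Suc_right)
  qed
  have "((\<lambda>d. (\<lambda>(n, d). of_real (real d powr \<alpha>) * g (Suc n)) (n, d)) has_sum
      (of_real (divisor_sigma \<alpha> (Suc n)) * g (Suc n))) {d. d dvd Suc n}" for n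
  proof -
    have "finite {d. d dvd Suc n}" by simp
    from has_sum_finite[OF this, of "\<lambda>d. of_real (real d powr \<alpha>) * g (Suc n)"]
    show ?thesis by (simp add: divisor_sigma_def sum_distrib_right)
  qed
  from has_sum_SigmaD[OF hs'[unfolded D_def] this] show ?thesis
    unfolding S_def by (rule has_sum_imp_sums)
qed

section \<open>Size, derivative and decay of the kernel\<close>

lemma norm_cpowr_real:
  fixes z :: complex
  assumes "z \<noteq> 0"
  shows "norm (z powr of_real r) = norm z powr r"
  using assms by (simp add: powr_def norm_exp_eq_Re)

lemma norm_kern:
  assumes "Im w > 0"
  shows "norm (kern s w y) = norm (of_real y - w) powr (- s)"
proof -
  have "\<i> * (of_real y - w) \<noteq> 0" using assms by (auto simp: complex_eq_iff)
  from norm_cpowr_real[OF this, of "- s"] show ?thesis by (simp add: kern_def norm_mult)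
qed

text \<open>The real part of i (y - w) is Im w, so the principal power meets no branch cut for real
  y.\<close>

lemma kern_arg_pos: "Im w > 0 \<Longrightarrow> \<i> * (of_real y - w) \<notin> \<real>\<^sub>\<le>\<^sub>0"
  by (auto simp: complex_nonpos_Reals_iff)

lemma has_vector_derivative_kern:
  assumes w: "Im w > 0"
  shows "(kern s w has_vector_derivative (- of_real s * \<i> * kern (s + 1) w y)) (at y)"
proof -
  have "((\<lambda>z. (\<i> * (z - w)) powr (- of_real s)) has_field_derivative
      (- of_real s * (\<i> * (of_real y - w)) powr (- of_real s - 1)) * \<i>) (at (of_real y))"
    using kern_arg_pos[OF w, of y] by (auto intro!: derivative_eq_intros)
  from has_vector_derivative_real_field[OF this] show ?thesis
    by (simp add: kern_def [abs_def] mult_ac)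
qed

lemma continuous_on_kern:
  assumes w: "Im w > 0" and f: "continuous_on A f"
  shows "continuous_on A (\<lambda>y. kern s w (f y))"
proof (rule continuous_on_compose2[OF _ f])
  show "continuous_on UNIV (kern s w)"
    using has_vector_derivative_kern[OF w] has_vector_derivative_continuous
    by (intro continuous_at_imp_continuous_on) blast
qed simp

lemma kern_decay:
  assumes w: "Im w > 0" and s: "s \<ge> 0"
  obtains C where "C > 0" "\<And>y. norm (kern s w y) \<le> C * (1 + \<bar>y\<bar>) powr (- s)"
proof
  \<comment> \<open>Obtained from norm (y - w) \<ge> Im w together with |y| \<le> norm w + norm (y -
    w). The constant depends on w, so the bound serves convergence questions.\<close>
  define c where "c = Im w / (1 + norm w + Im w)"
  have c: "c > 0" using w by (simp add: c_def add_pos_nonneg)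
  show "c powr (- s) > 0" using c by simp
  show "norm (kern s w y) \<le> c powr (- s) * (1 + \<bar>y\<bar>) powr (- s)" for y
  proof -
    have "Im w \<le> norm (of_real y - w)"
      using abs_Im_le_cmod[of "of_real y - w"] w by simp
    moreover have "\<bar>y\<bar> \<le> norm w + norm (of_real y - w)"
      using norm_triangle_ineq[of "w" "of_real y - w"] by simp
    ultimately have "Im w * (1 + \<bar>y\<bar>) \<le> norm (of_real y - w) + norm w * norm (of_real y - w) + Im w * norm (of_real y - w)"
      using mult_mono[of "Im w" "norm (of_real y - w)" "norm w" "norm w"]
        mult_left_mono[of "\<bar>y\<bar>" "norm w + norm (of_real y - w)" "Im w"] w
      by (simp add: algebra_simps)
    then have "c * (1 + \<bar>y\<bar>) \<le> norm (of_real y - w)"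
      using w by (simp add: c_def field_simps add_pos_nonneg)
    then have "norm (kern s w y) \<le> (c * (1 + \<bar>y\<bar>)) powr (- s)"
      unfolding norm_kern[OF w] using c s by (intro powr_mono2') auto
    then show ?thesis using c by (simp add: powr_mult)
  qed
qed

text \<open>Because Re w \<ge> 0, the distance from - y to w is at least y and at least norm w. The
  exponent s is shared between the two: p pays for convergence in y, and s - p remains as a saving
  in norm w.\<close>

lemma kern_neg_bound:
  assumes w: "Im w > 0" "Re w \<ge> 0" and y: "y > 0" and p: "0 \<le> p" "p \<le> s"
  shows "norm (kern s w (- y)) \<le> norm w powr (- (s - p)) * y powr (- p)"
proof -
  have n: "norm (of_real (- y) - w) = norm (of_real y + w)"
    by (metis minus_add_distrib norm_minus_cancel of_real_minus add_uminus_conv_diff)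
  have "y \<le> norm (of_real y + w)" using abs_Re_le_cmod[of "of_real y + w"] w by simp
  moreover have "norm w \<le> norm (of_real y + w)"
  proof -
    have "(Re w)\<^sup>2 \<le> (y + Re w)\<^sup>2" using w y by (intro power_mono) auto
    then show ?thesis by (simp add: cmod_def)
  qed
  moreover have "norm w > 0" using w by auto
  ultimately have "norm (of_real y + w) powr (- (s - p)) * norm (of_real y + w) powr (- p) \<le> norm w powr (- (s - p)) * y powr (- p)"
    using y p by (intro mult_mono powr_mono2') auto
  then show ?thesis
    unfolding norm_kern[OF w(1)] n by (simp flip: powr_add)
qed

section \<open>The Voronoi formula by trapezoidal summation over d\<close>

locale voronoi =
  fixes \<alpha> :: real and T :: complex
  assumes \<alpha>: "0 < \<alpha>" "\<alpha> < 1 / 2" and T: "Re T > 0" "Im T > 0"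
begin

abbreviation "s \<equiv> 5 / 2 + \<alpha>"
text \<open>\<open>Vp\<close> and \<open>Vm\<close> are the sums of \<open>divisor_sigma \<alpha> n * h n\<close> and \<open>divisor_sigma \<alpha> n * h (- n)\<close>,
  unfolded over the factorisations \<open>n = d m\<close>; \<open>Zc\<close> is the value of the zeta function at \<open>1 + \<alpha>\<close>;
  \<open>Osc\<close> is the oscillating side of the Voronoi formula.\<close>

definition w where "w = T\<^sup>2"
abbreviation "h \<equiv> kern s w"
definition c0 where "c0 = (2 * pi) powr s / Gamma s"
definition Bk where "Bk k = of_real (real (Suc k)) * (- 2 * pi * \<i> * T\<^sup>2)"
definition Vp where "Vp = pair_sum (\<lambda>d m. of_real (real (Suc d) powr \<alpha>) * h (real (Suc d * Suc m)))"
definition Vm where "Vm = pair_sum (\<lambda>d m. of_real (real (Suc d) powr \<alpha>) * h (- real (Suc d * Suc m)))"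
definition Jp where "Jp = (LBINT y:{0<..}. of_real (y powr \<alpha>) * h y)"
definition Jm where "Jm = (LBINT y:{0<..}. of_real (y powr \<alpha>) * h (- y))"
definition Zc where "Zc = (\<Sum>m. real (Suc m) powr (- 1 - \<alpha>))"
definition Osc where "Osc = (\<Sum>k. of_real (c0 * real (Suc k) powr (3 / 2 + \<alpha>)) * (LBINT x:{0<..}. of_real (bern x) * fB2 (Bk k) x))"

lemma Imw: "Im w > 0" using T by (simp add: w_def power2_eq_square)

lemma ReBk: "Re (Bk k) = real (Suc k) * (2 * pi * Im w)"
  by (simp add: Bk_def w_def power2_eq_square)

lemma ReBk_pos: "Re (Bk k) > 0" unfolding ReBk using Imw by simp

lemma Gamma_s: "Gamma s > 0" using \<alpha> by (intro Gamma_real_pos) auto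

lemma c0_pos: "c0 > 0" unfolding c0_def using Gamma_s by simp

definition qs where "qs m x = h (- x * real (Suc m)) + h (x * real (Suc m))"

text \<open>The sum of \<open>h\<close> over all multiples of x, weighted by x powr \<alpha>. The
  divisor d has become a real variable x, so that the sum over d can be treated by Poisson
  summation.\<close>

definition Psi where "Psi x = of_real (x powr \<alpha>) * (h 0 + (\<Sum>m. qs m x))"

text \<open>The lattice sum formula multiplied by \<open>c0\<close> x powr (-5/2). The constant
  \<open>c0\<close> inverts Gamma s (2 pi) powr (- s), and x powr s becomes x powr \<alpha>.\<close>

lemma Psi_sums:
  assumes "x \<ge> 0"
  shows "(\<lambda>k. of_real (c0 * real (Suc k) powr (3 / 2 + \<alpha>)) * fB (Bk k) x) sums Psi x"
proof (cases "x = 0")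
  \<comment> \<open>At x = 0 both sides vanish by the convention 0 powr p = 0. The point 0 is
    included for the half end term of the trapezoidal sum with X = 0.\<close>
  case True
  then show ?thesis by (simp add: Psi_def fB_def)
next
  case False
  then have x: "x > 0" using assms by simp
  have s1: "s - 1 = 3 / 2 + \<alpha>" by simp
  have s2: "s > 2" using \<alpha> by simp
  have "(\<lambda>k. of_real (c0 * x powr (- 5 / 2)) * (of_real (real (Suc k) powr (s - 1)) * exp (2 * pi * \<i> * of_real (real (Suc k)) * w / of_real x)))
    sums (of_real (c0 * x powr (- 5 / 2)) * (of_real (Gamma s * (2 * pi) powr (- s) * x powr s) * (h 0 + (\<Sum>m. qs m x))))"
    unfolding qs_def using lattice_sum_kern(2)[OF s2 Imw x] by (rule sums_mult)
  moreover have "of_real (c0 * x powr (- 5 / 2)) * (of_real (Gamma s * (2 * pi) powr (- s) * x powr s) * (h 0 + (\<Sum>m. qs m x))) = Psi x"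
  proof -
    have "c0 * (Gamma s * (2 * pi) powr (- s)) = 1"
    proof -
      have "(2 * pi) powr s * (2 * pi) powr (- s) = 1"
        using powr_add[of "2 * pi" s "- s"] by simp
      moreover have "u / G * (G * v) = u * v" if "G > 0" for u v G :: real using that by simp
      ultimately show ?thesis unfolding c0_def using Gamma_s by metis
    qed
    moreover have "x powr (- 5 / 2) * x powr s = x powr \<alpha>"
      using x by (simp flip: powr_add)
    moreover have "(c * a) * (G * P * b) = (c * (G * P)) * (a * b)" for c a G P b :: real
      by (simp only: mult_ac)
    ultimately have e: "(c0 * x powr (- 5 / 2)) * (Gamma s * (2 * pi) powr (- s) * x powr s) = x powr \<alpha>"
      by (simp only: mult_1)
    show ?thesis unfolding Psi_def mult.assoc [symmetric] of_real_mult [symmetric]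
      by (simp only: e [unfolded mult.assoc [symmetric]])
  qed
  moreover have "of_real (c0 * x powr (- 5 / 2)) * (of_real (real (Suc k) powr (s - 1)) * exp (2 * pi * \<i> * of_real (real (Suc k)) * w / of_real x))
     = of_real (c0 * real (Suc k) powr (3 / 2 + \<alpha>)) * fB (Bk k) x" for k
  proof -
    have "2 * pi * \<i> * of_real (real (Suc k)) * w / of_real x = - Bk k / of_real x"
      by (simp add: Bk_def w_def mult_ac del: of_nat_Suc)
    then show ?thesis unfolding fB_def s1 of_real_mult by (simp only: mult_ac)
  qed
  ultimately show ?thesis by (simp only:)
qed

lemma fB_term_bound:
  assumes x: "0 < x" "x < X"
  shows "norm (of_real (c0 * real (Suc k) powr (3 / 2 + \<alpha>)) * fB (Bk k) x) \<le>
     c0 * X powr (7/2) * (6 / (2 * pi * Im w)) powr 6 * real (Suc k) powr (\<alpha> - 9/2)"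
proof -
  define K where "K = real (Suc k)"
  define b where "b = 2 * pi * Im w"
  have K: "K > 0" and b: "b > 0" using Imw by (simp_all add: K_def b_def)
  have Rb: "Re (Bk k) = K * b" unfolding ReBk K_def b_def ..
  have "norm (fB (Bk k) x) = x powr (- 5 / 2) * exp (- (K * b) / x)"
    unfolding fB_def norm_mult norm_of_real norm_exp_eq_Re by (simp add: Rb)
  \<comment> \<open>Six powers of x are borrowed to bound the exponential. The number 6 exceeds 5/2
    + \<alpha>, so that K powr (3/2 + \<alpha> - 6) is summable, and it leaves the positive power
    7/2 of x, which is monotone and bounded by its value at X.\<close>
  also have "x powr (- 5 / 2) = x powr (7/2) * x powr (-6)"
    using x by (simp flip: powr_add)
  also have "x powr (7/2) * x powr (-6) * exp (- (K * b) / x) = x powr (7/2) * (x powr (-6) * exp (- (K * b) / x))"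
    by simp
  also have "\<dots> \<le> X powr (7/2) * (- (-6) / (K * b)) powr (- (-6))"
    using x K b by (intro mult_mono powr_exp_inverse_le powr_mono2) auto
  also have "(- (-6) / (K * b)) powr (- (-6)) = (6 / b) powr 6 * K powr (-6)"
  proof -
    have "(- (-6) / (K * b)) = (6 / b) * (1 / K)" by (simp add: mult.commute)
    then have "(- (-6) / (K * b)) powr (- (-6)) = (6 / b) powr 6 * (1 / K) powr 6"
      by (simp only: powr_mult minus_minus)
    also have "(1 / K) powr 6 = K powr (-6)"
      using K powr_divide[of 1 K 6] powr_minus_divide[of K 6] by simp
    finally show ?thesis .
  qed
  finally have "norm (fB (Bk k) x) \<le> X powr (7/2) * ((6 / b) powr 6 * K powr (-6))" .
  then have "c0 * K powr (3 / 2 + \<alpha>) * norm (fB (Bk k) x) \<le> c0 * K powr (3 / 2 + \<alpha>) * (X powr (7/2) * ((6 / b) powr 6 * K powr (-6)))"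
    using c0_pos by (intro mult_left_mono) auto
  also have "\<dots> = c0 * X powr (7/2) * (6 / b) powr 6 * (K powr (3 / 2 + \<alpha>) * K powr (-6))"
    by (simp only: mult_ac)
  also have "K powr (3 / 2 + \<alpha>) * K powr (-6) = K powr (\<alpha> - 9/2)"
    using K by (simp flip: powr_add)
  finally show ?thesis
    using c0_pos unfolding norm_mult norm_of_real K_def b_def by (simp add: abs_mult)
qed

definition tauPsi where
  "tauPsi X = (\<Sum>d=1..X. Psi (real d)) - Psi (real X) / 2 - (LBINT x:{0<..<real X}. Psi x)"

text \<open>The identity \<open>trapezoid\<close> is applied to each exponential. Below X the terms
  decay like k powr (\<alpha> - 9/2) uniformly in x, so that sum and integral may be
  interchanged.\<close>

lemma tauPsi_sums:
  "(\<lambda>k. of_real (c0 * real (Suc k) powr (3 / 2 + \<alpha>)) * (LBINT x:{0<..<real X}. of_real (bern x) * fB2 (Bk k) x)) sums tauPsi X"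
proof -
  define a where "a = (\<lambda>k. complex_of_real (c0 * real (Suc k) powr (3 / 2 + \<alpha>)))"
  define M where "M = (\<lambda>k. c0 * (real X) powr (7/2) * (6 / (2 * pi * Im w)) powr 6 * real (Suc k) powr (\<alpha> - 9/2))"
  have sM: "summable M" unfolding M_def using \<alpha> by (intro summable_mult summable_Suc_powr) auto
  have bd: "norm (a k * fB (Bk k) x) \<le> M k" if "x \<in> {0<..<real X}" for k x
    unfolding a_def M_def using fB_term_bound that by simp
  have int: "set_integrable lborel {0<..<real X} (\<lambda>x. a k * fB (Bk k) x)" for k
  proof -
    interpret halfline_C2 "fB (Bk k)" "fB1 (Bk k)" "fB2 (Bk k)" by (rule halfline_C2_fB[OF ReBk_pos])
    show ?thesis by (intro set_integrable_mult_right set_integrable_subset[OF int]) auto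
  qed
  have "(\<lambda>k. LBINT x:{0<..<real X}. a k * fB (Bk k) x) sums (LBINT x:{0<..<real X}. (\<Sum>k. a k * fB (Bk k) x))"
  proof (rule set_lebesgue_integral_sums(2)[OF int])
    show "summable (\<lambda>k. norm (a k * fB (Bk k) x))" if "x \<in> {0<..<real X}" for x
      by (rule summable_comparison_test'[OF sM]) (use bd[OF that] in simp)
    show "(LBINT x:{0<..<real X}. norm (a k * fB (Bk k) x)) \<le> M k * real X" for k
    proof -
      have "(LBINT x:{0<..<real X}. norm (a k * fB (Bk k) x)) \<le> (LBINT x:{0<..<real X}. M k)"
      proof (rule set_integral_mono)
        show "set_integrable lborel {0<..<real X} (\<lambda>x. M k)"
          by (rule set_integrable_subset[OF borel_integrable_atLeastAtMost'[of 0 "real X"]]) auto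
      qed (rule set_integrable_norm[OF int] bd | assumption)+
      also have "\<dots> = M k * real X" by (simp add: set_integral_const)
      finally show ?thesis .
    qed
    show "summable (\<lambda>k. M k * real X)" by (intro summable_mult2 sM)
  qed
  also have "(LBINT x:{0<..<real X}. (\<Sum>k. a k * fB (Bk k) x)) = (LBINT x:{0<..<real X}. Psi x)"
    using Psi_sums by (intro set_lebesgue_integral_cong) (auto simp: a_def sums_iff)
  finally have 1: "(\<lambda>k. a k * (LBINT x:{0<..<real X}. fB (Bk k) x)) sums (LBINT x:{0<..<real X}. Psi x)"
    by simp
  have 2: "(\<lambda>k. a k * fB (Bk k) x) sums Psi x" if "x \<ge> 0" for x
    unfolding a_def by (rule Psi_sums[OF that])
  have 3: "(\<lambda>k. \<Sum>d=1..X. a k * fB (Bk k) (real d)) sums (\<Sum>d=1..X. Psi (real d))"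
    by (intro sums_sum 2) simp
  have "(\<lambda>k. (\<Sum>d=1..X. a k * fB (Bk k) (real d)) - a k * fB (Bk k) (real X) / 2 - a k * (LBINT x:{0<..<real X}. fB (Bk k) x)) sums tauPsi X"
    unfolding tauPsi_def by (intro sums_diff 3 1 sums_divide 2) simp
  moreover have "(\<Sum>d=1..X. a k * fB (Bk k) (real d)) - a k * fB (Bk k) (real X) / 2 - a k * (LBINT x:{0<..<real X}. fB (Bk k) x)
     = a k * (LBINT x:{0<..<real X}. of_real (bern x) * fB2 (Bk k) x)" for k
  proof -
    interpret halfline_C2 "fB (Bk k)" "fB1 (Bk k)" "fB2 (Bk k)" by (rule halfline_C2_fB[OF ReBk_pos])
    show ?thesis unfolding trapezoid [symmetric] sum_distrib_left [symmetric]
      by (simp add: right_diff_distrib)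
  qed
  ultimately show ?thesis unfolding a_def by simp
qed

text \<open>Tannery's theorem in X. By the homogeneity of \<open>fB2\<close>, the k-th trapezoidal
  error is at most a multiple of k powr (-7/2) for every X; with the weight k powr (3/2 + \<alpha>)
  the majorant is k powr (\<alpha> - 2), which is summable since \<alpha> < 1.\<close>

lemma tauPsi_tendsto: "tauPsi \<longlonglongrightarrow> Osc"
proof -
  define a where "a = (\<lambda>k. complex_of_real (c0 * real (Suc k) powr (3 / 2 + \<alpha>)))"
  define M where "M = (LBINT x:{0<..}. norm (fB2 (- 2 * pi * \<i> * T\<^sup>2) x))"
  have ReB: "Re (- 2 * pi * \<i> * T\<^sup>2) > 0"
    using ReBk_pos[of 0] by (simp add: Bk_def)
  have "((\<lambda>X. \<Sum>k. a k * (LBINT x:{0<..<real X}. of_real (bern x) * fB2 (Bk k) x)) \<longlongrightarrow>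
      (\<Sum>k. a k * (LBINT x:{0<..}. of_real (bern x) * fB2 (Bk k) x))) sequentially"
  proof (rule tannerys_theorem[THEN conjunct2, THEN conjunct2])
    show "(\<lambda>X. a k * (LBINT x:{0<..<real X}. of_real (bern x) * fB2 (Bk k) x)) \<longlonglongrightarrow>
        a k * (LBINT x:{0<..}. of_real (bern x) * fB2 (Bk k) x)" for k
    proof -
      interpret halfline_C2 "fB (Bk k)" "fB1 (Bk k)" "fB2 (Bk k)" by (rule halfline_C2_fB[OF ReBk_pos])
      show ?thesis by (intro tendsto_mult_left tendsto_set_integral_Ioo_sequentially int_bern)
    qed
    have "norm (a k * (LBINT x:{0<..<real X}. of_real (bern x) * fB2 (Bk k) x)) \<le> c0 * M * real (Suc k) powr (\<alpha> - 2)" for k X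
    proof -
      interpret halfline_C2 "fB (Bk k)" "fB1 (Bk k)" "fB2 (Bk k)" by (rule halfline_C2_fB[OF ReBk_pos])
      have "norm (LBINT x:{0<..<real X}. of_real (bern x) * fB2 (Bk k) x) \<le> (LBINT x:{0<..}. norm (fB2 (Bk k) x))"
        by (rule trapezoid_bound)
      also have "\<dots> = real (Suc k) powr (-7/2) * M"
        unfolding Bk_def M_def by (rule fB2_norm_integral[OF ReB]) simp
      finally have "c0 * real (Suc k) powr (3 / 2 + \<alpha>) * norm (LBINT x:{0<..<real X}. of_real (bern x) * fB2 (Bk k) x)
         \<le> c0 * real (Suc k) powr (3 / 2 + \<alpha>) * (real (Suc k) powr (-7/2) * M)"
        using c0_pos by (intro mult_left_mono) auto
      also have "\<dots> = c0 * M * (real (Suc k) powr (3 / 2 + \<alpha>) * real (Suc k) powr (-7/2))"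
        by (simp only: mult_ac)
      also have "real (Suc k) powr (3 / 2 + \<alpha>) * real (Suc k) powr (-7/2) = real (Suc k) powr (\<alpha> - 2)"
        by (simp flip: powr_add del: of_nat_Suc)
      finally show ?thesis
        using c0_pos unfolding a_def norm_mult norm_of_real by (simp add: abs_mult)
    qed
    then show "\<forall>\<^sub>F (k, X) in sequentially \<times>\<^sub>F sequentially.
       norm (a k * (LBINT x:{0<..<real X}. of_real (bern x) * fB2 (Bk k) x)) \<le> c0 * M * real (Suc k) powr (\<alpha> - 2)"
      by (intro always_eventually) auto
    show "summable (\<lambda>k. c0 * M * real (Suc k) powr (\<alpha> - 2))"
      using \<alpha> by (intro summable_mult summable_Suc_powr) auto
  qed simp
  moreover have "(\<Sum>k. a k * (LBINT x:{0<..<real X}. of_real (bern x) * fB2 (Bk k) x)) = tauPsi X" for X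
    using tauPsi_sums[of X] by (simp add: a_def sums_iff)
  ultimately show ?thesis unfolding Osc_def a_def by simp
qed

lemma int_J:
  shows "set_integrable lborel {0<..} (\<lambda>y. of_real (y powr \<alpha>) * h y)"
    and "set_integrable lborel {0<..} (\<lambda>y. of_real (y powr \<alpha>) * h (- y))"
proof -
  obtain C where C: "C > 0" "\<And>y. norm (h y) \<le> C * (1 + \<bar>y\<bar>) powr (- s)"
    using kern_decay[OF Imw, of s] \<alpha> by auto
  have *: "set_integrable lborel {0<..} (\<lambda>y. of_real (y powr \<alpha>) * g y)"
    if g: "continuous_on {0<..} g" "\<And>y. y > 0 \<Longrightarrow> norm (g y) \<le> C * (1 + y) powr (- s)" for g :: "real \<Rightarrow> complex"
  proof (rule set_integrable_continuous_boundI[where a = \<alpha> and b = "-5/2" and C = C])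
    show "continuous_on {0<..} (\<lambda>y. of_real (y powr \<alpha>) * g y)"
      by (intro continuous_intros g) auto
    show "norm (of_real (y powr \<alpha>) * g y) \<le> C * y powr \<alpha>" if "0 < y" for y
    proof -
      have "(1 + y) powr (- s) \<le> 1 powr (- s)" using that \<alpha> by (intro powr_mono2') auto
      then have "C * (1 + y) powr (- s) \<le> C * 1 powr (- s)" using C(1) by (intro mult_left_mono) auto
      also have "\<dots> = C" by (simp only: powr_one_eq_one mult_1_right)
      finally have "norm (g y) \<le> C" by (rule order_trans[OF g(2)[OF that]])
      then show ?thesis using mult_left_mono[of "norm (g y)" C "y powr \<alpha>"] by (simp add: norm_mult mult.commute)
    qed
    show "norm (of_real (y powr \<alpha>) * g y) \<le> C * y powr (-5/2)" if "1 \<le> y" for y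
    proof -
      have "(1 + y) powr (- s) \<le> y powr (- s)" using that \<alpha> by (intro powr_mono2') auto
      then have "C * (1 + y) powr (- s) \<le> C * y powr (- s)" using C(1) by (intro mult_left_mono) auto
      then have "norm (g y) \<le> C * y powr (- s)" using that by (intro order_trans[OF g(2)[of y]]) auto
      then have "y powr \<alpha> * norm (g y) \<le> y powr \<alpha> * (C * y powr (- s))" by (intro mult_left_mono) auto
      also have "\<dots> = C * (y powr \<alpha> * y powr (- s))" by (simp only: mult_ac)
      also have "y powr \<alpha> * y powr (- s) = y powr (-5/2)" using that by (simp flip: powr_add)
      finally show ?thesis by (simp add: norm_mult)
    qed
  qed (use \<alpha> in auto)
  show "set_integrable lborel {0<..} (\<lambda>y. of_real (y powr \<alpha>) * h y)"
    by (rule *[OF continuous_on_kern[OF Imw continuous_on_id]]) (metis C(2) abs_of_pos)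
  have "continuous_on {0<..} (\<lambda>y. h (- y))"
    by (intro continuous_on_kern[OF Imw] continuous_intros)
  then show "set_integrable lborel {0<..} (\<lambda>y. of_real (y powr \<alpha>) * h (- y))"
    by (rule *) (metis C(2) abs_of_pos abs_minus_cancel)
qed

lemma pair_summable_V:
  shows "pair_summable (\<lambda>d m. of_real (real (Suc d) powr \<alpha>) * h (real (Suc d * Suc m)))"
    and "pair_summable (\<lambda>d m. of_real (real (Suc d) powr \<alpha>) * h (- real (Suc d * Suc m)))"
proof -
  obtain C where C: "C > 0" "\<And>y. norm (h y) \<le> C * (1 + \<bar>y\<bar>) powr (- s)"
    using kern_decay[OF Imw, of s] \<alpha> by auto
  have *: "norm (of_real (real (Suc d) powr \<alpha>) * h y) \<le> (C * real (Suc d) powr (-5/2)) * real (Suc m) powr (- s)"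
    if y: "\<bar>y\<bar> = real (Suc d * Suc m)" for d m y
  proof -
    have "\<bar>y\<bar> > 0"
      unfolding y by (simp only: of_nat_0_less_iff nat_0_less_mult_iff zero_less_Suc simp_thms)
    then have "norm (h y) \<le> C * \<bar>y\<bar> powr (- s)"
      using \<alpha> C(1) by (intro order_trans[OF C(2)] mult_left_mono powr_mono2') auto
    also have "\<bar>y\<bar> powr (- s) = real (Suc d) powr (- s) * real (Suc m) powr (- s)"
      unfolding y of_nat_mult by (simp add: powr_mult del: of_nat_Suc)
    finally have "real (Suc d) powr \<alpha> * norm (h y) \<le> real (Suc d) powr \<alpha> * (C * (real (Suc d) powr (- s) * real (Suc m) powr (- s)))"
      by (intro mult_left_mono) auto
    also have "\<dots> = (C * (real (Suc d) powr \<alpha> * real (Suc d) powr (- s))) * real (Suc m) powr (- s)"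
      by (simp only: mult_ac)
    also have "real (Suc d) powr \<alpha> * real (Suc d) powr (- s) = real (Suc d) powr (-5/2)"
      by (simp flip: powr_add del: of_nat_Suc)
    finally show ?thesis by (simp add: norm_mult)
  qed
  have sa: "summable (\<lambda>d. C * real (Suc d) powr (-5/2))" "summable (\<lambda>m. real (Suc m) powr (- s))"
    using \<alpha> by (intro summable_mult summable_Suc_powr; simp)+
  show "pair_summable (\<lambda>d m. of_real (real (Suc d) powr \<alpha>) * h (real (Suc d * Suc m)))"
    by (rule pair_summable_productI(1)[OF _ sa], rule *) (rule abs_of_nat)
  show "pair_summable (\<lambda>d m. of_real (real (Suc d) powr \<alpha>) * h (- real (Suc d * Suc m)))"
    by (rule pair_summable_productI(1)[OF _ sa], rule *) (simp only: abs_minus_cancel abs_of_nat)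
qed

text \<open>The trapezoidal error of x powr \<alpha>; its limit is the value of the zeta function at
  - \<alpha>. It does not contain \<open>T\<close>, so outside the locale it is a function of
  \<alpha> alone and its limit is a constant.\<close>

definition tau_powr where
  "tau_powr X = (\<Sum>d=1..X. complex_of_real (real d powr \<alpha>)) - of_real (real X powr \<alpha>) / 2
      - (LBINT x:{0<..<real X}. complex_of_real (x powr \<alpha>))"

text \<open>Substituting y = (m + 1) x in the m-th pair takes out the factor (m + 1) powr (-1 -
  \<alpha>) and leaves the integrals of the kernel over both half-axes. The factors add up to
  \<open>Zc\<close>.\<close>

lemma integral_qs:
  "set_integrable lborel {0<..} (\<lambda>x. of_real (x powr \<alpha>) * (\<Sum>m. qs m x))"
  "(LBINT x:{0<..}. of_real (x powr \<alpha>) * (\<Sum>m. qs m x)) = of_real Zc * (Jm + Jp)"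
proof -
  have sq: "summable (\<lambda>m. qs m x)" if "x > 0" for x
    unfolding qs_def using lattice_sum_kern(1)[OF _ Imw that, of s] \<alpha> by simp
  define F where "F = (\<lambda>y. of_real (y powr \<alpha>) * (h (- y) + h y))"
  have iF: "set_integrable lborel {0<..} F"
    unfolding F_def distrib_left by (intro set_integral_add int_J)
  have vF: "(LBINT y:{0<..}. F y) = Jm + Jp"
    unfolding F_def distrib_left Jm_def Jp_def by (intro set_integral_add int_J)
  have eq: "of_real (x powr \<alpha>) * qs m x = of_real (real (Suc m) powr (- \<alpha>)) * F (real (Suc m) * x)" if "x > 0" for m x
  proof -
    have "real (Suc m) powr (- \<alpha>) * (real (Suc m) * x) powr \<alpha> = x powr \<alpha>"
      using that by (simp add: powr_mult powr_minus del: of_nat_Suc)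
    then have "complex_of_real (x powr \<alpha>) = of_real (real (Suc m) powr (- \<alpha>)) * of_real ((real (Suc m) * x) powr \<alpha>)"
      by (metis of_real_mult)
    then show ?thesis by (simp add: F_def qs_def mult_ac del: of_nat_Suc)
  qed
  have i1: "set_integrable lborel {0<..} (\<lambda>x. F (real (Suc m) * x))" for m
    by (subst set_integral_Ioi_scale(1)) (use iF in simp_all)
  have v1: "(LBINT x:{0<..}. F (real (Suc m) * x)) = of_real (1 / real (Suc m)) * (Jm + Jp)" for m
  proof -
    have "Jm + Jp = of_real (real (Suc m)) * (LBINT x:{0<..}. F (real (Suc m) * x))"
      using set_integral_Ioi_scale(2)[of "real (Suc m)" F] unfolding vF scaleR_conv_of_real by simp
    then show ?thesis by (simp del: of_nat_Suc)
  qed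
  have v2: "(LBINT x:{0<..}. norm (F (real (Suc m) * x))) = 1 / real (Suc m) * (LBINT x:{0<..}. norm (F x))" for m
    using set_integral_Ioi_scale(2)[of "real (Suc m)" "\<lambda>x. norm (F x)"] by (simp del: of_nat_Suc)
  have i2: "set_integrable lborel {0<..} (\<lambda>x. of_real (x powr \<alpha>) * qs m x)" for m
    by (subst set_integrable_cong[OF refl refl eq]) (use i1 in simp_all)
  have pw: "real (Suc m) powr (- \<alpha>) * (1 / real (Suc m)) = real (Suc m) powr (- 1 - \<alpha>)" for m
  proof -
    have "real (Suc m) powr (- 1 - \<alpha>) = real (Suc m) powr (- \<alpha> + - 1)"
      by (rule arg_cong) simp
    also have "\<dots> = real (Suc m) powr (- \<alpha>) * real (Suc m) powr (- 1)" by (rule powr_add)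
    also have "real (Suc m) powr (- 1) = 1 / real (Suc m)"
      by (simp add: powr_minus_divide del: of_nat_Suc)
    finally show ?thesis by (rule sym)
  qed
  have v3: "(LBINT x:{0<..}. of_real (x powr \<alpha>) * qs m x) = of_real (real (Suc m) powr (- 1 - \<alpha>)) * (Jm + Jp)" for m
  proof -
    have "(LBINT x:{0<..}. of_real (x powr \<alpha>) * qs m x) = (LBINT x:{0<..}. of_real (real (Suc m) powr (- \<alpha>)) * F (real (Suc m) * x))"
      by (rule set_lebesgue_integral_cong) (auto simp: eq simp del: of_nat_Suc)
    also have "\<dots> = of_real (real (Suc m) powr (- \<alpha>)) * (of_real (1 / real (Suc m)) * (Jm + Jp))"
      unfolding set_integral_mult_right v1 ..
    finally show ?thesis by (simp only: mult.assoc [symmetric] of_real_mult [symmetric] pw)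
  qed
  define f where "f = (\<lambda>m x. of_real (x powr \<alpha>) * qs m x)"
  have sZ: "summable (\<lambda>m. real (Suc m) powr (- 1 - \<alpha>))" using \<alpha> by (intro summable_Suc_powr) simp
  obtain C where C: "C > 0" "\<And>y. norm (h y) \<le> C * (1 + \<bar>y\<bar>) powr (- s)"
    using kern_decay[OF Imw, of s] \<alpha> by auto
  have h1: "norm (h y) \<le> C * \<bar>y\<bar> powr (- s)" if "y \<noteq> 0" for y
    using \<alpha> C(1) that by (intro order_trans[OF C(2)] mult_left_mono powr_mono2') auto
  have sn: "summable (\<lambda>m. norm (f m x))" if x: "x \<in> {0<..}" for x
  proof (rule summable_comparison_test')
    show "summable (\<lambda>m. x powr \<alpha> * (2 * C * x powr (- s)) * real (Suc m) powr (- s))"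
      using \<alpha> by (intro summable_mult summable_Suc_powr) simp
    show "norm (norm (f m x)) \<le> x powr \<alpha> * (2 * C * x powr (- s)) * real (Suc m) powr (- s)" for m
    proof -
      have y: "- x * real (Suc m) \<noteq> 0" "x * real (Suc m) \<noteq> 0" "\<bar>- x * real (Suc m)\<bar> = x * real (Suc m)" "\<bar>x * real (Suc m)\<bar> = x * real (Suc m)"
        using x by (auto simp: abs_mult simp del: of_nat_Suc)
      have "norm (qs m x) \<le> C * (x * real (Suc m)) powr (- s) + C * (x * real (Suc m)) powr (- s)"
        unfolding qs_def using h1[OF y(1)] h1[OF y(2)] unfolding y(3,4)
        by (intro order_trans[OF norm_triangle_ineq] add_mono)
      also have "\<dots> = (2 * C * x powr (- s)) * real (Suc m) powr (- s)"
        using x by (simp add: powr_mult del: of_nat_Suc)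
      finally have "x powr \<alpha> * norm (qs m x) \<le> x powr \<alpha> * ((2 * C * x powr (- s)) * real (Suc m) powr (- s))"
        by (intro mult_left_mono) auto
      then show ?thesis by (simp add: f_def norm_mult mult.assoc del: of_nat_Suc)
    qed
  qed
  have ni: "(LBINT x:{0<..}. norm (f m x)) \<le> real (Suc m) powr (- 1 - \<alpha>) * (LBINT x:{0<..}. norm (F x))" for m
  proof -
    have "(LBINT x:{0<..}. norm (f m x)) = (LBINT x:{0<..}. real (Suc m) powr (- \<alpha>) * norm (F (real (Suc m) * x)))"
      unfolding f_def by (rule set_lebesgue_integral_cong) (auto simp: eq norm_mult simp del: of_nat_Suc)
    also have "\<dots> = real (Suc m) powr (- \<alpha>) * (1 / real (Suc m) * (LBINT x:{0<..}. norm (F x)))"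
      unfolding set_integral_mult_right v2 ..
    also have "\<dots> = (real (Suc m) powr (- \<alpha>) * (1 / real (Suc m))) * (LBINT x:{0<..}. norm (F x))"
      by (simp only: mult.assoc)
    finally show ?thesis by (simp only: pw order_refl)
  qed
  have i2f: "set_integrable lborel {0<..} (f m)" for m
    using i2[of m] by (simp only: f_def)
  note L = set_lebesgue_integral_sums[OF i2f sn ni summable_mult2[OF sZ]]
  have e2: "(\<Sum>m. f m x) = of_real (x powr \<alpha>) * (\<Sum>m. qs m x)" if "x > 0" for x
    unfolding f_def by (rule suminf_mult[OF sq[OF that]])
  have "set_integrable lborel {0<..} (\<lambda>x. \<Sum>m. f m x) \<longleftrightarrow>
      set_integrable lborel {0<..} (\<lambda>x. of_real (x powr \<alpha>) * (\<Sum>m. qs m x))"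
    by (rule set_integrable_cong) (auto simp: e2)
  then show "set_integrable lborel {0<..} (\<lambda>x. of_real (x powr \<alpha>) * (\<Sum>m. qs m x))"
    using L(1) by (simp only:)
  have "(\<lambda>m. of_real (real (Suc m) powr (- 1 - \<alpha>)) * (Jm + Jp)) sums (LBINT x:{0<..}. (\<Sum>m. f m x))"
    using L(2) unfolding f_def v3 .
  moreover have "(\<lambda>m. of_real (real (Suc m) powr (- 1 - \<alpha>)) * (Jm + Jp)) sums (of_real Zc * (Jm + Jp))"
    unfolding Zc_def by (intro sums_mult2 sums_of_real summable_sums sZ)
  moreover have "(LBINT x:{0<..}. (\<Sum>m. f m x)) = (LBINT x:{0<..}. of_real (x powr \<alpha>) * (\<Sum>m. qs m x))"
    by (rule set_lebesgue_integral_cong) (auto simp: e2)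
  ultimately show "(LBINT x:{0<..}. of_real (x powr \<alpha>) * (\<Sum>m. qs m x)) = of_real Zc * (Jm + Jp)"
    using sums_unique2 by metis
qed

text \<open>The Voronoi formula. \<open>Psi\<close> is h(0) x powr \<alpha> plus a part G that comes
  from the nonzero lattice points. The trapezoidal errors of \<open>Psi\<close> tend to
  \<open>Osc\<close>, the sums of G over d to \<open>Vm\<close> + \<open>Vp\<close>, and its
  integrals to \<open>Zc\<close> (\<open>Jm\<close> + \<open>Jp\<close>). The sum and the integral
  of the remaining part diverge separately, but by difference its trapezoidal errors
  converge.\<close>

lemma tau_powr_tendsto: "(\<lambda>X. h 0 * tau_powr X) \<longlonglongrightarrow> Osc - (Vm + Vp - of_real Zc * (Jm + Jp))"
proof -
  define G where "G = (\<lambda>x. of_real (x powr \<alpha>) * (\<Sum>m. qs m x))"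
  have iP: "set_integrable lborel {0<..<real X} (\<lambda>x. complex_of_real (x powr \<alpha>))" for X
  proof (rule set_integrable_subset[OF borel_integrable_atLeastAtMost'[of 0 "real X"]])
    show "continuous_on {0..real X} (\<lambda>x. complex_of_real (x powr \<alpha>))"
      by (intro continuous_on_of_real continuous_on_powr' continuous_on_id continuous_on_const) (use \<alpha> in auto)
  qed auto
  have Psi: "Psi x = h 0 * of_real (x powr \<alpha>) + G x" for x
    by (simp add: Psi_def G_def algebra_simps)
  have iG: "set_integrable lborel {0<..<real X} G" for X
    unfolding G_def by (rule set_integrable_subset[OF integral_qs(1)]) auto
  have I: "(LBINT x:{0<..<real X}. Psi x) = h 0 * (LBINT x:{0<..<real X}. complex_of_real (x powr \<alpha>)) + (LBINT x:{0<..<real X}. G x)" for X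
    unfolding Psi set_integral_mult_right [symmetric] by (intro set_integral_add iG set_integrable_mult_right iP)
  have tau: "h 0 * tau_powr X = tauPsi X - ((\<Sum>d<X. G (real (Suc d))) - G (real X) / 2 - (LBINT x:{0<..<real X}. G x))" for X
    unfolding tauPsi_def tau_powr_def I Psi
    by (simp add: sum.distrib sum_distrib_left sum_distrib_right algebra_simps add_divide_distrib sum.atLeast1_atMost_eq)
  note P = pair_summable_V
  note Q = pair_summable_inner[OF P(1)] pair_summable_inner[OF P(2)]
  have Gs: "G (real (Suc d)) = (\<Sum>m. of_real (real (Suc d) powr \<alpha>) * h (- real (Suc d * Suc m))) +
       (\<Sum>m. of_real (real (Suc d) powr \<alpha>) * h (real (Suc d * Suc m)))" for d
  proof -
    have x: "real (Suc d) > 0" by simp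
    have "G (real (Suc d)) = (\<Sum>m. of_real (real (Suc d) powr \<alpha>) * qs m (real (Suc d)))"
      unfolding G_def qs_def
      using lattice_sum_kern(1)[OF _ Imw x, of s] \<alpha> by (intro suminf_mult [symmetric]) simp
    also have "\<dots> = (\<Sum>m. of_real (real (Suc d) powr \<alpha>) * h (- real (Suc d * Suc m)) + of_real (real (Suc d) powr \<alpha>) * h (real (Suc d * Suc m)))"
      by (simp add: qs_def distrib_left del: of_nat_Suc mult_Suc mult_Suc_right)
    also have "\<dots> = (\<Sum>m. of_real (real (Suc d) powr \<alpha>) * h (- real (Suc d * Suc m))) +
       (\<Sum>m. of_real (real (Suc d) powr \<alpha>) * h (real (Suc d * Suc m)))"
      by (rule suminf_add [symmetric, OF Q(3) Q(1)])
    finally show ?thesis .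
  qed
  have Gsum: "(\<lambda>d. G (real (Suc d))) sums (Vm + Vp)"
    unfolding Gs Vm_def Vp_def pair_sum_def by (intro sums_add summable_sums Q(4) Q(2))
  have t1: "(\<lambda>X. \<Sum>d<X. G (real (Suc d))) \<longlonglongrightarrow> Vm + Vp"
    using Gsum by (simp add: sums_def)
  have "(\<lambda>d. G (real (Suc d))) \<longlonglongrightarrow> 0"
    using Gsum by (intro summable_LIMSEQ_zero) (auto simp: sums_iff)
  then have "(\<lambda>d. G (real d)) \<longlonglongrightarrow> 0" by (rule LIMSEQ_imp_Suc)
  then have t2: "(\<lambda>X. G (real X) / 2) \<longlonglongrightarrow> 0 / 2" by (intro tendsto_intros) auto
  have t3: "(\<lambda>X. LBINT x:{0<..<real X}. G x) \<longlonglongrightarrow> of_real Zc * (Jm + Jp)"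
    using tendsto_set_integral_Ioo_sequentially[OF integral_qs(1)] unfolding G_def integral_qs(2) .
  show ?thesis
    unfolding tau using tendsto_diff[OF tauPsi_tendsto tendsto_diff[OF tendsto_diff[OF t1 t2] t3]] by simp
qed

lemma h0_nonzero: "h 0 \<noteq> 0"
proof -
  have "norm (h 0) > 0" unfolding norm_kern[OF Imw] using Imw by auto
  then show ?thesis by auto
qed

end

section \<open>Sizes of the terms that do not oscillate\<close>

context voronoi
begin

lemma s_pos: "s > 0" "s > 1" "s - 1 > 0" "s \<ge> 0" using \<alpha> by auto

text \<open>Inserting the Gamma integral for \<open>h\<close> into \<open>Jp\<close> gives a double
  integral that is not absolutely convergent. The factor exp (- y / e) makes Fubini's theorem
  applicable, and the inner integral over y is again a Gamma integral.\<close>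

lemma Jp_regularized:
  assumes e: "e > 0"
  shows "of_real (Gamma s) * (LBINT y:{0<..}. of_real (exp (- y / e)) * (of_real (y powr \<alpha>) * h y)) =
    (LBINT v:{0<..}. of_real (v powr (s - 1)) * exp (of_real v * (\<i> * w)) *
        (of_real (Gamma (1 + \<alpha>)) * (of_real (1 / e) + \<i> * of_real v) powr (- of_real (1 + \<alpha>))))"
proof -
  define p where "p = (\<lambda>y. indicator {0<..} y * (y powr \<alpha> * exp (- (1 / e) * y)))"
  define q where "q = (\<lambda>v. indicator {0<..} v * (v powr (s - 1) * exp (- Im w * v)))"
  define G where "G = (\<lambda>y v. complex_of_real (p y) * (of_real (indicator {0<..} v * v powr (s - 1)) * exp (- of_real v * (\<i> * (of_real y - w)))))"
  have p: "integrable lborel p"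
    using Gamma_integral_scaled(1)[of "1 + \<alpha>" "1 / e"] \<alpha> e by (simp add: p_def set_integrable_def)
  have q: "integrable lborel q"
    using Gamma_integral_scaled(1)[OF s_pos(1) Imw] by (simp add: q_def set_integrable_def)
  have p0: "p y \<ge> 0" and q0: "q v \<ge> 0" for y v by (auto simp: p_def q_def indicator_def)
  have nG: "norm (G y v) = p y * q v" for y v
  proof -
    have "norm (G y v) = p y * (indicator {0<..} v * v powr (s - 1) * exp (Re (- of_real v * (\<i> * (of_real y - w)))))"
      unfolding G_def norm_mult norm_of_real norm_exp_eq_Re using p0[of y] by (simp add: abs_mult indicator_def)
    also have "Re (- of_real v * (\<i> * (of_real y - w))) = - Im w * v" by simp
    finally show ?thesis by (simp add: q_def)
  qed
  have mG: "(\<lambda>(y, v). G y v) \<in> borel_measurable (lborel \<Otimes>\<^sub>M lborel)"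
    unfolding G_def p_def by measurable
  have iG: "integrable lborel (G y)" for y
  proof (rule Bochner_Integration.integrable_bound[OF integrable_mult_right[OF q, of "p y"]])
    show "G y \<in> borel_measurable lborel" unfolding G_def by measurable
    show "AE v in lborel. norm (G y v) \<le> norm (p y * q v)"
      using p0 q0 by (intro AE_I2) (simp add: nG abs_mult)
  qed
  have int: "integrable (lborel \<Otimes>\<^sub>M lborel) (\<lambda>(y, v). G y v)"
  proof (rule lborel_pair.Fubini_integrable[OF mG])
    show "integrable lborel (\<lambda>y. \<integral>v. norm (case (y, v) of (y, v) \<Rightarrow> G y v) \<partial>lborel)"
      using integrable_mult_left[OF p, of "integral\<^sup>L lborel q"] by (simp add: nG)
    show "AE y in lborel. integrable lborel (\<lambda>v. case (y, v) of (y, v) \<Rightarrow> G y v)"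
      using iG by simp
  qed
  have fub: "(\<integral>v. (\<integral>y. G y v \<partial>lborel) \<partial>lborel) = (\<integral>y. (\<integral>v. G y v \<partial>lborel) \<partial>lborel)"
    by (rule lborel_pair.Fubini_integral[OF int])
  have 1: "(\<integral>v. G y v \<partial>lborel) = indicator {0<..} y *\<^sub>R (of_real (Gamma s) * (of_real (exp (- y / e)) * (of_real (y powr \<alpha>) * h y)))" for y
  proof -
    have "(\<integral>v. G y v \<partial>lborel) = of_real (p y) * (\<integral>v. (of_real (indicator {0<..} v * v powr (s - 1)) * exp (- of_real v * (\<i> * (of_real y - w)))) \<partial>lborel)"
      unfolding G_def by simp
    also have "(\<integral>v. (of_real (indicator {0<..} v * v powr (s - 1)) * exp (- of_real v * (\<i> * (of_real y - w)))) \<partial>lborel) =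
       (LBINT v:{0<..}. of_real (v powr (s - 1)) * exp (- of_real v * (\<i> * (of_real y - w))))"
      unfolding set_lebesgue_integral_def by (intro Bochner_Integration.integral_cong) (auto simp: indicator_def)
    also have "\<dots> = of_real (Gamma s) * h y"
      unfolding kern_def using Imw by (intro Gamma_integral_complex_scaled(2) s_pos) simp
    finally show ?thesis by (simp add: p_def indicator_def mult_ac)
  qed
  have 2: "(\<integral>y. G y v \<partial>lborel) = indicator {0<..} v *\<^sub>R (of_real (v powr (s - 1)) * exp (of_real v * (\<i> * w)) *
        (of_real (Gamma (1 + \<alpha>)) * (of_real (1 / e) + \<i> * of_real v) powr (- of_real (1 + \<alpha>))))" for v
  proof -
    have Gv: "G y v = (of_real (indicator {0<..} v * v powr (s - 1)) * exp (of_real v * (\<i> * w))) *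
        (indicator {0<..} y *\<^sub>R (of_real (y powr (1 + \<alpha> - 1)) * exp (- of_real y * (of_real (1 / e) + \<i> * of_real v))))" for y
    proof -
      have "exp (- of_real v * (\<i> * (of_real y - w))) = exp (of_real v * (\<i> * w)) * exp (- of_real v * (\<i> * of_real y))"
        unfolding exp_add [symmetric] by (simp add: algebra_simps)
      moreover have "complex_of_real (exp (- (1 / e) * y)) * exp (- of_real v * (\<i> * of_real y)) = exp (- of_real y * (of_real (1 / e) + \<i> * of_real v))"
        unfolding exp_of_real [symmetric] exp_add [symmetric] by (simp add: algebra_simps)
      ultimately show ?thesis
        by (cases "y > 0") (simp_all add: G_def p_def mult_ac)
    qed
    have "(\<integral>y. G y v \<partial>lborel) = (of_real (indicator {0<..} v * v powr (s - 1)) * exp (of_real v * (\<i> * w))) *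
       (LBINT y:{0<..}. of_real (y powr (1 + \<alpha> - 1)) * exp (- of_real y * (of_real (1 / e) + \<i> * of_real v)))"
      unfolding Gv set_lebesgue_integral_def by (rule Bochner_Integration.integral_mult_right_zero)
    also have "(LBINT y:{0<..}. of_real (y powr (1 + \<alpha> - 1)) * exp (- of_real y * (of_real (1 / e) + \<i> * of_real v)))
       = of_real (Gamma (1 + \<alpha>)) * (of_real (1 / e) + \<i> * of_real v) powr (- of_real (1 + \<alpha>))"
      using \<alpha> e by (intro Gamma_integral_complex_scaled(2)) auto
    finally show ?thesis by (simp add: indicator_def)
  qed
  show ?thesis
    using fub unfolding 1 2 set_lebesgue_integral_def mult_scaleR_right [symmetric]
      Bochner_Integration.integral_mult_right_zero by (rule sym)
qed

text \<open>As e tends to infinity, (1 / e + i v) powr (-1 - \<alpha>) tends to a constant times v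
  powr (-1 - \<alpha>), and v powr (s - 1) becomes v powr (1/2). What remains is a Gamma integral
  with exponent 3/2 at - i w. This exact size is essential: integrating norms would leave a power of
  Im w instead of norm w, which is too large.\<close>

lemma norm_Jp: "norm Jp = Gamma (1 + \<alpha>) * Gamma (3 / 2) / Gamma s * norm w powr (- 3 / 2)"
proof -
  have w0: "w \<noteq> 0" using Imw by auto
  have Riw: "Re (- \<i> * w) > 0" using Imw by simp
  have iw0: "- \<i> * w \<noteq> 0" using w0 by simp
  define R where "R = (\<lambda>e v. of_real (v powr (s - 1)) * exp (of_real v * (\<i> * w)) *
        (of_real (Gamma (1 + \<alpha>)) * (of_real (1 / e) + \<i> * of_real v) powr (- of_real (1 + \<alpha>))))"
  define R0 where "R0 = (\<lambda>v. of_real (Gamma (1 + \<alpha>)) * \<i> powr (- of_real (1 + \<alpha>)) * (of_real (v powr (3 / 2 - 1)) * exp (- of_real v * (- \<i> * w))))"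
  have G1: "Gamma (1 + \<alpha>) > 0" using \<alpha> by (intro Gamma_real_pos) auto
  have inv: "((\<lambda>e::real. 1 / e) \<longlongrightarrow> 0) at_top" by real_asymp
  have t1: "((\<lambda>e. LBINT v:{0<..}. R e v) \<longlongrightarrow> (LBINT v:{0<..}. R0 v)) at_top"
  proof (rule set_integral_dominated_at_top)
    show "set_integrable lborel {0<..} (\<lambda>v. Gamma (1 + \<alpha>) * (v powr (3 / 2 - 1) * exp (- Im w * v)))"
      by (intro set_integrable_mult_right Gamma_integral_scaled(1) Imw) simp
    show "set_borel_measurable lborel {0<..} (R e)" for e
      unfolding set_borel_measurable_def R_def by measurable
    show "set_borel_measurable lborel {0<..} R0"
      unfolding set_borel_measurable_def R0_def by measurable
    fix v :: real assume "v \<in> {0<..}"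
    then have v: "v > 0" by simp
    have "((\<lambda>e. R e v) \<longlongrightarrow> of_real (v powr (s - 1)) * exp (of_real v * (\<i> * w)) *
        (of_real (Gamma (1 + \<alpha>)) * (of_real 0 + \<i> * of_real v) powr (- of_real (1 + \<alpha>)))) at_top"
      unfolding R_def using v
      by (intro tendsto_intros tendsto_powr_complex inv) (auto simp: complex_nonpos_Reals_iff)
    moreover have "of_real (v powr (s - 1)) * exp (of_real v * (\<i> * w)) *
        (of_real (Gamma (1 + \<alpha>)) * (of_real 0 + \<i> * of_real v) powr (- of_real (1 + \<alpha>))) = R0 v"
    proof -
      have "(of_real 0 + \<i> * of_real v) powr (- of_real (1 + \<alpha>)) = of_real (v powr (- (1 + \<alpha>))) * \<i> powr (- of_real (1 + \<alpha>))"
        using cpowr_of_real_mult[OF v, of \<i> "- (1 + \<alpha>)"] by (simp add: mult.commute)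
      moreover have "v powr (s - 1) * v powr (- (1 + \<alpha>)) = v powr (3 / 2 - 1)"
        by (simp flip: powr_add)
      then have "complex_of_real (v powr (s - 1)) * of_real (v powr (- (1 + \<alpha>))) = of_real (v powr (3 / 2 - 1))"
        by (metis of_real_mult)
      moreover have "of_real v * (\<i> * w) = - of_real v * (- \<i> * w)" by simp
      moreover have "a * E * (g * (b * j)) = g * j * ((a * b) * E)" for a E g b j :: complex
        by (simp only: mult_ac)
      ultimately show ?thesis unfolding R0_def by simp
    qed
    ultimately show "((\<lambda>e. R e v) \<longlongrightarrow> R0 v) at_top" by simp
  next
    fix e v :: real assume v: "v \<in> {0<..}" and e: "e > 0"
    have "norm (R e v) = v powr (s - 1) * exp (- Im w * v) * (Gamma (1 + \<alpha>) * norm (of_real (1 / e) + \<i> * of_real v) powr (- (1 + \<alpha>)))"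
    proof -
      have nz: "of_real (1 / e) + \<i> * of_real v \<noteq> 0" using v by (auto simp: complex_eq_iff)
      have "Re (of_real v * (\<i> * w)) = - Im w * v" by simp
      then show ?thesis
        unfolding R_def norm_mult norm_of_real norm_exp_eq_Re
        using norm_cpowr_real[OF nz, of "- (1 + \<alpha>)"] G1 by (simp only: of_real_minus) simp
    qed
    also have "\<dots> \<le> v powr (s - 1) * exp (- Im w * v) * (Gamma (1 + \<alpha>) * v powr (- (1 + \<alpha>)))"
    proof -
      have "v \<le> norm (of_real (1 / e) + \<i> * of_real v)"
        using abs_Im_le_cmod[of "of_real (1 / e) + \<i> * of_real v"] v by simp
      then have "norm (of_real (1 / e) + \<i> * of_real v) powr (- (1 + \<alpha>)) \<le> v powr (- (1 + \<alpha>))"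
        using v \<alpha> by (intro powr_mono2') auto
      then show ?thesis using G1 by (intro mult_left_mono) auto
    qed
    also have "\<dots> = Gamma (1 + \<alpha>) * ((v powr (s - 1) * v powr (- (1 + \<alpha>))) * exp (- Im w * v))"
      by (simp only: mult_ac)
    also have "v powr (s - 1) * v powr (- (1 + \<alpha>)) = v powr (3 / 2 - 1)"
      using v by (simp flip: powr_add)
    finally show "norm (R e v) \<le> Gamma (1 + \<alpha>) * (v powr (3 / 2 - 1) * exp (- Im w * v))" .
  qed
  define Je where "Je = (\<lambda>e y. of_real (exp (- y / e)) * (of_real (y powr \<alpha>) * h y))"
  have t2: "((\<lambda>e. LBINT y:{0<..}. Je e y) \<longlongrightarrow> Jp) at_top"
    unfolding Jp_def
  proof (rule set_integral_dominated_at_top)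
    show "set_integrable lborel {0<..} (\<lambda>y. norm (of_real (y powr \<alpha>) * h y))"
      by (intro set_integrable_norm int_J)
    have c: "continuous_on {0<..} (\<lambda>y. of_real (y powr \<alpha>) * h y)"
      by (intro continuous_intros continuous_on_kern[OF Imw]) auto
    show "set_borel_measurable lborel {0<..} (\<lambda>y. of_real (y powr \<alpha>) * h y)"
      by (rule set_borel_measurable_continuous[OF c])
    have "continuous_on {0<..} (Je e)" for e
    proof (cases "e = 0")
      case True
      then show ?thesis unfolding Je_def using c by simp
    next
      case False
      then show ?thesis unfolding Je_def by (intro continuous_on_mult c continuous_on_of_real continuous_on_exp continuous_intros) auto
    qed
    then show "set_borel_measurable lborel {0<..} (Je e)" for e
      by (intro set_borel_measurable_continuous)
    show "((\<lambda>e. Je e y) \<longlongrightarrow> of_real (y powr \<alpha>) * h y) at_top" for y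
    proof -
      have "((\<lambda>e. exp (- y / e)) \<longlongrightarrow> 1) at_top" by real_asymp
      from tendsto_mult_right[OF tendsto_of_real[OF this, where 'a = complex], of "of_real (y powr \<alpha>) * h y"]
      show ?thesis unfolding Je_def by simp
    qed
    show "norm (Je e y) \<le> norm (of_real (y powr \<alpha>) * h y)" if "y \<in> {0<..}" "e > 0" for e y
    proof -
      have "exp (- y / e) \<le> 1" using that by simp
      then show ?thesis unfolding Je_def norm_mult[of "of_real (exp (- y / e))"]
        by (intro mult_left_le_one_le) auto
    qed
  qed
  have "((\<lambda>e. LBINT v:{0<..}. R e v) \<longlongrightarrow> of_real (Gamma s) * Jp) at_top"
  proof (rule Lim_transform_eventually[OF tendsto_mult_left[OF t2, of "of_real (Gamma s)"]])
    show "\<forall>\<^sub>F e in at_top. of_real (Gamma s) * (LBINT y:{0<..}. Je e y) = (LBINT v:{0<..}. R e v)"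
      using eventually_gt_at_top[of 0]
    proof eventually_elim
      case (elim e)
      show ?case unfolding Je_def R_def by (rule Jp_regularized[OF elim])
    qed
  qed
  from tendsto_unique[OF _ this t1] have "of_real (Gamma s) * Jp = (LBINT v:{0<..}. R0 v)" by simp
  also have "\<dots> = of_real (Gamma (1 + \<alpha>)) * \<i> powr (- of_real (1 + \<alpha>)) * (of_real (Gamma (3 / 2)) * (- \<i> * w) powr (- of_real (3 / 2)))"
    unfolding R0_def set_integral_mult_right using Gamma_integral_complex_scaled(2)[OF _ Riw, of "3 / 2"] by simp
  finally have "norm (of_real (Gamma s) * Jp) = norm (of_real (Gamma (1 + \<alpha>)) * \<i> powr (- of_real (1 + \<alpha>)) * (of_real (Gamma (3 / 2)) * (- \<i> * w) powr (- of_real (3 / 2))))"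
    by (rule arg_cong)
  also have "norm (\<i> powr (- of_real (1 + \<alpha>))) = 1"
    using norm_cpowr_real[of \<i> "- (1 + \<alpha>)"] by (simp only: of_real_minus) simp
  then have "norm (of_real (Gamma (1 + \<alpha>)) * \<i> powr (- of_real (1 + \<alpha>)) * (of_real (Gamma (3 / 2)) * (- \<i> * w) powr (- of_real (3 / 2))))
    = Gamma (1 + \<alpha>) * (\<bar>Gamma (3 / 2)\<bar> * norm ((- \<i> * w) powr (- of_real (3 / 2))))"
    unfolding norm_mult norm_of_real using G1 by simp
  also have "norm ((- \<i> * w) powr (- of_real (3 / 2))) = norm w powr (- 3 / 2)"
    using norm_cpowr_real[OF iw0, of "- 3 / 2"] by (simp add: norm_mult)
  also have "\<bar>Gamma (3 / 2 :: real)\<bar> = Gamma (3 / 2)" using Gamma_real_pos[of "3 / 2 :: real"] by simp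
  finally show ?thesis using Gamma_s by (simp add: norm_mult field_simps)
qed

text \<open>On the negative half-axis the exponent s is split into 5/4 + \<alpha> for y and 5/4 for
  norm w. After the weight d powr \<alpha> the series in d and m have the exponents -5/4 and -5/4 -
  \<alpha> and still converge, while norm w powr (-5/4) = norm T powr (-5/2) improves on the order
  norm T powr (-2) of the main term.\<close>

lemma minor_bounds:
  assumes w1: "Re w \<ge> 0" "norm w \<ge> 1"
  shows "norm Vm \<le> (\<Sum>d. real (Suc d) powr (-5/4)) * (\<Sum>m. real (Suc m) powr (-5/4 - \<alpha>)) * norm w powr (-5/4)"
    and "norm Jm \<le> (LBINT y:{0<..}. (if y < 1 then y powr \<alpha> else y powr (-5/4))) * norm w powr (-5/4)"
    and "norm (h 0) \<le> norm w powr (-5/4)"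
    and "norm Jp \<le> Gamma (1 + \<alpha>) * Gamma (3 / 2) / Gamma s * norm w powr (-5/4)"
proof -
  have e1: "- (s - (5/4 + \<alpha>)) = -5/4" by simp
  have kn: "norm (h (- y)) \<le> norm w powr (-5/4) * y powr (- (5/4 + \<alpha>))" if "y > 0" for y
    using kern_neg_bound[OF Imw w1(1) that, of "5/4 + \<alpha>" s] \<alpha> unfolding e1 by simp
  have wm: "norm w powr p \<le> norm w powr (-5/4)" if "p \<le> -5/4" for p
    using that w1(2) by (intro powr_mono) auto
  have kn0: "norm (h (- y)) \<le> norm w powr (-5/4)" if "y > 0" for y
  proof -
    have "norm (h (- y)) \<le> norm w powr (- (s - 0)) * y powr (- 0)"
      using kern_neg_bound[OF Imw w1(1) that, of 0 s] \<alpha> by simp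
    also have "\<dots> = norm w powr (- s)" using that by simp
    also have "\<dots> \<le> norm w powr (-5/4)" using \<alpha> by (intro wm) simp
    finally show ?thesis .
  qed
  show "norm Vm \<le> (\<Sum>d. real (Suc d) powr (-5/4)) * (\<Sum>m. real (Suc m) powr (-5/4 - \<alpha>)) * norm w powr (-5/4)"
  proof -
    have sd: "summable (\<lambda>d. real (Suc d) powr (-5/4))" "summable (\<lambda>m. real (Suc m) powr (-5/4 - \<alpha>))"
      using \<alpha> by (intro summable_Suc_powr; simp)+
    have "norm Vm \<le> (\<Sum>d. real (Suc d) powr (-5/4)) * (\<Sum>m. real (Suc m) powr (-5/4 - \<alpha>) * norm w powr (-5/4))"
      unfolding Vm_def
    proof (rule pair_summable_productI(2)[OF _ sd(1) summable_mult2[OF sd(2)]])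
      fix d m :: nat
      define D M where "D = real (Suc d)" and "M = real (Suc m)"
      have DM: "D > 0" "M > 0" by (simp_all add: D_def M_def)
      have "norm (h (- (D * M))) \<le> norm w powr (-5/4) * (D * M) powr (- (5/4 + \<alpha>))"
        using DM by (intro kn) simp
      then have "D powr \<alpha> * norm (h (- (D * M))) \<le> D powr \<alpha> * (norm w powr (-5/4) * (D * M) powr (- (5/4 + \<alpha>)))"
        by (intro mult_left_mono) auto
      also have "\<dots> = (D powr \<alpha> * D powr (- (5/4 + \<alpha>))) * (M powr (- (5/4 + \<alpha>)) * norm w powr (-5/4))"
        unfolding powr_mult by (simp only: mult_ac)
      also have "D powr \<alpha> * D powr (- (5/4 + \<alpha>)) = D powr (-5/4)" using DM by (simp flip: powr_add)
      also have "- (5/4 + \<alpha>) = -5/4 - \<alpha>" by simp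
      finally show "norm (of_real (real (Suc d) powr \<alpha>) * h (- real (Suc d * Suc m))) \<le>
          real (Suc d) powr (-5/4) * (real (Suc m) powr (-5/4 - \<alpha>) * norm w powr (-5/4))"
        unfolding D_def M_def norm_mult of_nat_mult norm_of_real by simp
    qed
    also have "(\<Sum>m. real (Suc m) powr (-5/4 - \<alpha>) * norm w powr (-5/4)) = (\<Sum>m. real (Suc m) powr (-5/4 - \<alpha>)) * norm w powr (-5/4)"
      by (rule suminf_mult2[OF sd(2), symmetric])
    finally show ?thesis by (simp only: mult.assoc)
  qed
  show "norm Jm \<le> (LBINT y:{0<..}. (if y < 1 then y powr \<alpha> else y powr (-5/4))) * norm w powr (-5/4)"
  proof -
    have "norm Jm \<le> (LBINT y:{0<..}. (if y < 1 then y powr \<alpha> else y powr (-5/4)) * norm w powr (-5/4))"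
      unfolding Jm_def
    proof (rule set_integral_norm_bound')
      show "set_integrable lborel {0<..} (\<lambda>y. (if y < 1 then y powr \<alpha> else y powr (-5/4)) * norm w powr (-5/4))"
        using \<alpha> by (intro set_integrable_mult_left set_integrable_powr_split) auto
      fix y :: real assume "y \<in> {0<..}"
      then have y: "y > 0" by simp
      show "norm (of_real (y powr \<alpha>) * h (- y)) \<le> (if y < 1 then y powr \<alpha> else y powr (-5/4)) * norm w powr (-5/4)"
      proof (cases "y < 1")
        case True
        then show ?thesis using kn0[OF y] by (simp add: norm_mult mult_left_mono)
      next
        case False
        have "y powr \<alpha> * norm (h (- y)) \<le> y powr \<alpha> * (norm w powr (-5/4) * y powr (- (5/4 + \<alpha>)))"
          by (intro mult_left_mono kn y) auto
        also have "\<dots> = (y powr \<alpha> * y powr (- (5/4 + \<alpha>))) * norm w powr (-5/4)" by (simp only: mult_ac)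
        also have "y powr \<alpha> * y powr (- (5/4 + \<alpha>)) = y powr (-5/4)" using y by (simp flip: powr_add)
        finally show ?thesis using False by (simp add: norm_mult)
      qed
    qed
    then show ?thesis by simp
  qed
  have "norm (h 0) = norm w powr (- s)" unfolding norm_kern[OF Imw] by simp
  also have "\<dots> \<le> norm w powr (-5/4)" using \<alpha> by (intro wm) simp
  finally show "norm (h 0) \<le> norm w powr (-5/4)" .
  have "Gamma (1 + \<alpha>) > 0" "Gamma (3 / 2 :: real) > 0" using \<alpha> by (auto intro!: Gamma_real_pos)
  then show "norm Jp \<le> Gamma (1 + \<alpha>) * Gamma (3 / 2) / Gamma s * norm w powr (-5/4)"
    unfolding norm_Jp using Gamma_s by (intro mult_left_mono wm) auto
qed

section \<open>Partial summation against the derivative of the kernel\<close>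

definition kd :: "real \<Rightarrow> complex" where "kd y = of_real s * \<i> * kern (s + 1) w y"

lemma kd: "((\<lambda>y. - h y) has_vector_derivative kd y) (at y)"
proof -
  have "- (- of_real s * \<i> * kern (s + 1) w y) = kd y"
    by (simp only: kd_def mult_minus_left minus_minus)
  with has_vector_derivative_minus[OF has_vector_derivative_kern[OF Imw, of s y]] show ?thesis
    by (simp only:)
qed

lemma norm_kd: "norm (kd y) = s * norm (of_real y - w) powr (- s - 1)"
proof -
  have "- (s + 1) = - s - 1" by simp
  then show ?thesis
    unfolding kd_def norm_mult norm_kern[OF Imw] norm_of_real using s_pos by simp
qed

lemma kd_decay: obtains C where "C > 0" "\<And>y. y > 0 \<Longrightarrow> norm (kd y) \<le> C * y powr (- s - 1)" "\<And>y. y > 0 \<Longrightarrow> norm (kd y) \<le> C"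
proof -
  have s1: "s + 1 \<ge> 0" using \<alpha> by simp
  obtain C where C: "C > 0" "\<And>y. norm (kern (s + 1) w y) \<le> C * (1 + \<bar>y\<bar>) powr (- (s + 1))"
    using kern_decay[OF Imw s1] by metis
  have n: "norm (kd y) = s * norm (kern (s + 1) w y)" for y
    unfolding kd_def norm_mult norm_of_real using s_pos by simp
  show ?thesis
  proof (rule that[of "s * C"])
    show "s * C > 0" using C s_pos by simp
    fix y :: real assume y: "y > 0"
    have "(1 + \<bar>y\<bar>) powr (- (s + 1)) \<le> y powr (- (s + 1))" using y s1 by (intro powr_mono2') auto
    then have "C * (1 + \<bar>y\<bar>) powr (- (s + 1)) \<le> C * y powr (- (s + 1))" using C(1) by (intro mult_left_mono) auto
    then have "norm (kern (s + 1) w y) \<le> C * y powr (- (s + 1))" by (rule order_trans[OF C(2)])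
    then have "s * norm (kern (s + 1) w y) \<le> s * (C * y powr (- (s + 1)))" using s_pos by (intro mult_left_mono) auto
    also have "- (s + 1) = - s - 1" by simp
    finally show "norm (kd y) \<le> s * C * y powr (- s - 1)" unfolding n by (simp only: mult.assoc)
    have "(1 + \<bar>y\<bar>) powr (- (s + 1)) \<le> 1 powr (- (s + 1))" using y s1 by (intro powr_mono2') auto
    then have "C * (1 + \<bar>y\<bar>) powr (- (s + 1)) \<le> C * 1" using C(1) by (intro mult_left_mono) auto
    then have "norm (kern (s + 1) w y) \<le> C * 1" by (rule order_trans[OF C(2)])
    then show "norm (kd y) \<le> s * C" unfolding n using s_pos by simp
  qed
qed

lemma continuous_on_kd: "continuous_on A kd"
  unfolding kd_def by (intro continuous_intros continuous_on_kern[OF Imw] continuous_on_id)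

lemma int_powr_kd:
  assumes p: "-1 < p" "p < s"
  shows "set_integrable lborel {0<..} (\<lambda>y. of_real (y powr p) * kd y)"
proof -
  obtain C where C: "C > 0" "\<And>y. y > 0 \<Longrightarrow> norm (kd y) \<le> C * y powr (- s - 1)" "\<And>y. y > 0 \<Longrightarrow> norm (kd y) \<le> C"
    by (rule kd_decay) (rule that; assumption)
  show ?thesis
  proof (rule set_integrable_continuous_boundI[where a = p and b = "p - s - 1" and C = C])
    show "continuous_on {0<..} (\<lambda>y. of_real (y powr p) * kd y)"
      by (intro continuous_intros continuous_on_kd) auto
    show "norm (of_real (y powr p) * kd y) \<le> C * y powr p" if "0 < y" for y
      using mult_left_mono[OF C(3)[OF that], of "y powr p"] by (simp add: norm_mult mult.commute)
    show "norm (of_real (y powr p) * kd y) \<le> C * y powr (p - s - 1)" if "1 \<le> y" for y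
    proof -
      have "y powr p * norm (kd y) \<le> y powr p * (C * y powr (- s - 1))"
        using that by (intro mult_left_mono C(2)) auto
      also have "\<dots> = C * (y powr p * y powr (- s - 1))" by (simp only: mult_ac)
      also have "y powr p * y powr (- s - 1) = y powr (p + (- s - 1))" by (rule powr_add [symmetric])
      also have "p + (- s - 1) = p - s - 1" by simp
      finally show ?thesis by (simp add: norm_mult)
    qed
  qed (use p in auto)
qed

lemma tendsto_powr_h:
  assumes p: "p \<ge> 0" "p < s"
  shows "((\<lambda>y. of_real (y powr p) * h y) \<longlongrightarrow> 0) at_top"
    and "p > 0 \<Longrightarrow> ((\<lambda>y. of_real (y powr p) * h y) \<longlongrightarrow> 0) (at_right 0)"
proof -
  obtain C where C: "C > 0" "\<And>y. norm (h y) \<le> C * (1 + \<bar>y\<bar>) powr (- s)"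
    using kern_decay[OF Imw s_pos(4)] by metis
  have hle: "norm (h y) \<le> C * y powr (- s)" if "y > 0" for y
    using that s_pos C(1) by (intro order_trans[OF C(2)] mult_left_mono powr_mono2') auto
  show "((\<lambda>y. of_real (y powr p) * h y) \<longlongrightarrow> 0) at_top"
  proof (rule Lim_null_comparison)
    have "((\<lambda>y. C * y powr (p - q)) \<longlongrightarrow> 0) at_top" if "p < q" for q :: real
      using that by real_asymp
    from this[OF p(2)] show "((\<lambda>y. C * y powr (p - s)) \<longlongrightarrow> 0) at_top" .
    show "\<forall>\<^sub>F y in at_top. norm (of_real (y powr p) * h y) \<le> C * y powr (p - s)"
      using eventually_gt_at_top[of 0]
    proof eventually_elim
      case (elim y)
      have "y powr p * norm (h y) \<le> y powr p * (C * y powr (- s))" by (intro mult_left_mono hle elim) auto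
      also have "\<dots> = C * (y powr p * y powr (- s))" by (simp only: mult_ac)
      also have "y powr p * y powr (- s) = y powr (p + (- s))" by (rule powr_add [symmetric])
      also have "p + (- s) = p - s" by simp
      finally show ?case by (simp add: norm_mult)
    qed
  qed
  show "((\<lambda>y. of_real (y powr p) * h y) \<longlongrightarrow> 0) (at_right 0)" if "p > 0"
  proof -
    have "isCont h 0" using has_vector_derivative_kern[OF Imw] has_vector_derivative_continuous by blast
    then have "(h \<longlongrightarrow> h 0) (at_right 0)" by (auto simp: isCont_def intro: tendsto_within_subset)
    moreover have "((\<lambda>y. y powr p) \<longlongrightarrow> 0) (at_right 0)" using that by real_asymp
    ultimately have "((\<lambda>y. of_real (y powr p) * h y) \<longlongrightarrow> of_real 0 * h 0) (at_right 0)"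
      by (intro tendsto_intros)
    then show ?thesis by simp
  qed
qed

lemma int_powr_h:
  assumes p: "-1 < p" "p < s - 1"
  shows "set_integrable lborel {0<..} (\<lambda>y. of_real (y powr p) * h y)"
proof -
  obtain C where C: "C > 0" "\<And>y. norm (h y) \<le> C * (1 + \<bar>y\<bar>) powr (- s)"
    using kern_decay[OF Imw s_pos(4)] by metis
  have hle: "norm (h y) \<le> C * y powr (- s)" if "y > 0" for y
    using that s_pos C(1) by (intro order_trans[OF C(2)] mult_left_mono powr_mono2') auto
  have hC: "norm (h y) \<le> C" for y
  proof -
    have "(1 + \<bar>y\<bar>) powr (- s) \<le> 1 powr (- s)" using s_pos by (intro powr_mono2') auto
    then have "C * (1 + \<bar>y\<bar>) powr (- s) \<le> C * 1" using C(1) by (intro mult_left_mono) auto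
    then show ?thesis using C(2)[of y] by simp
  qed
  show ?thesis
  proof (rule set_integrable_continuous_boundI[where a = p and b = "p - s" and C = C])
    show "continuous_on {0<..} (\<lambda>y. of_real (y powr p) * h y)"
      by (intro continuous_intros continuous_on_kern[OF Imw]) auto
    show "norm (of_real (y powr p) * h y) \<le> C * y powr p" if "0 < y" for y
      using mult_left_mono[OF hC, of "y powr p" y] by (simp add: norm_mult mult.commute)
    show "norm (of_real (y powr p) * h y) \<le> C * y powr (p - s)" if "1 \<le> y" for y
    proof -
      have "y powr p * norm (h y) \<le> y powr p * (C * y powr (- s))"
        using that by (intro mult_left_mono hle) auto
      also have "\<dots> = C * (y powr p * y powr (- s))" by (simp only: mult_ac)
      also have "y powr p * y powr (- s) = y powr (p + (- s))" by (rule powr_add [symmetric])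
      also have "p + (- s) = p - s" by simp
      finally show ?thesis by (simp add: norm_mult)
    qed
  qed (use p in auto)
qed

lemma parts_powr:
  assumes p: "p > 0" "p < s"
  shows "(LBINT y:{0<..}. of_real (y powr p) * kd y) = of_real p * (LBINT y:{0<..}. of_real (y powr (p - 1)) * h y)"
proof -
  have i1: "set_integrable lborel {0<..} (\<lambda>y. of_real (y powr p) * kd y)"
    using p by (intro int_powr_kd) auto
  have i2: "set_integrable lborel {0<..} (\<lambda>y. of_real p * (of_real (y powr (p - 1)) * h y))"
    using p by (intro set_integrable_mult_right int_powr_h) auto
  have "(LBINT y:{0<..}. of_real (y powr p) * kd y - of_real p * (of_real (y powr (p - 1)) * h y)) = 0 - 0"
  proof (rule FTC_Ioi[where F = "\<lambda>y. - (of_real (y powr p) * h y)"])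
    fix y :: real assume y: "0 < y"
    have "((\<lambda>y. y powr p) has_real_derivative p * y powr (p - 1)) (at y)"
      using y by (auto intro!: derivative_eq_intros)
    from has_vector_derivative_mult[OF has_vector_derivative_of_real[OF this] kd]
    have "((\<lambda>y. of_real (y powr p) * - h y) has_vector_derivative
        of_real (y powr p) * kd y + of_real (p * y powr (p - 1)) * - h y) (at y)" .
    then show "((\<lambda>y. - (of_real (y powr p) * h y)) has_vector_derivative
        of_real (y powr p) * kd y - of_real p * (of_real (y powr (p - 1)) * h y)) (at y)"
      by (simp add: mult.assoc)
  next
    show "continuous_on {0<..} (\<lambda>y. of_real (y powr p) * kd y - of_real p * (of_real (y powr (p - 1)) * h y))"
      by (intro continuous_intros continuous_on_kd continuous_on_kern[OF Imw]) auto
    show "set_integrable lborel {0<..} (\<lambda>y. of_real (y powr p) * kd y - of_real p * (of_real (y powr (p - 1)) * h y))"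
      by (rule set_integral_diff(1)[OF i1 i2])
    show "((\<lambda>y. - (of_real (y powr p) * h y)) \<longlongrightarrow> 0) (at_right 0)"
      using tendsto_minus[OF tendsto_powr_h(2)[of p]] p by simp
    show "((\<lambda>y. - (of_real (y powr p) * h y)) \<longlongrightarrow> 0) at_top"
      using tendsto_minus[OF tendsto_powr_h(1)[of p]] p by simp
  qed
  then show ?thesis
    unfolding set_integral_diff(2)[OF i1 i2] by simp
qed

definition H1 where "H1 = (LBINT y:{0<..}. h y)"

text \<open>\<open>h\<close> has a multiple of the kernel with exponent s - 1 as primitive, so the
  integral is a boundary value at 0, away from the peak near Re w. Norms inside the integral would
  give the order Im w powr (1 - s).\<close>

lemma norm_H1: "norm H1 = norm w powr (- 3 / 2 - \<alpha>) / (s - 1)"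
proof -
  have i: "set_integrable lborel {0<..} h"
  proof -
    have "set_integrable lborel {0<..} (\<lambda>y. of_real (y powr 0) * h y)" using \<alpha> by (intro int_powr_h) auto
    then show ?thesis by (rule set_integrable_cong[THEN iffD1, rotated -1]) auto
  qed
  define c where "c = \<i> * of_real (1 - s)"
  have nc: "norm c = s - 1"
    unfolding c_def norm_mult norm_of_real using \<alpha> by simp
  have "c \<noteq> 0" using nc s_pos(3) by (metis less_irrefl norm_zero)
  note c0 = this nc
  have F: "((\<lambda>y. kern (s - 1) w y / c) has_vector_derivative h y) (at y)" for y
  proof -
    have s11: "s - 1 + 1 = s" by simp
    have e: "- of_real (s - 1) * \<i> * h y = h y * c"
      by (simp add: c_def algebra_simps)
    have "(kern (s - 1) w has_vector_derivative h y * c) (at y)"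
      using has_vector_derivative_kern[OF Imw, of "s - 1" y] unfolding s11 e .
    from has_vector_derivative_mult_left[OF this, of "1 / c"] show ?thesis using c0(1) by simp
  qed
  have "H1 = 0 - kern (s - 1) w 0 / c"
    unfolding H1_def
  proof (rule FTC_Ioi[OF F _ i])
    show "continuous_on {0<..} h" by (intro continuous_on_kern[OF Imw] continuous_on_id)
    have "isCont (\<lambda>y. kern (s - 1) w y / c) 0" using F has_vector_derivative_continuous by blast
    then show "((\<lambda>y. kern (s - 1) w y / c) \<longlongrightarrow> kern (s - 1) w 0 / c) (at_right 0)"
      by (auto simp: isCont_def intro: tendsto_within_subset)
    obtain C where C: "C > 0" "\<And>y. norm (kern (s - 1) w y) \<le> C * (1 + \<bar>y\<bar>) powr (- (s - 1))"
      using kern_decay[OF Imw, of "s - 1"] s_pos by (metis less_imp_le)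
    have "((\<lambda>y. kern (s - 1) w y) \<longlongrightarrow> 0) at_top"
    proof (rule Lim_null_comparison)
      have "((\<lambda>y. C * (1 + \<bar>y\<bar>) powr (- q)) \<longlongrightarrow> 0) at_top" if "q > 0" for q :: real
        using that by real_asymp
      from this[OF s_pos(3)] show "((\<lambda>y. C * (1 + \<bar>y\<bar>) powr (- (s - 1))) \<longlongrightarrow> 0) at_top" .
    qed (use C in \<open>auto intro!: always_eventually\<close>)
    from tendsto_divide[OF this tendsto_const, of c] show "((\<lambda>y. kern (s - 1) w y / c) \<longlongrightarrow> 0) at_top"
      using c0 by simp
  qed
  then have "norm H1 = norm w powr (- (s - 1)) / norm c"
    by (simp add: norm_divide norm_kern[OF Imw])
  also have "- (s - 1) = - 3 / 2 - \<alpha>" by simp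
  finally show ?thesis by (simp only: c0)
qed

text \<open>At most n divisors, each at most n. The bound only has to make the series against n powr
  (- s) converge, and 1 + \<alpha> - s = -3/2.\<close>

lemma divisor_sigma_le: "0 \<le> divisor_sigma \<alpha> (Suc n)" "divisor_sigma \<alpha> (Suc n) \<le> real (Suc n) powr (1 + \<alpha>)"
proof -
  show "0 \<le> divisor_sigma \<alpha> (Suc n)" by (auto simp: divisor_sigma_def intro: sum_nonneg)
  have "divisor_sigma \<alpha> (Suc n) \<le> (\<Sum>d | d dvd Suc n. real (Suc n) powr \<alpha>)"
    unfolding divisor_sigma_def using \<alpha> by (intro sum_mono powr_mono2) (auto dest: dvd_imp_le)
  also have "\<dots> = real (card {d. d dvd Suc n}) * real (Suc n) powr \<alpha>" by simp
  also have "card {d. d dvd Suc n} \<le> card {1..Suc n}"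
    by (intro card_mono) (auto intro!: Suc_leI dvd_imp_le intro: dvd_pos_nat[of "Suc n"])
  then have "real (card {d. d dvd Suc n}) * real (Suc n) powr \<alpha> \<le> real (Suc n) * real (Suc n) powr \<alpha>"
    by (intro mult_right_mono) auto
  also have "\<dots> = real (Suc n) powr (1 + \<alpha>)" by (simp add: powr_add del: of_nat_Suc)
  finally show "divisor_sigma \<alpha> (Suc n) \<le> real (Suc n) powr (1 + \<alpha>)" .
qed

definition Dsum :: "real \<Rightarrow> real" where
  "Dsum x = (\<Sum>n | 1 \<le> n \<and> real n \<le> x. divisor_sigma \<alpha> n)"

text \<open>Abel summation as termwise integration: \<open>Dsum\<close> is a sum of steps that start
  at the integers n with height \<open>divisor_sigma \<alpha> n\<close>, and the integral of - h'
  from n to infinity is h(n). The resulting series is identified with \<open>Vp\<close> by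
  regrouping over factorisations.\<close>

lemma Vp_integral:
  "set_integrable lborel {0<..} (\<lambda>x. of_real (Dsum x) * kd x)"
  "(LBINT x:{0<..}. of_real (Dsum x) * kd x) = Vp"
proof -
  obtain C where C: "C > 0" "\<And>y. y > 0 \<Longrightarrow> norm (kd y) \<le> C * y powr (- s - 1)" "\<And>y. y > 0 \<Longrightarrow> norm (kd y) \<le> C"
    by (rule kd_decay) (rule that; assumption)
  have ik: "set_integrable lborel {0<..} kd"
  proof -
    have "set_integrable lborel {0<..} (\<lambda>y. of_real (y powr 0) * kd y)" using \<alpha> by (intro int_powr_kd) auto
    then show ?thesis by (rule set_integrable_cong[THEN iffD1, rotated -1]) auto
  qed
  define f where "f = (\<lambda>n x. of_real (divisor_sigma \<alpha> (Suc n)) * (indicator {real (Suc n)..} x * kd x))"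
  have ind: "indicator {0<..} x *\<^sub>R (indicator {real (Suc n)..} x * g) = indicator {real (Suc n)..} x *\<^sub>R g" for x n and g :: complex
    by (auto simp: indicator_def)
  have i0: "set_integrable lborel {real (Suc n)..} kd" for n
    by (rule set_integrable_subset[OF ik]) auto
  have i1: "set_integrable lborel {0<..} (\<lambda>x. indicator {real (Suc n)..} x * kd x)" for n
    using i0[of n] unfolding set_integrable_def ind .
  have fint: "set_integrable lborel {0<..} (f n)" for n
    unfolding f_def by (intro set_integrable_mult_right i1)
  \<comment> \<open>A step includes its own jump point, hence the closed half-line, whereas the
    fundamental theorem is stated for open ones; the two differ by a null set.\<close>
  have AE_eq: "(LBINT x:{c..}. g x) = (LBINT x:{c<..}. g x)" if "set_integrable lborel {c..} g" for g :: "real \<Rightarrow> 'b :: {banach, second_countable_topology}" and c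
    unfolding set_lebesgue_integral_def
  proof (rule integral_cong_AE)
    show "(\<lambda>x. indicat_real {c..} x *\<^sub>R g x) \<in> borel_measurable lborel" using that by (auto simp: set_integrable_def)
    have "set_integrable lborel {c<..} g" by (rule set_integrable_subset[OF that]) auto
    then show "(\<lambda>x. indicat_real {c<..} x *\<^sub>R g x) \<in> borel_measurable lborel" by (auto simp: set_integrable_def)
    show "AE x in lborel. indicat_real {c..} x *\<^sub>R g x = indicat_real {c<..} x *\<^sub>R g x"
      using AE_lborel_singleton[of c] by eventually_elim (auto simp: indicator_def)
  qed
  have ftc: "(LBINT x:{real (Suc n)<..}. kd x) = h (real (Suc n))" for n
  proof -
    have "(LBINT x:{real (Suc n)<..}. kd x) = 0 - (- h (real (Suc n)))"
    proof (rule FTC_Ioi[OF kd continuous_on_kd])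
      show "set_integrable lborel {real (Suc n)<..} kd" by (rule set_integrable_subset[OF ik]) auto
      have "isCont (\<lambda>y. - h y) (real (Suc n))" using kd has_vector_derivative_continuous by blast
      then show "((\<lambda>y. - h y) \<longlongrightarrow> - h (real (Suc n))) (at_right (real (Suc n)))"
        unfolding isCont_def by (rule tendsto_within_subset) simp
      have "((\<lambda>y. of_real (y powr 0) * h y) \<longlongrightarrow> 0) at_top" using s_pos by (intro tendsto_powr_h(1)) auto
      note l = this
      have "((\<lambda>y. - h y) \<longlongrightarrow> - 0) at_top"
      proof (rule Lim_transform_eventually[OF tendsto_minus[OF l]])
        show "\<forall>\<^sub>F y in at_top. - (of_real (y powr 0) * h y) = - h y"
          using eventually_gt_at_top[of "0::real"] by eventually_elim simp
      qed
      then show "((\<lambda>y. - h y) \<longlongrightarrow> 0) at_top" by simp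
    qed
    then show ?thesis by simp
  qed
  have fval: "(LBINT x:{0<..}. f n x) = of_real (divisor_sigma \<alpha> (Suc n)) * h (real (Suc n))" for n
  proof -
    have "(LBINT x:{0<..}. f n x) = of_real (divisor_sigma \<alpha> (Suc n)) * (LBINT x:{0<..}. indicator {real (Suc n)..} x * kd x)"
      unfolding f_def by simp
    also have "(LBINT x:{0<..}. indicator {real (Suc n)..} x * kd x) = (LBINT x:{real (Suc n)..}. kd x)"
      unfolding set_lebesgue_integral_def ind ..
    also have "\<dots> = h (real (Suc n))" unfolding AE_eq[OF i0] by (rule ftc)
    finally show ?thesis .
  qed
  \<comment> \<open>The zero-based index n belongs to the step at n + 1, so at a fixed x only
    indices below the ceiling of x contribute and the pointwise sum is finite.\<close>
  have supp: "f n x = 0" if "n \<notin> {..<nat \<lceil>x\<rceil>}" for n x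
  proof -
    have "x < real (Suc n)" using that by simp linarith
    then show ?thesis by (simp add: f_def)
  qed
  have fs: "(\<Sum>n. f n x) = of_real (Dsum x) * kd x" if "x > 0" for x
  proof -
    have "(\<Sum>n. f n x) = (\<Sum>n<nat \<lceil>x\<rceil>. f n x)"
      by (rule suminf_finite) (use supp in auto)
    also have "\<dots> = (\<Sum>n\<in>{n. n < nat \<lceil>x\<rceil> \<and> real (Suc n) \<le> x}. of_real (divisor_sigma \<alpha> (Suc n)) * kd x)"
      by (rule sum.mono_neutral_cong_right) (auto simp: f_def)
    also have "\<dots> = (\<Sum>n | 1 \<le> n \<and> real n \<le> x. of_real (divisor_sigma \<alpha> n) * kd x)"
    proof (rule sum.reindex_bij_witness[where i = "\<lambda>n. n - 1" and j = Suc])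
      fix n assume "n \<in> {n. 1 \<le> n \<and> real n \<le> x}"
      then have n: "1 \<le> n" "real n \<le> x" by auto
      then show "Suc (n - 1) = n" by simp
      have "n - 1 < nat \<lceil>x\<rceil>" using n by linarith
      then show "n - 1 \<in> {n. n < nat \<lceil>x\<rceil> \<and> real (Suc n) \<le> x}" using n by simp
    qed auto
    finally show ?thesis by (simp add: Dsum_def sum_distrib_right)
  qed
  have nb: "(LBINT x:{0<..}. norm (f n x)) \<le> C / s * real (Suc n) powr (-3/2)" for n
  proof -
    have c1: "- s - 1 < -1" "real (Suc n) > 0" using s_pos by auto
    note P = set_integrable_powr_at_top[OF c1]
    have "(LBINT x:{0<..}. norm (f n x)) = divisor_sigma \<alpha> (Suc n) * (LBINT x:{real (Suc n)..}. norm (kd x))"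
      unfolding set_lebesgue_integral_def Bochner_Integration.integral_mult_right_zero [symmetric]
      using divisor_sigma_le(1)[of n]
      by (intro Bochner_Integration.integral_cong) (auto simp: f_def norm_mult indicator_def)
    also have "(LBINT x:{real (Suc n)..}. norm (kd x)) = (LBINT x:{real (Suc n)<..}. norm (kd x))"
      by (rule AE_eq[OF set_integrable_norm[OF i0]])
    also have "\<dots> \<le> (LBINT x:{real (Suc n)<..}. C * x powr (- s - 1))"
    proof (rule set_integral_mono)
      show "set_integrable lborel {real (Suc n)<..} (\<lambda>x. norm (kd x))"
        by (intro set_integrable_norm set_integrable_subset[OF ik]) auto
      show "set_integrable lborel {real (Suc n)<..} (\<lambda>x. C * x powr (- s - 1))"
        by (intro set_integrable_mult_right P(1))
      show "norm (kd x) \<le> C * x powr (- s - 1)" if "x \<in> {real (Suc n)<..}" for x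
      proof -
        have "real (Suc n) < x" using that by simp
        then have "x > 0" using c1(2) by linarith
        then show ?thesis by (rule C(2))
      qed
    qed
    also have "\<dots> = C * (real (Suc n) powr (- s) / s)"
    proof -
      have e: "- s - 1 + 1 = - s" by simp
      show ?thesis unfolding set_integral_mult_right P(2) e by (simp only: divide_minus_right minus_minus)
    qed
    finally have "(LBINT x:{0<..}. norm (f n x)) \<le> divisor_sigma \<alpha> (Suc n) * (C * (real (Suc n) powr (- s) / s))"
      using divisor_sigma_le(1)[of n] by (simp add: mult_left_mono)
    also have "\<dots> \<le> real (Suc n) powr (1 + \<alpha>) * (C * (real (Suc n) powr (- s) / s))"
      using divisor_sigma_le(2)[of n] C(1) s_pos(1) by (intro mult_right_mono) auto
    also have "\<dots> = C / s * (real (Suc n) powr (1 + \<alpha>) * real (Suc n) powr (- s))" by simp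
    also have "real (Suc n) powr (1 + \<alpha>) * real (Suc n) powr (- s) = real (Suc n) powr (-3/2)"
      by (simp flip: powr_add del: of_nat_Suc)
    finally show ?thesis .
  qed
  have sn: "summable (\<lambda>n. norm (f n x))" for x
    by (rule summable_finite[of "{..<nat \<lceil>x\<rceil>}"]) (use supp in auto)
  have sM: "summable (\<lambda>n. C / s * real (Suc n) powr (-3/2))" by (intro summable_mult summable_Suc_powr) simp
  note L = set_lebesgue_integral_sums[OF fint sn nb sM]
  have "set_integrable lborel {0<..} (\<lambda>x. \<Sum>n. f n x) \<longleftrightarrow> set_integrable lborel {0<..} (\<lambda>x. of_real (Dsum x) * kd x)"
    by (rule set_integrable_cong) (auto simp: fs)
  then show "set_integrable lborel {0<..} (\<lambda>x. of_real (Dsum x) * kd x)" using L(1) by simp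
  have "(LBINT x:{0<..}. (\<Sum>n. f n x)) = (LBINT x:{0<..}. of_real (Dsum x) * kd x)"
    by (rule set_lebesgue_integral_cong) (auto simp: fs)
  with L(2) have "(\<lambda>n. of_real (divisor_sigma \<alpha> (Suc n)) * h (real (Suc n))) sums (LBINT x:{0<..}. of_real (Dsum x) * kd x)"
    unfolding fval by simp
  moreover have "(\<lambda>n. of_real (divisor_sigma \<alpha> (Suc n)) * h (real (Suc n))) sums Vp"
    unfolding Vp_def by (rule divisor_sum_rearrange[where g = "\<lambda>n. h (real n)", OF pair_summable_V(1)])
  ultimately show "(LBINT x:{0<..}. of_real (Dsum x) * kd x) = Vp" by (rule sums_unique2)
qed

text \<open>By \<open>parts_powr\<close> the two smooth terms become multiples of \<open>Jp\<close>
  and \<open>H1\<close>, whose norms are known exactly.\<close>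

lemma error_integral:
  fixes A B :: real
  defines "E \<equiv> \<lambda>x. Dsum x - (A * x powr (1 + \<alpha>) + B * x)"
  shows "set_integrable lborel {0<..} (\<lambda>x. of_real (E x) * kd x)"
    and "(LBINT x:{0<..}. of_real (E x) * kd x) = Vp - of_real (A * (1 + \<alpha>)) * Jp - of_real B * H1"
proof -
  have p1: "1 + \<alpha> > 0" "1 + \<alpha> < s" "(1::real) > 0" "1 < s" using \<alpha> by auto
  have i1: "set_integrable lborel {0<..} (\<lambda>x. of_real A * (of_real (x powr (1 + \<alpha>)) * kd x))"
    using p1 by (intro set_integrable_mult_right int_powr_kd) auto
  have i2: "set_integrable lborel {0<..} (\<lambda>x. of_real B * (of_real (x powr 1) * kd x))"
    using p1 by (intro set_integrable_mult_right int_powr_kd) auto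
  have eq: "of_real (E x) * kd x = of_real (Dsum x) * kd x - of_real A * (of_real (x powr (1 + \<alpha>)) * kd x) - of_real B * (of_real (x powr 1) * kd x)"
    if "x \<in> {0<..}" for x
    using that by (simp add: E_def algebra_simps)
  have v1: "(LBINT x:{0<..}. of_real A * (of_real (x powr (1 + \<alpha>)) * kd x)) = of_real (A * (1 + \<alpha>)) * Jp"
    unfolding set_integral_mult_right parts_powr[OF p1(1,2)] Jp_def by simp
  have v2: "(LBINT x:{0<..}. of_real B * (of_real (x powr 1) * kd x)) = of_real B * H1"
  proof -
    have "(LBINT y:{0<..}. of_real (y powr (1 - 1)) * h y) = H1"
      unfolding H1_def by (rule set_lebesgue_integral_cong) auto
    then show ?thesis unfolding set_integral_mult_right parts_powr[OF p1(3,4)] by simp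
  qed
  note D = set_integral_diff[OF Vp_integral(1) i1]
  note D2 = set_integral_diff[OF D(1) i2]
  have "set_integrable lborel {0<..} (\<lambda>x. of_real (E x) * kd x) \<longleftrightarrow>
     set_integrable lborel {0<..} (\<lambda>x. of_real (Dsum x) * kd x - of_real A * (of_real (x powr (1 + \<alpha>)) * kd x) - of_real B * (of_real (x powr 1) * kd x))"
    by (rule set_integrable_cong[OF refl refl eq])
  then show "set_integrable lborel {0<..} (\<lambda>x. of_real (E x) * kd x)" using D2(1) by (simp only:)
  have "(LBINT x:{0<..}. of_real (E x) * kd x) = (LBINT x:{0<..}. of_real (Dsum x) * kd x - of_real A * (of_real (x powr (1 + \<alpha>)) * kd x) - of_real B * (of_real (x powr 1) * kd x))"
    by (rule set_lebesgue_integral_cong) (use eq in auto)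
  then show "(LBINT x:{0<..}. of_real (E x) * kd x) = Vp - of_real (A * (1 + \<alpha>)) * Jp - of_real B * H1"
    unfolding D2(2) D(2) v1 v2 Vp_integral(2) .
qed

end

section \<open>Exponential sums with aligned phases\<close>

lemma pair_summable_innerI:
  assumes s1: "\<And>d. summable (\<lambda>m. norm (F d m))" and le: "\<And>d. (\<Sum>m. norm (F d m)) \<le> A d" and A: "summable A"
  shows "pair_summable F" and "norm (pair_sum F) \<le> (\<Sum>d. \<Sum>m. norm (F d m))"
proof -
  have nn: "0 \<le> (\<Sum>m. norm (F d m))" for d
    by (rule suminf_nonneg[OF s1]) simp
  have s2: "summable (\<lambda>d. \<Sum>m. norm (F d m))"
    by (rule summable_comparison_test'[OF A]) (use le nn in simp)
  show "pair_summable F" using s1 s2 by (simp add: pair_summable_def)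
  have n1: "norm (\<Sum>m. F d m) \<le> (\<Sum>m. norm (F d m))" for d
    by (rule summable_norm[OF s1])
  have s3: "summable (\<lambda>d. norm (\<Sum>m. F d m))"
    by (rule summable_comparison_test'[OF s2]) (use n1 in simp)
  have "norm (pair_sum F) \<le> (\<Sum>d. norm (\<Sum>m. F d m))"
    unfolding pair_sum_def by (rule summable_norm[OF s3])
  also have "\<dots> \<le> (\<Sum>d. \<Sum>m. norm (F d m))"
    by (rule suminf_le[OF n1 s3 s2])
  finally show "norm (pair_sum F) \<le> (\<Sum>d. \<Sum>m. norm (F d m))" .
qed

lemma pair_sum_add:
  assumes "pair_summable F" "pair_summable G"
  shows "pair_sum (\<lambda>d m. F d m + G d m) = pair_sum F + pair_sum G"
proof -
  note F = pair_summable_inner[OF assms(1)] and G = pair_summable_inner[OF assms(2)]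
  have "(\<Sum>m. F d m + G d m) = (\<Sum>m. F d m) + (\<Sum>m. G d m)" for d
    by (rule suminf_add[OF F(1) G(1), symmetric])
  then show ?thesis unfolding pair_sum_def using suminf_add[OF F(2) G(2)] by simp
qed

lemma pair_sum_cmult:
  assumes "pair_summable F"
  shows "pair_sum (\<lambda>d m. c * F d m) = c * pair_sum F"
proof -
  note F = pair_summable_inner[OF assms]
  have "(\<Sum>m. c * F d m) = c * (\<Sum>m. F d m)" for d by (rule suminf_mult[OF F(1)])
  then show ?thesis unfolding pair_sum_def using suminf_mult[OF F(2), of c] by simp
qed

section \<open>Sums damped by exp (- c sqrt n)\<close>

lemma exp_sqrt_sum:
  fixes u :: real
  assumes u: "u > 0"
  shows "summable (\<lambda>l. exp (- u * sqrt (real (Suc l))))"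
    and "(\<Sum>l. exp (- u * sqrt (real (Suc l)))) \<le> 2 / u\<^sup>2"
proof -
  \<comment> \<open>An antiderivative of exp (- u sqrt x) that starts at - 2 / u^2 and stays
    nonpositive. Each term of the series is at most the increment of \<open>P\<close> over
    [l, l + 1], because the exponential is decreasing; telescoping gives 2 / u^2.\<close>
  define P where "P = (\<lambda>x. - (2 / u\<^sup>2) * ((1 + u * sqrt x) * exp (- u * sqrt x)))"
  have step: "exp (- u * sqrt (real (Suc l))) \<le> P (real (Suc l)) - P (real l)" for l
  proof -
    have D: "(P has_real_derivative exp (- u * sqrt x)) (at x)" if "x > 0" for x
    proof -
      have "((\<lambda>r. - (2 / u\<^sup>2) * ((1 + u * r) * exp (- u * r))) has_real_derivative 2 * r * exp (- u * r)) (at r)" for r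
        using u by (auto intro!: derivative_eq_intros simp: field_simps power2_eq_square)
      note d = DERIV_chain2[OF this DERIV_real_sqrt[OF that]]
      have e: "2 * sqrt x * exp (- u * sqrt x) * (inverse (sqrt x) / 2) = exp (- u * sqrt x)"
        using that by simp
      show ?thesis unfolding P_def using d[unfolded e] .
    qed
    have "continuous_on {real l..real (Suc l)} P"
      unfolding P_def by (intro continuous_intros)
    moreover have "P differentiable (at x)" if "real l < x" "x < real (Suc l)" for x
    proof -
      have "x > 0" using that(1) of_nat_0_le_iff[of l] by linarith
      from D[OF this] show ?thesis using real_differentiable_def by blast
    qed
    ultimately obtain d z where z: "real l < z" "z < real (Suc l)" "(P has_real_derivative d) (at z)"
        "P (real (Suc l)) - P (real l) = (real (Suc l) - real l) * d"
      using MVT[of "real l" "real (Suc l)" P] by auto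
    have "z > 0" using z(1) of_nat_0_le_iff[of l] by linarith
    then have d: "d = exp (- u * sqrt z)" using D z(3) DERIV_unique by blast
    have "sqrt z \<le> sqrt (real (Suc l))" using z by simp
    then have "u * sqrt z \<le> u * sqrt (real (Suc l))" using u by (intro mult_left_mono) auto
    then show ?thesis unfolding z(4) d by simp
  qed
  have part: "(\<Sum>l<n. exp (- u * sqrt (real (Suc l)))) \<le> 2 / u\<^sup>2" for n
  proof -
    have "(\<Sum>l<n. exp (- u * sqrt (real (Suc l)))) \<le> (\<Sum>l<n. P (real (Suc l)) - P (real l))"
      by (intro sum_mono step)
    also have "\<dots> = P (real n) - P (real 0)" by (rule sum_lessThan_telescope)
    also have "P (real n) \<le> 0" unfolding P_def using u by simp
    also have "P (real 0) = - (2 / u\<^sup>2)" by (simp add: P_def)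
    finally show ?thesis by simp
  qed
  show s: "summable (\<lambda>l. exp (- u * sqrt (real (Suc l))))"
    by (rule summableI_nonneg_bounded[OF _ part]) simp
  show "(\<Sum>l. exp (- u * sqrt (real (Suc l)))) \<le> 2 / u\<^sup>2"
    by (rule suminf_le_const[OF s part])
qed

text \<open>Half of the exponential absorbs the square root, by y \<le> exp y at y = v sqrt l / 2;
  the other half is summed by the previous lemma with v / 2.\<close>

lemma sqrt_exp_sqrt_sum:
  fixes v :: real
  assumes v: "v > 0"
  shows "summable (\<lambda>l. sqrt (real (Suc l)) * exp (- v * sqrt (real (Suc l))))"
    and "(\<Sum>l. sqrt (real (Suc l)) * exp (- v * sqrt (real (Suc l)))) \<le> 16 / v ^ 3"
proof -
  have le: "sqrt (real (Suc l)) * exp (- v * sqrt (real (Suc l))) \<le> 2 / v * exp (- (v / 2) * sqrt (real (Suc l)))" for l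
  proof -
    define r where "r = sqrt (real (Suc l))"
    define y where "y = v * r / 2"
    have "y \<le> exp y" using exp_ge_add_one_self[of y] by linarith
    then have "y * exp (- y) \<le> 1" by (simp add: exp_minus field_simps)
    then have "2 / v * (y * exp (- y)) * exp (- y) \<le> 2 / v * 1 * exp (- y)"
      using v by (intro mult_right_mono mult_left_mono) auto
    moreover have "2 / v * (y * exp (- y)) * exp (- y) = r * exp (- v * r)"
    proof -
      have "exp (- y) * exp (- y) = exp (- v * r)" unfolding exp_add [symmetric] y_def by simp
      moreover have "2 / v * y = r" using v by (simp add: y_def)
      moreover have "2 / v * (y * E) * E = (2 / v * y) * (E * E)" for E :: real
        by (simp only: mult_ac)
      ultimately show ?thesis by (simp only:)
    qed
    ultimately show ?thesis by (simp add: y_def r_def)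
  qed
  have v2: "v / 2 > 0" using v by simp
  note E = exp_sqrt_sum[OF v2]
  have s2: "summable (\<lambda>l. 2 / v * exp (- (v / 2) * sqrt (real (Suc l))))" by (intro summable_mult E(1))
  show s: "summable (\<lambda>l. sqrt (real (Suc l)) * exp (- v * sqrt (real (Suc l))))"
    by (rule summable_comparison_test'[OF s2]) (use le in simp)
  have "(\<Sum>l. sqrt (real (Suc l)) * exp (- v * sqrt (real (Suc l)))) \<le> (\<Sum>l. 2 / v * exp (- (v / 2) * sqrt (real (Suc l))))"
    by (rule suminf_le[OF le s s2])
  also have "\<dots> = 2 / v * (\<Sum>l. exp (- (v / 2) * sqrt (real (Suc l))))" by (rule suminf_mult[OF E(1)])
  also have "\<dots> \<le> 2 / v * (2 / (v / 2)\<^sup>2)" using v by (intro mult_left_mono E(2)) auto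
  also have "\<dots> = 16 / v ^ 3" using v by (simp add: power2_eq_square power3_eq_cube)
  finally show "(\<Sum>l. sqrt (real (Suc l)) * exp (- v * sqrt (real (Suc l)))) \<le> 16 / v ^ 3" .
qed

text \<open>By the mean value theorem \<alpha> (k + 1) powr (\<alpha> - 1) is at most the increment
  of x powr \<alpha> over [k, k + 1]. The interval at 0 is separate, as the derivative blows up
  there.\<close>

lemma sum_powr_le:
  fixes \<alpha> :: real
  assumes \<alpha>: "0 < \<alpha>" "\<alpha> < 1"
  shows "(\<Sum>k<K. real (Suc k) powr (\<alpha> - 1)) \<le> real K powr \<alpha> / \<alpha>"
proof (induction K)
  case (Suc K)
  have "\<alpha> * real (Suc K) powr (\<alpha> - 1) \<le> real (Suc K) powr \<alpha> - real K powr \<alpha>"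
  proof (cases "K = 0")
    case True
    then show ?thesis using \<alpha> by simp
  next
    case False
    then have K: "real K > 0" by simp
    have "\<exists>z>real K. z < real (Suc K) \<and> real (Suc K) powr \<alpha> - real K powr \<alpha> = (real (Suc K) - real K) * (\<alpha> * z powr (\<alpha> - 1))"
      using K by (intro MVT2) (auto intro!: derivative_eq_intros)
    then obtain z where z: "real K < z" "z < real (Suc K)" "real (Suc K) powr \<alpha> - real K powr \<alpha> = \<alpha> * z powr (\<alpha> - 1)"
      by auto
    have "real (Suc K) powr (\<alpha> - 1) \<le> z powr (\<alpha> - 1)" using z K \<alpha> by (intro powr_mono2') auto
    then show ?thesis unfolding z(3) using \<alpha> by (intro mult_left_mono) auto
  qed
  then have "real (Suc K) powr (\<alpha> - 1) \<le> (real (Suc K) powr \<alpha> - real K powr \<alpha>) / \<alpha>"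
    using \<alpha> by (simp add: field_simps)
  then show ?case using Suc by (simp add: diff_divide_distrib)
qed (use \<alpha> in simp)

lemma powr_exp_sqrt_sum:
  fixes \<alpha> u :: real
  assumes \<alpha>: "0 < \<alpha>" "\<alpha> < 1" and u: "u > 0"
  shows "summable (\<lambda>k. real (Suc k) powr (\<alpha> - 1) * exp (- u * sqrt (real (Suc k))))"
    and "(\<Sum>k. real (Suc k) powr (\<alpha> - 1) * exp (- u * sqrt (real (Suc k)))) \<le> (1 / \<alpha> + 2) * u powr (- 2 * \<alpha>)"
proof -
  \<comment> \<open>The sum is split near k = u powr (-2), where the damping sets in. Below, the
    exponential is bounded by 1; above, k powr (\<alpha> - 1) is at most u powr (2 - 2 \<alpha>) and
    the exponential is summed. Both parts are of order u powr (- 2 \<alpha>).\<close>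
  define K where "K = nat \<lfloor>u powr (-2)\<rfloor>"
  define e where "e = (\<lambda>k. exp (- u * sqrt (real (Suc k))))"
  define g where "g = (\<lambda>k. (if k < K then real (Suc k) powr (\<alpha> - 1) else 0))"
  have le: "real (Suc k) powr (\<alpha> - 1) * e k \<le> g k + u powr (2 - 2 * \<alpha>) * e k" for k
  proof (cases "k < K")
    case True
    have "e k \<le> 1" using u by (simp add: e_def)
    then have "real (Suc k) powr (\<alpha> - 1) * e k \<le> real (Suc k) powr (\<alpha> - 1) * 1" by (intro mult_left_mono) auto
    moreover have "0 \<le> u powr (2 - 2 * \<alpha>) * e k" by (simp add: e_def)
    moreover have "g k = real (Suc k) powr (\<alpha> - 1)" using True by (simp add: g_def)
    ultimately show ?thesis by linarith
  next
    case False
    then have "u powr (-2) \<le> real (Suc k)" unfolding K_def by linarith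
    then have "real (Suc k) powr (\<alpha> - 1) \<le> (u powr (-2)) powr (\<alpha> - 1)"
      using u \<alpha> by (intro powr_mono2') auto
    also have "\<dots> = u powr (2 - 2 * \<alpha>)" by (simp add: powr_powr algebra_simps)
    finally have "real (Suc k) powr (\<alpha> - 1) * e k \<le> u powr (2 - 2 * \<alpha>) * e k"
      by (intro mult_right_mono) (auto simp: e_def)
    then show ?thesis using False by (simp add: g_def)
  qed
  note E = exp_sqrt_sum[OF u, folded e_def]
  have sg: "summable g" by (rule summable_finite[of "{..<K}"]) (auto simp: g_def)
  have s2: "summable (\<lambda>k. g k + u powr (2 - 2 * \<alpha>) * e k)"
    by (intro summable_add summable_mult sg) (use E(1) in \<open>simp add: e_def\<close>)
  have se: "summable e" using E(1) by (simp add: e_def)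
  have s: "summable (\<lambda>k. real (Suc k) powr (\<alpha> - 1) * e k)"
    by (rule summable_comparison_test'[OF s2]) (use le in \<open>simp add: e_def\<close>)
  then show "summable (\<lambda>k. real (Suc k) powr (\<alpha> - 1) * exp (- u * sqrt (real (Suc k))))"
    by (simp only: e_def)
  have "(\<Sum>k. real (Suc k) powr (\<alpha> - 1) * e k) \<le> (\<Sum>k. g k + u powr (2 - 2 * \<alpha>) * e k)"
    by (rule suminf_le[OF le s s2])
  also have "\<dots> = suminf g + u powr (2 - 2 * \<alpha>) * suminf e"
    using suminf_add[OF sg summable_mult[OF se]] suminf_mult[OF se] by metis
  also have "suminf g = (\<Sum>k<K. g k)" by (rule suminf_finite) (auto simp: g_def)
  also have "\<dots> = (\<Sum>k<K. real (Suc k) powr (\<alpha> - 1))" by (simp add: g_def)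
  also have "\<dots> \<le> real K powr \<alpha> / \<alpha>" by (rule sum_powr_le[OF \<alpha>])
  also have "\<dots> \<le> (u powr (-2)) powr \<alpha> / \<alpha>"
    using \<alpha> by (intro divide_right_mono powr_mono2) (auto simp: K_def)
  also have "(u powr (-2)) powr \<alpha> / \<alpha> = 1 / \<alpha> * u powr (- 2 * \<alpha>)" by (simp add: powr_powr)
  also have "u powr (2 - 2 * \<alpha>) * suminf e \<le> u powr (2 - 2 * \<alpha>) * (2 / u\<^sup>2)"
    using E(2) by (intro mult_left_mono) (auto simp: e_def)
  also have "u powr (2 - 2 * \<alpha>) * (2 / u\<^sup>2) = 2 * u powr (- 2 * \<alpha>)"
  proof -
    have "u powr (2 - 2 * \<alpha>) = u\<^sup>2 * u powr (- 2 * \<alpha>)"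
      using u powr_add[of u 2 "- 2 * \<alpha>"] by (simp add: powr_numeral)
    then show ?thesis using u by simp
  qed
  finally show "(\<Sum>k. real (Suc k) powr (\<alpha> - 1) * exp (- u * sqrt (real (Suc k)))) \<le> (1 / \<alpha> + 2) * u powr (- 2 * \<alpha>)"
    by (simp add: e_def distrib_right)
qed

definition gmean :: "nat \<Rightarrow> nat \<Rightarrow> real" where "gmean k l = sqrt (real (Suc k * Suc l))"

text \<open>The absolute value of the term k powr \<alpha> sqrt (k l) exp (4 pi i sqrt (k l) T) when
  c = 4 pi Im T, with indices shifted by one.\<close>

definition damped :: "real \<Rightarrow> real \<Rightarrow> nat \<Rightarrow> nat \<Rightarrow> real" where
  "damped \<alpha> c k l = real (Suc k) powr \<alpha> * gmean k l * exp (- c * gmean k l)"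

definition damped_sum :: "real \<Rightarrow> real \<Rightarrow> real" where "damped_sum \<alpha> c = (\<Sum>k. \<Sum>l. damped \<alpha> c k l)"

lemma gmean_ge_1: "gmean k l \<ge> 1"
proof -
  have "real 1 \<le> real (Suc k * Suc l)" by (rule of_nat_mono) simp
  then have "sqrt (real 1) \<le> sqrt (real (Suc k * Suc l))" by (rule real_sqrt_le_mono)
  then show ?thesis unfolding gmean_def by (simp only: of_nat_1 real_sqrt_one)
qed

lemma damped_nonneg: "damped \<alpha> c k l \<ge> 0"
  using gmean_ge_1[of k l] by (simp add: damped_def)

text \<open>As sqrt (k l) \<ge> (sqrt k + sqrt (k l)) / 2, half of the damping is kept for k alone.
  The sum over l then costs a factor of order (c sqrt k) powr (-3), which leaves k powr (\<alpha> -
  1) exp (- c sqrt k / 2) for the sum over k.\<close>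

lemma damped_sum_summable:
  fixes \<alpha> c :: real
  assumes \<alpha>: "0 < \<alpha>" "\<alpha> < 1" and c: "c > 0"
  shows "summable (\<lambda>l. damped \<alpha> c k l)" and "summable (\<lambda>k. \<Sum>l. damped \<alpha> c k l)"
    and "damped_sum \<alpha> c \<le> 128 * (1 / \<alpha> + 2) * 2 powr (2 * \<alpha>) * c powr (- 3 - 2 * \<alpha>)"
proof -
  define A where "A = (\<lambda>k. 128 / c ^ 3 * (real (Suc k) powr (\<alpha> - 1) * exp (- (c / 2) * sqrt (real (Suc k)))))"
  have inner: "summable (\<lambda>l. damped \<alpha> c k l) \<and> (\<Sum>l. damped \<alpha> c k l) \<le> A k" for k
  proof -
    define a where "a = sqrt (real (Suc k))"
    have a: "a > 0" by (simp add: a_def)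
    define v where "v = c * a / 2"
    have v: "v > 0" using c a by (simp add: v_def)
    note S = sqrt_exp_sqrt_sum[OF v]
    define q where "q = real (Suc k) powr \<alpha> * a * exp (- v)"
    have q: "q \<ge> 0" using a by (simp add: q_def)
    have le: "damped \<alpha> c k l \<le> q * (sqrt (real (Suc l)) * exp (- v * sqrt (real (Suc l))))" for l
    proof -
      define b where "b = sqrt (real (Suc l))"
      have b: "b \<ge> 1" by (simp add: b_def)
      have r: "gmean k l = a * b" unfolding gmean_def a_def b_def of_nat_mult by (rule real_sqrt_mult)
      have "c * (a * b) = v * b + v * b" by (simp add: v_def)
      also have "\<dots> \<ge> v + v * b" using v b by simp
      finally have "exp (- c * (a * b)) \<le> exp (- v) * exp (- v * b)"
        unfolding exp_add [symmetric] by simp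
      then have "real (Suc k) powr \<alpha> * (a * b) * exp (- c * (a * b)) \<le> real (Suc k) powr \<alpha> * (a * b) * (exp (- v) * exp (- v * b))"
        using a b by (intro mult_left_mono) auto
      also have "\<dots> = q * (b * exp (- v * b))" unfolding q_def by (simp only: mult_ac)
      finally show ?thesis unfolding damped_def r b_def .
    qed
    have s2: "summable (\<lambda>l. q * (sqrt (real (Suc l)) * exp (- v * sqrt (real (Suc l)))))"
      by (intro summable_mult S(1))
    have s: "summable (\<lambda>l. damped \<alpha> c k l)"
      by (rule summable_comparison_test'[OF s2]) (use le damped_nonneg in simp)
    have "(\<Sum>l. damped \<alpha> c k l) \<le> (\<Sum>l. q * (sqrt (real (Suc l)) * exp (- v * sqrt (real (Suc l)))))"
      by (rule suminf_le[OF le s s2])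
    also have "\<dots> = q * (\<Sum>l. sqrt (real (Suc l)) * exp (- v * sqrt (real (Suc l))))" by (rule suminf_mult[OF S(1)])
    also have "\<dots> \<le> q * (16 / v ^ 3)" by (intro mult_left_mono S(2) q)
    also have "\<dots> = A k"
    proof -
      have "real (Suc k) powr (\<alpha> - 1) = real (Suc k) powr \<alpha> / (a * a)"
        by (simp add: a_def powr_diff del: of_nat_Suc)
      moreover have "16 / v ^ 3 = 128 / c ^ 3 * (1 / (a * a * a))"
        using c a by (simp add: v_def power_mult_distrib power_divide power3_eq_cube field_simps)
      moreover have "P * a * E * (C * (1 / (a * a * a))) = C * (P / (a * a) * E)" for P E C :: real
        using a by (simp add: field_simps)
      moreover have "- v = - (c / 2) * a" by (simp add: v_def)
      ultimately show ?thesis unfolding q_def A_def a_def [symmetric] by (simp only:)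
    qed
    finally show ?thesis using s by simp
  qed
  have c2: "c / 2 > 0" using c by simp
  note P = powr_exp_sqrt_sum[OF \<alpha> c2]
  have sA: "summable A" unfolding A_def by (intro summable_mult P(1))
  show s1: "summable (\<lambda>l. damped \<alpha> c k l)" for k using inner by blast
  have nn: "0 \<le> (\<Sum>l. damped \<alpha> c k l)" for k by (rule suminf_nonneg[OF s1 damped_nonneg])
  show s2: "summable (\<lambda>k. \<Sum>l. damped \<alpha> c k l)"
    by (rule summable_comparison_test'[OF sA]) (use inner nn in simp)
  have "damped_sum \<alpha> c \<le> suminf A" unfolding damped_sum_def by (rule suminf_le[OF _ s2 sA]) (use inner in blast)
  also have "\<dots> = 128 / c ^ 3 * (\<Sum>k. real (Suc k) powr (\<alpha> - 1) * exp (- (c / 2) * sqrt (real (Suc k))))"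
    unfolding A_def by (rule suminf_mult[OF P(1)])
  also have "\<dots> \<le> 128 / c ^ 3 * ((1 / \<alpha> + 2) * (c / 2) powr (- 2 * \<alpha>))"
    using c by (intro mult_left_mono P(2)) auto
  also have "\<dots> = 128 * (1 / \<alpha> + 2) * 2 powr (2 * \<alpha>) * c powr (- 3 - 2 * \<alpha>)"
  proof -
    have "(c / 2) powr (- 2 * \<alpha>) = c powr (- 2 * \<alpha>) * 2 powr (2 * \<alpha>)"
      using c powr_divide[of c 2 "- 2 * \<alpha>"] powr_minus_divide[of 2 "2 * \<alpha>"] by simp
    moreover have "c powr (- 3 - 2 * \<alpha>) = c powr (- 2 * \<alpha>) / c ^ 3"
    proof -
      have "c powr (- 3 - 2 * \<alpha>) = c powr (- 2 * \<alpha> - 3)" by (rule arg_cong) simp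
      also have "\<dots> = c powr (- 2 * \<alpha>) / c powr 3" by (rule powr_diff)
      finally show ?thesis using c by (simp add: powr_numeral)
    qed
    moreover have "128 / C * (x * (y * z)) = 128 * x * z * (y / C)" for C x y z :: real by simp
    ultimately show ?thesis by (simp only:)
  qed
  finally show "damped_sum \<alpha> c \<le> 128 * (1 / \<alpha> + 2) * 2 powr (2 * \<alpha>) * c powr (- 3 - 2 * \<alpha>)" .
qed

text \<open>The terms with l = 1 and k between M and 2 M suffice: there are M of them, the damping
  exponent is at most 4 pi, and each is at least exp (- 4 pi) M powr (1/2 + \<alpha>).\<close>

lemma damped_sum_lower:
  fixes \<alpha> :: real and M :: nat
  assumes \<alpha>: "0 < \<alpha>" "\<alpha> < 1" and M: "M > 0"
  shows "damped_sum \<alpha> (4 * pi / sqrt (2 * M)) \<ge> exp (- 4 * pi) * real M powr (3 / 2 + \<alpha>)"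
proof -
  define c where "c = 4 * pi / sqrt (2 * M)"
  have c: "c > 0" using M by (simp add: c_def)
  note S = damped_sum_summable[OF \<alpha> c]
  have nn: "0 \<le> (\<Sum>l. damped \<alpha> c k l)" for k by (rule suminf_nonneg[OF S(1) damped_nonneg])
  have "real M * (real M powr (1 / 2 + \<alpha>) * exp (- 4 * pi)) = (\<Sum>k\<in>{M..<2 * M}. real M powr (1 / 2 + \<alpha>) * exp (- 4 * pi))"
    by simp
  also have "\<dots> \<le> (\<Sum>k\<in>{M..<2 * M}. \<Sum>l. damped \<alpha> c k l)"
  proof (rule sum_mono)
    fix k assume k: "k \<in> {M..<2 * M}"
    define K where "K = real (Suc k)"
    have K: "real M \<le> K" "K \<le> 2 * real M" "K > 0" using k by (auto simp: K_def)
    have "sqrt K \<le> sqrt (2 * M)" using K by simp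
    then have "c * sqrt K \<le> c * sqrt (2 * M)" using c by (intro mult_left_mono) auto
    also have "\<dots> = 4 * pi" using M by (simp add: c_def)
    finally have e: "exp (- 4 * pi) \<le> exp (- c * sqrt K)" by simp
    have "real M powr (1 / 2 + \<alpha>) \<le> K powr (1 / 2 + \<alpha>)" using K \<alpha> by (intro powr_mono2) auto
    then have "real M powr (1 / 2 + \<alpha>) * exp (- 4 * pi) \<le> K powr (1 / 2 + \<alpha>) * exp (- c * sqrt K)"
      using e by (intro mult_mono) auto
    also have "K powr (1 / 2 + \<alpha>) = K powr \<alpha> * sqrt K"
      using K by (simp add: powr_add powr_half_sqrt)
    also have "K powr \<alpha> * sqrt K * exp (- c * sqrt K) = damped \<alpha> c k 0"
      by (simp add: damped_def gmean_def K_def)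
    also have "\<dots> = (\<Sum>l<1. damped \<alpha> c k l)" by simp
    also have "\<dots> \<le> (\<Sum>l. damped \<alpha> c k l)" by (rule sum_le_suminf[OF S(1)]) (auto simp: damped_nonneg)
    finally show "real M powr (1 / 2 + \<alpha>) * exp (- 4 * pi) \<le> (\<Sum>l. damped \<alpha> c k l)" .
  qed
  also have "\<dots> \<le> damped_sum \<alpha> c"
    unfolding damped_sum_def by (rule sum_le_suminf[OF S(2)]) (auto simp: nn)
  finally have "real M * (real M powr (1 / 2 + \<alpha>) * exp (- 4 * pi)) \<le> damped_sum \<alpha> c" .
  moreover have "real M powr (3 / 2 + \<alpha>) = real M * real M powr (1 / 2 + \<alpha>)"
    using M powr_add[of "real M" 1 "1 / 2 + \<alpha>"] by simp
  ultimately show ?thesis by (simp add: c_def mult_ac)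
qed

text \<open>For k l up to K0 the cosine of the phase is at least 1/2. Beyond K0 half of the damping
  is converted into the factor exp (- 2 pi \<eta> sqrt K0), which leaves the sum at 2 pi \<eta> in
  place of 4 pi \<eta>.\<close>

lemma aligned_sum_lower:
  fixes \<alpha> \<eta> t :: real and K0 :: nat
  assumes \<alpha>: "0 < \<alpha>" "\<alpha> < 1" and \<eta>: "\<eta> > 0"
    and cs: "\<And>n. n < K0 \<Longrightarrow> cos (4 * pi * sqrt (real (Suc n)) * t) \<ge> 1 / 2"
  defines "F \<equiv> \<lambda>k l. of_real (real (Suc k) powr \<alpha> * gmean k l) * exp (4 * pi * \<i> * of_real (gmean k l) * Complex t \<eta>)"
  shows "pair_summable F" and "\<And>k l. norm (F k l) = damped \<alpha> (4 * pi * \<eta>) k l"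
    and "Re (pair_sum F) \<ge> damped_sum \<alpha> (4 * pi * \<eta>) / 2 - 3 / 2 * exp (- 2 * pi * \<eta> * sqrt (real K0)) * damped_sum \<alpha> (2 * pi * \<eta>)"
proof -
  have c: "4 * pi * \<eta> > 0" "2 * pi * \<eta> > 0" using \<eta> by simp_all
  note S = damped_sum_summable[OF \<alpha> c(1)] and S2 = damped_sum_summable[OF \<alpha> c(2)]
  have polar: "F k l = of_real (damped \<alpha> (4 * pi * \<eta>) k l) * cis (4 * pi * gmean k l * t)" for k l
  proof -
    have "exp (4 * pi * \<i> * of_real (gmean k l) * Complex t \<eta>) = of_real (exp (- (4 * pi * \<eta>) * gmean k l)) * cis (4 * pi * gmean k l * t)"
      by (simp add: exp_eq_polar complex_eq_iff Re_exp Im_exp mult_ac)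
    then show ?thesis unfolding F_def damped_def of_real_mult by (simp only: mult.assoc)
  qed
  show nF: "norm (F k l) = damped \<alpha> (4 * pi * \<eta>) k l" for k l
    unfolding polar norm_mult norm_of_real norm_cis using damped_nonneg[of \<alpha> "4 * pi * \<eta>" k l] by simp
  show pF: "pair_summable F"
    using S(1,2) by (simp add: pair_summable_def nF)
  note PF = pair_summable_inner[OF pF]
  \<comment> \<open>A single minorant for both ranges. In the tail the cosine may be -1, and the
    weight 3/2 pays for this loss of 1 and for the 1/2 that is credited to every term.\<close>
  define G where "G = (\<lambda>k l. damped \<alpha> (4 * pi * \<eta>) k l / 2 - 3 / 2 * exp (- 2 * pi * \<eta> * sqrt (real K0)) * damped \<alpha> (2 * pi * \<eta>) k l)"
  have le: "G k l \<le> Re (F k l)" for k l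
  proof -
    have ReF: "Re (F k l) = damped \<alpha> (4 * pi * \<eta>) k l * cos (4 * pi * gmean k l * t)" unfolding polar by simp
    show ?thesis
    proof (cases "Suc k * Suc l \<le> K0")
      case True
      have p: "Suc k * Suc l \<ge> 1" by simp
      have n1: "Suc k * Suc l - 1 < K0" using p True by linarith
      have n2: "Suc (Suc k * Suc l - 1) = Suc k * Suc l" using p by linarith
      have "cos (4 * pi * gmean k l * t) \<ge> 1 / 2"
        using cs[OF n1] unfolding n2 gmean_def .
      then have "damped \<alpha> (4 * pi * \<eta>) k l * cos (4 * pi * gmean k l * t) \<ge> damped \<alpha> (4 * pi * \<eta>) k l * (1 / 2)"
        by (intro mult_left_mono damped_nonneg)
      moreover have "0 \<le> 3 / 2 * exp (- 2 * pi * \<eta> * sqrt (real K0)) * damped \<alpha> (2 * pi * \<eta>) k l"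
        by (intro mult_nonneg_nonneg damped_nonneg) auto
      ultimately show ?thesis unfolding ReF G_def by linarith
    next
      case False
      then have "real K0 \<le> real (Suc k * Suc l)" by (intro of_nat_mono) simp
      then have "sqrt (real K0) \<le> gmean k l" unfolding gmean_def by simp
      then have "2 * pi * \<eta> * sqrt (real K0) \<le> 2 * pi * \<eta> * gmean k l" using c by (intro mult_left_mono) auto
      then have "exp (- (4 * pi * \<eta>) * gmean k l) \<le> exp (- 2 * pi * \<eta> * sqrt (real K0)) * exp (- (2 * pi * \<eta>) * gmean k l)"
        unfolding exp_add [symmetric] by simp
      then have "real (Suc k) powr \<alpha> * gmean k l * exp (- (4 * pi * \<eta>) * gmean k l) \<le>
         real (Suc k) powr \<alpha> * gmean k l * (exp (- 2 * pi * \<eta> * sqrt (real K0)) * exp (- (2 * pi * \<eta>) * gmean k l))"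
        using gmean_ge_1[of k l] by (intro mult_left_mono) auto
      also have "\<dots> = exp (- 2 * pi * \<eta> * sqrt (real K0)) * (real (Suc k) powr \<alpha> * gmean k l * exp (- (2 * pi * \<eta>) * gmean k l))"
        by (simp only: mult_ac)
      finally have X: "damped \<alpha> (4 * pi * \<eta>) k l \<le> exp (- 2 * pi * \<eta> * sqrt (real K0)) * damped \<alpha> (2 * pi * \<eta>) k l"
        unfolding damped_def .
      have "damped \<alpha> (4 * pi * \<eta>) k l * cos (4 * pi * gmean k l * t) \<ge> damped \<alpha> (4 * pi * \<eta>) k l * (- 1)"
        by (intro mult_left_mono damped_nonneg) simp
      with X show ?thesis unfolding ReF G_def by (simp add: algebra_simps)
    qed
  qed
  define K where "K = 3 / 2 * exp (- 2 * pi * \<eta> * sqrt (real K0))"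
  have sG1: "summable (\<lambda>l. G k l)" for k
    unfolding G_def by (intro summable_diff summable_divide summable_mult S(1) S2(1))
  have vG1: "(\<Sum>l. G k l) = (\<Sum>l. damped \<alpha> (4 * pi * \<eta>) k l) / 2 - K * (\<Sum>l. damped \<alpha> (2 * pi * \<eta>) k l)" for k
    unfolding G_def K_def [symmetric]
    by (subst suminf_diff[symmetric]) (auto intro!: summable_divide summable_mult S(1) S2(1)
        simp: suminf_divide[OF S(1)] suminf_mult[OF S2(1)])
  have sG2: "summable (\<lambda>k. \<Sum>l. G k l)"
    unfolding vG1 by (intro summable_diff summable_divide summable_mult S(2) S2(2))
  have vG2: "(\<Sum>k. \<Sum>l. G k l) = damped_sum \<alpha> (4 * pi * \<eta>) / 2 - K * damped_sum \<alpha> (2 * pi * \<eta>)"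
    unfolding vG1 damped_sum_def
    by (subst suminf_diff[symmetric]) (auto intro!: summable_divide summable_mult S(2) S2(2)
        simp: suminf_divide[OF S(2)] suminf_mult[OF S2(2)])
  have "(\<Sum>k. \<Sum>l. G k l) \<le> (\<Sum>k. \<Sum>l. Re (F k l))"
  proof (rule suminf_le[OF _ sG2])
    show "(\<Sum>l. G k l) \<le> (\<Sum>l. Re (F k l))" for k
      by (rule suminf_le[OF le sG1 summable_Re[OF PF(1)]])
    have "summable (\<lambda>k. Re (\<Sum>l. F k l))" by (rule summable_Re[OF PF(2)])
    then show "summable (\<lambda>k. \<Sum>l. Re (F k l))" using Re_suminf[OF PF(1)] by simp
  qed
  also have "\<dots> = Re (pair_sum F)"
    unfolding pair_sum_def using Re_suminf[OF PF(1)] Re_suminf[OF PF(2)] by simp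
  finally show "Re (pair_sum F) \<ge> damped_sum \<alpha> (4 * pi * \<eta>) / 2 - 3 / 2 * exp (- 2 * pi * \<eta> * sqrt (real K0)) * damped_sum \<alpha> (2 * pi * \<eta>)"
    unfolding vG2 K_def .
qed

section \<open>The main term of the oscillating side\<close>

context voronoi
begin

definition Er :: "real \<Rightarrow> complex" where
  "Er r = (1 / 2 - 2 * of_real pi * \<i> * of_real r * T) * exp (4 * of_real pi * \<i> * of_real r * T)
     + (1 / 2 + 2 * of_real pi * of_real r * T) * exp (- (4 * of_real pi * of_real r * T))"

definition wave_term where
  "wave_term k l = of_real (real (Suc k) powr \<alpha> * gmean k l) * exp (4 * pi * \<i> * of_real (gmean k l) * Complex (Re T) (Im T))"

text \<open>The leading part of \<open>Er\<close> is - 2 pi i r T exp (4 pi i r T). The rest of the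
  first product lacks the factor r T. The second exponential has norm exp (- u) with u = 4 pi Re T
  r; half of it absorbs the linear factor, and the other half is below the damping exp (- 4 pi Im T
  r) because Im T \<le> Re T / 2.\<close>

lemma Er_bound:
  assumes T1: "Re T \<ge> 1" "Im T \<le> Re T / 2" and r: "r \<ge> 1"
  shows "norm (Er r + 2 * of_real pi * \<i> * T * (of_real r * exp (4 * of_real pi * \<i> * of_real r * T)))
     \<le> 3 * (r * exp (- (4 * pi * Im T) * r))"
proof -
  define e1 where "e1 = exp (4 * of_real pi * \<i> * of_real r * T)"
  define e2 where "e2 = exp (- (4 * of_real pi * of_real r * T))"
  have n1: "norm e1 = exp (- (4 * pi * Im T) * r)" by (simp add: e1_def norm_exp_eq_Re mult_ac)
  have n2: "norm e2 = exp (- (4 * pi * Re T * r))" by (simp add: e2_def norm_exp_eq_Re mult_ac)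
  have eq: "Er r + 2 * of_real pi * \<i> * T * (of_real r * e1) = e1 / 2 + (1 / 2 + 2 * of_real pi * of_real r * T) * e2"
    unfolding Er_def e1_def [symmetric] e2_def [symmetric] by (simp add: algebra_simps)
  define u where "u = 4 * pi * Re T * r"
  have Tr: "Re T * r \<ge> 1" using mult_mono[of 1 "Re T" 1 r] T1 r by simp
  have nT: "norm T \<le> 2 * Re T"
    using cmod_le[of T] T1 T by simp
  have "norm (1 / 2 + 2 * of_real pi * of_real r * T) \<le> 1 / 2 + 2 * pi * r * norm T"
    using norm_triangle_ineq[of "1 / 2" "2 * of_real pi * of_real r * T"] r by (simp add: norm_mult)
  also have "\<dots> \<le> 1 / 2 + 2 * pi * r * (2 * Re T)" using nT r by (intro add_left_mono mult_left_mono) auto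
  also have "\<dots> = 1 / 2 + u" by (simp add: u_def)
  finally have a: "norm (1 / 2 + 2 * of_real pi * of_real r * T) \<le> 1 / 2 + u" .
  have "1 / 2 + u \<le> 2 * exp (u / 2)"
    using exp_ge_add_one_self[of "u / 2"] by linarith
  then have "(1 / 2 + u) * exp (- u) \<le> 2 * exp (u / 2) * exp (- u)" by (intro mult_right_mono) auto
  also have "\<dots> = 2 * exp (- (u / 2))" by (simp add: mult.assoc flip: exp_add)
  also have "exp (- (u / 2)) \<le> exp (- (4 * pi * Im T) * r)"
  proof -
    have "Im T * r \<le> Re T / 2 * r" using T1 r by (intro mult_right_mono) auto
    then have "4 * pi * (Im T * r) \<le> 4 * pi * (Re T / 2 * r)" by (intro mult_left_mono) auto
    then show ?thesis by (simp add: u_def mult_ac)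
  qed
  finally have b: "(1 / 2 + u) * exp (- u) \<le> 2 * exp (- (4 * pi * Im T) * r)" by simp
  have "norm (e1 / 2 + (1 / 2 + 2 * of_real pi * of_real r * T) * e2) \<le> norm e1 / 2 + norm (1 / 2 + 2 * of_real pi * of_real r * T) * norm e2"
    using norm_triangle_ineq[of "e1 / 2" "(1 / 2 + 2 * of_real pi * of_real r * T) * e2"]
    by (simp add: norm_mult norm_divide)
  also have "\<dots> \<le> norm e1 / 2 + (1 / 2 + u) * norm e2"
    by (intro add_left_mono mult_right_mono a) auto
  also have "norm e2 = exp (- u)" unfolding n2 u_def ..
  also have "norm e1 / 2 + (1 / 2 + u) * exp (- u) \<le> exp (- (4 * pi * Im T) * r) / 2 + 2 * exp (- (4 * pi * Im T) * r)"
    unfolding n1 by (rule add_left_mono[OF b])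
  also have "\<dots> \<le> 3 * exp (- (4 * pi * Im T) * r)" by simp
  also have "\<dots> \<le> 3 * (r * exp (- (4 * pi * Im T) * r))" using r by simp
  finally show ?thesis unfolding e1_def [symmetric] eq .
qed

text \<open>The weight k powr (3/2 + \<alpha>) meets k powr (-3/2) from the Fourier integrals and
  leaves k powr \<alpha>. The remainders of \<open>Er\<close> are collected in R. With the prefactor
  T powr (-3), R is smaller than the main term by a factor of order norm T.\<close>

lemma Osc_eq:
  assumes T1: "Re T \<ge> 1" "Im T \<le> Re T / 2"
  shows "\<exists>R. norm R \<le> 3 * damped_sum \<alpha> (4 * pi * Im T) \<and>
     Osc = of_real (c0 * sqrt pi * (2 * pi) powr (-3/2)) * cis (3 * pi / 4) / T ^ 3 *
        (R - 2 * of_real pi * \<i> * T * pair_sum wave_term)"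
proof -
  define CC where "CC = of_real (c0 * sqrt pi * (2 * pi) powr (-3/2)) * cis (3 * pi / 4) / T ^ 3"
  have \<alpha>1: "0 < \<alpha>" "\<alpha> < 1" using \<alpha> by auto
  have c: "4 * pi * Im T > 0" using T by simp
  note S = damped_sum_summable[OF \<alpha>1 c]
  have cT: "Complex (Re T) (Im T) = T" by simp
  have wave_term: "wave_term k l = of_real (real (Suc k) powr \<alpha>) * (of_real (gmean k l) * exp (4 * of_real pi * \<i> * of_real (gmean k l) * T))" for k l
    unfolding wave_term_def cT by simp
  note AL = aligned_sum_lower[OF \<alpha>1 T(2), of 0 "Re T", folded wave_term_def [abs_def]]
  have sFm: "pair_summable wave_term"
    using AL(1) by (simp add: wave_term_def [abs_def])
  define G where "G = (\<lambda>k l. of_real (real (Suc k) powr \<alpha>) * Er (gmean k l))"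
  define R where "R = (\<lambda>k l. G k l + 2 * of_real pi * \<i> * T * wave_term k l)"
  have nR: "norm (R k l) \<le> 3 * damped \<alpha> (4 * pi * Im T) k l" for k l
  proof -
    have "R k l = of_real (real (Suc k) powr \<alpha>) * (Er (gmean k l) + 2 * of_real pi * \<i> * T * (of_real (gmean k l) * exp (4 * of_real pi * \<i> * of_real (gmean k l) * T)))"
      unfolding R_def G_def wave_term by (simp only: distrib_left mult_ac)
    then have "norm (R k l) \<le> real (Suc k) powr \<alpha> * (3 * (gmean k l * exp (- (4 * pi * Im T) * gmean k l)))"
      unfolding norm_mult[of "of_real (real (Suc k) powr \<alpha>)"]
      using Er_bound[OF T1 gmean_ge_1] by (simp add: norm_mult mult_left_mono)
    then show ?thesis by (simp add: damped_def mult_ac)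
  qed
  have s3: "summable (\<lambda>l. 3 * damped \<alpha> (4 * pi * Im T) k l)" for k by (intro summable_mult S(1))
  have sR1: "summable (\<lambda>l. norm (R k l))" for k
    by (rule summable_comparison_test'[OF s3]) (use nR in simp)
  have leR: "(\<Sum>l. norm (R k l)) \<le> 3 * (\<Sum>l. damped \<alpha> (4 * pi * Im T) k l)" for k
    unfolding suminf_mult[OF S(1), symmetric] by (rule suminf_le[OF nR sR1 s3])
  note PR = pair_summable_innerI[OF sR1 leR summable_mult[OF S(2)]]
  have s2R: "summable (\<lambda>k. \<Sum>l. norm (R k l))" using PR(1) by (simp add: pair_summable_def)
  have bR: "norm (pair_sum R) \<le> 3 * damped_sum \<alpha> (4 * pi * Im T)"
  proof -
    have "(\<Sum>k. \<Sum>l. norm (R k l)) \<le> (\<Sum>k. 3 * (\<Sum>l. damped \<alpha> (4 * pi * Im T) k l))"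
      by (rule suminf_le[OF leR s2R summable_mult[OF S(2)]])
    also have "\<dots> = 3 * damped_sum \<alpha> (4 * pi * Im T)" unfolding damped_sum_def by (rule suminf_mult[OF S(2)])
    finally show ?thesis using PR(2) by simp
  qed
  have Gsum: "G = (\<lambda>k l. R k l + (- (2 * of_real pi * \<i> * T)) * wave_term k l)" by (simp add: R_def fun_eq_iff)
  have sFm': "pair_summable (\<lambda>k l. (- (2 * of_real pi * \<i> * T)) * wave_term k l)"
  proof -
    have "summable (\<lambda>l. norm (2 * of_real pi * \<i> * T) * norm (wave_term k l))" for k
      using sFm by (intro summable_mult) (simp add: pair_summable_def)
    moreover have "(\<Sum>l. norm (2 * of_real pi * \<i> * T) * norm (wave_term k l)) = norm (2 * of_real pi * \<i> * T) * (\<Sum>l. norm (wave_term k l))" for k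
      using sFm by (intro suminf_mult) (simp add: pair_summable_def)
    moreover have "summable (\<lambda>k. norm (2 * of_real pi * \<i> * T) * (\<Sum>l. norm (wave_term k l)))"
      using sFm by (intro summable_mult) (simp add: pair_summable_def)
    moreover have "norm ((- (2 * of_real pi * \<i> * T)) * wave_term k l) = norm (2 * of_real pi * \<i> * T) * norm (wave_term k l)" for k l
      unfolding norm_mult norm_minus_cancel ..
    ultimately show ?thesis unfolding pair_summable_def by (simp only: simp_thms)
  qed
  have pG: "pair_sum G = pair_sum R - 2 * of_real pi * \<i> * T * pair_sum wave_term"
    unfolding Gsum pair_sum_add[OF PR(1) sFm'] pair_sum_cmult[OF sFm] by simp
  have sG: "summable (\<lambda>l. G k l)" for k
    unfolding Gsum by (intro summable_add pair_summable_inner(1)[OF PR(1)] pair_summable_inner(1)[OF sFm'])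
  have sG2: "summable (\<lambda>k. \<Sum>l. G k l)"
  proof -
    have "(\<Sum>l. G k l) = (\<Sum>l. R k l) + (\<Sum>l. (- (2 * of_real pi * \<i> * T)) * wave_term k l)" for k
      unfolding Gsum by (rule suminf_add[OF pair_summable_inner(1)[OF PR(1)] pair_summable_inner(1)[OF sFm'], symmetric])
    then show ?thesis
      using summable_add[OF pair_summable_inner(2)[OF PR(1)] pair_summable_inner(2)[OF sFm']] by simp
  qed
  have osc_term: "of_real (c0 * real (Suc k) powr (3 / 2 + \<alpha>)) * (LBINT x:{0<..}. of_real (bern x) * fB2 (Bk k) x) = CC * (\<Sum>l. G k l)" for k
  proof -
    interpret halfline_C2 "fB (Bk k)" "fB1 (Bk k)" "fB2 (Bk k)" by (rule halfline_C2_fB[OF ReBk_pos])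
    define D where "D = of_real (sqrt pi * (2 * pi * real (Suc k)) powr (-3/2)) * cis (3 * pi / 4) / T ^ 3"
    have "2 * (LBINT x:{0<..}. of_real (cos (2 * pi * real (Suc l) * x)) * fB (Bk k) x) = D * Er (gmean k l)" for l
      unfolding Bk_def fB_fourier(2)[OF T zero_less_Suc[of k]] D_def Er_def gmean_def
      by (simp del: of_nat_Suc mult_Suc mult_Suc_right)
    then have "(\<lambda>l. D * Er (gmean k l)) sums (LBINT x:{0<..}. of_real (bern x) * fB2 (Bk k) x)"
      using poisson by simp
    then have "(\<lambda>l. of_real (c0 * real (Suc k) powr (3 / 2 + \<alpha>)) * (D * Er (gmean k l))) sums
       (of_real (c0 * real (Suc k) powr (3 / 2 + \<alpha>)) * (LBINT x:{0<..}. of_real (bern x) * fB2 (Bk k) x))"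
      by (rule sums_mult)
    moreover have "of_real (c0 * real (Suc k) powr (3 / 2 + \<alpha>)) * (D * Er (gmean k l)) = CC * G k l" for l
    proof -
      have "real (Suc k) powr (3 / 2 + \<alpha>) * real (Suc k) powr (-3/2) = real (Suc k) powr \<alpha>"
        by (simp flip: powr_add del: of_nat_Suc)
      moreover have "c * a * (q * (P * b)) = c * q * P * (a * b)" for c a q P b :: real
        by (simp only: mult_ac)
      ultimately have "c0 * real (Suc k) powr (3 / 2 + \<alpha>) * (sqrt pi * (2 * pi * real (Suc k)) powr (-3/2))
         = c0 * sqrt pi * (2 * pi) powr (-3/2) * real (Suc k) powr \<alpha>"
        unfolding powr_mult[of "2 * pi"] by (simp only:)
      then have e: "complex_of_real (c0 * real (Suc k) powr (3 / 2 + \<alpha>)) * of_real (sqrt pi * (2 * pi * real (Suc k)) powr (-3/2))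
         = of_real (c0 * sqrt pi * (2 * pi) powr (-3/2)) * of_real (real (Suc k) powr \<alpha>)"
        by (metis of_real_mult)
      have g: "a * (b * z / t * E) = (a * b) * z / t * E" "a' * z / t * (b' * E) = (a' * b') * z / t * E" for a b z t E a' b' :: complex
        by simp_all
      show ?thesis unfolding D_def CC_def G_def g e ..
    qed
    ultimately have "(\<lambda>l. CC * G k l) sums (of_real (c0 * real (Suc k) powr (3 / 2 + \<alpha>)) * (LBINT x:{0<..}. of_real (bern x) * fB2 (Bk k) x))"
      by (simp only:)
    moreover have "(\<lambda>l. CC * G k l) sums (CC * (\<Sum>l. G k l))" by (intro sums_mult summable_sums sG)
    ultimately show ?thesis by (rule sums_unique2)
  qed
  have "Osc = CC * pair_sum G"
    unfolding Osc_def osc_term pair_sum_def by (rule suminf_mult[OF sG2])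
  then show ?thesis
    using bR unfolding pG CC_def by blast
qed

end

section \<open>Choice of the time t and of the length of the sum\<close>

lemma Dirichlet_aligned_time:
  fixes K :: nat
  obtains t :: real where "exp (real K) \<le> t" "ln t \<le> 3 * real K"
    "\<And>n. n < K \<Longrightarrow> cos (4 * pi * sqrt (real (Suc n)) * t) \<ge> 1 / 2"
proof -
  \<comment> \<open>The frequencies carry the factor exp K, so that t = q exp K is large even if q
    is small. The denominator 7 brings every phase within 2 pi / 7 < pi / 3 of a multiple of 2 pi,
    where the cosine is at least 1/2, and 7 \<le> exp 2 gives ln t \<le> 3 K.\<close>
  define \<theta> where "\<theta> = (\<lambda>i. 2 * sqrt (real (Suc i)) * exp (real K))"
  obtain q p where q: "0 < q" "q \<le> int (7 ^ K)"
    and qp: "\<And>i. i < K \<Longrightarrow> \<bar>of_int q * \<theta> i - of_int (p i)\<bar> < 1 / real 7"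
    using Dirichlet_approx_simult[of 7 K \<theta>] by auto
  show thesis
  proof (rule that[of "of_int q * exp (real K)"])
    show "exp (real K) \<le> of_int q * exp (real K)" using q by simp
    have "real_of_int q \<le> real_of_int (int (7 ^ K))" using q(2) by (simp only: of_int_le_iff)
    then have "real_of_int q \<le> 7 ^ K" by simp
    also have "(7 :: real) \<le> exp 2"
    proof -
      have "(27 / 10 :: real)\<^sup>2 \<le> (exp 1)\<^sup>2" using e_approx_32 by (intro power_mono) (auto simp: abs_if split: if_splits)
      then show ?thesis by (simp add: power2_eq_square flip: exp_add)
    qed
    then have "(7 :: real) ^ K \<le> exp 2 ^ K" by (intro power_mono) auto
    also have "exp 2 ^ K = exp (2 * real K)" by (simp add: exp_of_nat_mult mult.commute flip: exp_of_nat_mult)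
    finally have "of_int q * exp (real K) \<le> exp (2 * real K) * exp (real K)" by (intro mult_right_mono) auto
    also have "\<dots> = exp (3 * real K)" by (simp flip: exp_add)
    finally have "ln (of_int q * exp (real K)) \<le> ln (exp (3 * real K))"
      using q by (intro ln_mono) auto
    then show "ln (of_int q * exp (real K)) \<le> 3 * real K" by simp
  next
    fix n assume n: "n < K"
    define u where "u = of_int q * \<theta> n - of_int (p n)"
    have u: "\<bar>u\<bar> < 1 / 7" using qp[OF n] by (simp add: u_def)
    have "4 * pi * sqrt (real (Suc n)) * (of_int q * exp (real K)) = 2 * pi * u + 2 * pi * of_int (p n)"
      by (simp add: u_def \<theta>_def algebra_simps)
    then have "cos (4 * pi * sqrt (real (Suc n)) * (of_int q * exp (real K))) = cos (2 * pi * u)"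
      by (simp add: cos_add)
    also have "\<dots> = cos \<bar>2 * pi * u\<bar>" by simp
    also have "\<dots> \<ge> cos (pi / 3)"
    proof (rule cos_monotone_0_pi_le)
      have "\<bar>2 * pi * u\<bar> = 2 * pi * \<bar>u\<bar>" by (simp add: abs_mult)
      also have "\<dots> \<le> 2 * pi * (1 / 7)" using u by (intro mult_left_mono) auto
      also have "\<dots> \<le> pi / 3" by simp
      finally show "\<bar>2 * pi * u\<bar> \<le> pi / 3" .
    qed auto
    finally show "cos (4 * pi * sqrt (real (Suc n)) * (of_int q * exp (real K))) \<ge> 1 / 2"
      by (simp add: cos_60)
  qed
qed

lemma damped_sum_nonneg:
  assumes "0 < \<alpha>" "\<alpha> < 1" "c > 0"
  shows "damped_sum \<alpha> c \<ge> 0"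
  unfolding damped_sum_def by (intro suminf_nonneg damped_sum_summable damped_nonneg assms)

text \<open>For \<eta> = 1 / sqrt (2 M) the upper bound at 2 pi \<eta> and the lower bound at 4 pi
  \<eta> are both of order M powr (3/2 + \<alpha>). The cutoff 2 n^2 M turns the tail factor into
  exp (- 2 pi n), so a single n serves all M.\<close>

lemma damped_sum_tail_small:
  fixes \<alpha> :: real
  assumes \<alpha>: "0 < \<alpha>" "\<alpha> < 1"
  obtains n :: nat where "n > 0"
    "\<And>M :: nat. M > 0 \<Longrightarrow> 3 / 2 * exp (- 2 * pi * (1 / sqrt (2 * real M)) * sqrt (real (n\<^sup>2 * (2 * M)))) * damped_sum \<alpha> (2 * pi * (1 / sqrt (2 * real M)))
       \<le> damped_sum \<alpha> (4 * pi * (1 / sqrt (2 * real M))) / 4"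
proof -
  define Cu where "Cu = 128 * (1 / \<alpha> + 2) * 2 powr (2 * \<alpha>) * ((2 * pi) powr (- 3 - 2 * \<alpha>) * 2 powr (3 / 2 + \<alpha>))"
  have Cu: "Cu > 0" using \<alpha> by (simp add: Cu_def add_pos_pos)
  have "((\<lambda>x::real. exp (- 2 * pi * x)) \<longlongrightarrow> 0) at_top"
    by real_asymp
  then have "((\<lambda>n. exp (- 2 * pi * real n)) \<longlongrightarrow> 0) sequentially"
    by (rule filterlim_compose[OF _ filterlim_real_sequentially])
  \<comment> \<open>The 6 is chosen to match the weight 3/2 of the tail: 3/2 times 1/6 is the
    required quarter.\<close>
  then have "eventually (\<lambda>n. exp (- 2 * pi * real n) < exp (- 4 * pi) / (6 * Cu)) sequentially"
    using Cu by (intro order_tendstoD) auto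
  then have "eventually (\<lambda>n. exp (- 2 * pi * real n) < exp (- 4 * pi) / (6 * Cu) \<and> n > 0) sequentially"
    by (intro eventually_conj eventually_gt_at_top)
  then obtain n :: nat where n: "exp (- 2 * pi * real n) < exp (- 4 * pi) / (6 * Cu)" "n > 0"
    by (auto dest: eventually_happens)
  show thesis
  proof (rule that[OF n(2)])
    fix M :: nat assume M: "M > 0"
    define \<eta> where "\<eta> = 1 / sqrt (2 * real M)"
    have \<eta>: "\<eta> > 0" using M by (simp add: \<eta>_def)
    have \<eta>p: "\<eta> = (2 * real M) powr (- (1 / 2))"
      unfolding \<eta>_def powr_minus_divide by (simp only: powr_half_sqrt of_nat_0_le_iff zero_le_numeral mult_nonneg_nonneg)
    have e: "- 2 * pi * \<eta> * sqrt (real (n\<^sup>2 * (2 * M))) = - 2 * pi * real n"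
      using M by (simp add: \<eta>_def real_sqrt_mult)
    have "damped_sum \<alpha> (2 * pi * \<eta>) \<le> 128 * (1 / \<alpha> + 2) * 2 powr (2 * \<alpha>) * (2 * pi * \<eta>) powr (- 3 - 2 * \<alpha>)"
      using \<eta> by (intro damped_sum_summable(3) \<alpha>) simp
    also have "(2 * pi * \<eta>) powr (- 3 - 2 * \<alpha>) = (2 * pi) powr (- 3 - 2 * \<alpha>) * (2 powr (3 / 2 + \<alpha>) * real M powr (3 / 2 + \<alpha>))"
    proof -
      have x: "- (1 / 2) * (- 3 - 2 * \<alpha>) = 3 / 2 + \<alpha>" by (simp add: field_simps)
      have "\<eta> powr (- 3 - 2 * \<alpha>) = (2 * real M) powr (3 / 2 + \<alpha>)" unfolding \<eta>p powr_powr x ..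
      then show ?thesis by (simp only: powr_mult[of "2 * pi" \<eta>] powr_mult[of 2 "real M"])
    qed
    finally have up: "damped_sum \<alpha> (2 * pi * \<eta>) \<le> Cu * real M powr (3 / 2 + \<alpha>)"
      unfolding Cu_def by (simp only: mult.assoc)
    have lo: "exp (- 4 * pi) * real M powr (3 / 2 + \<alpha>) \<le> damped_sum \<alpha> (4 * pi * \<eta>)"
      using damped_sum_lower[OF \<alpha> M] by (simp add: \<eta>_def)
    have "3 / 2 * exp (- 2 * pi * real n) * damped_sum \<alpha> (2 * pi * \<eta>)
        \<le> 3 / 2 * (exp (- 4 * pi) / (6 * Cu)) * (Cu * real M powr (3 / 2 + \<alpha>))"
      using n(1) Cu \<eta> by (intro mult_mono up mult_nonneg_nonneg damped_sum_nonneg \<alpha>) auto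
    also have "\<dots> = exp (- 4 * pi) * real M powr (3 / 2 + \<alpha>) / 4" using Cu by (simp add: field_simps)
    also have "\<dots> \<le> damped_sum \<alpha> (4 * pi * \<eta>) / 4" using lo by simp
    finally show "3 / 2 * exp (- 2 * pi * (1 / sqrt (2 * real M)) * sqrt (real (n\<^sup>2 * (2 * M)))) * damped_sum \<alpha> (2 * pi * (1 / sqrt (2 * real M)))
       \<le> damped_sum \<alpha> (4 * pi * (1 / sqrt (2 * real M))) / 4"
      unfolding \<eta>_def [symmetric] e .
  qed
qed

text \<open>The constants of the bounds for \<open>Vm\<close>, \<open>Jm\<close>, \<open>Jp\<close>,
  \<open>h 0\<close> and \<open>H1\<close>, combined as these terms occur in the formula for
  \<open>Osc\<close>. It is free of T, which is what makes the remainder uniform in t.\<close>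

definition minor_const :: "real \<Rightarrow> complex \<Rightarrow> real \<Rightarrow> real \<Rightarrow> real" where
  "minor_const \<alpha> L A B =
     (\<Sum>d. real (Suc d) powr (-5/4)) * (\<Sum>m. real (Suc m) powr (-5/4 - \<alpha>))
     + \<bar>\<Sum>m. real (Suc m) powr (- 1 - \<alpha>)\<bar> * ((LBINT y:{0<..}. (if y < 1 then y powr \<alpha> else y powr (-5/4)))
         + Gamma (1 + \<alpha>) * Gamma (3 / 2) / Gamma (5 / 2 + \<alpha>))
     + norm L + \<bar>A * (1 + \<alpha>)\<bar> * (Gamma (1 + \<alpha>) * Gamma (3 / 2) / Gamma (5 / 2 + \<alpha>))
     + \<bar>B\<bar> / (5 / 2 + \<alpha> - 1)"

context voronoi
begin

text \<open>The Voronoi formula is solved for \<open>Osc\<close>, and \<open>Vp\<close> is replaced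
  by the integral of the error plus its smooth terms. Everything except this integral is bounded
  termwise by a multiple of norm w powr (-5/4).\<close>

lemma Osc_upper:
  fixes A B :: real
  assumes L: "tau_powr \<longlonglongrightarrow> L" and w1: "Re w \<ge> 0" "norm w \<ge> 1"
  shows "norm Osc \<le> norm (LBINT x:{0<..}. of_real (Dsum x - (A * x powr (1 + \<alpha>) + B * x)) * kd x)
     + minor_const \<alpha> L A B * norm w powr (-5/4)"
proof -
  define I where "I = (LBINT x:{0<..}. of_real (Dsum x - (A * x powr (1 + \<alpha>) + B * x)) * kd x)"
  define W where "W = norm w powr (-5/4)"
  have abstract_ident: "O' = i + vm - z * j + hl + a * jp + b * h1"
    if "hl = O' - (vm + vp - z * j)" "i = vp - a * jp - b * h1" for O' vm vp z j hl i a jp b h1 :: complex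
    using that by simp
  have "h 0 * L = Osc - (Vm + Vp - of_real Zc * (Jm + Jp))"
    by (rule LIMSEQ_unique[OF tendsto_mult_left[OF L] tau_powr_tendsto])
  moreover have "I = Vp - of_real (A * (1 + \<alpha>)) * Jp - of_real B * H1"
    unfolding I_def by (rule error_integral(2))
  ultimately have "Osc = I + Vm - of_real Zc * (Jm + Jp) + h 0 * L + of_real (A * (1 + \<alpha>)) * Jp + of_real B * H1"
    by (rule abstract_ident)
  then have "norm Osc = norm (I + Vm - of_real Zc * (Jm + Jp) + h 0 * L + of_real (A * (1 + \<alpha>)) * Jp + of_real B * H1)"
    by (simp only:)
  also have "\<dots> \<le> norm I + norm Vm + \<bar>Zc\<bar> * (norm Jm + norm Jp) + norm (h 0) * norm L + \<bar>A * (1 + \<alpha>)\<bar> * norm Jp + \<bar>B\<bar> * norm H1"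
  proof -
    have Z: "norm (of_real Zc * (Jm + Jp)) \<le> \<bar>Zc\<bar> * (norm Jm + norm Jp)"
      unfolding norm_mult norm_of_real by (intro mult_left_mono norm_triangle_ineq) auto
    have eqs: "norm (h 0 * L) = norm (h 0) * norm L" "norm (of_real (A * (1 + \<alpha>)) * Jp) = \<bar>A * (1 + \<alpha>)\<bar> * norm Jp"
      "norm (of_real B * H1) = \<bar>B\<bar> * norm H1"
      by (simp_all only: norm_mult norm_of_real)
    have tri: "norm (a + b - c + d + e + f) \<le> norm a + norm b + c' + norm d + norm e + norm f"
      if "norm c \<le> c'" for a b c d e f :: complex and c'
      by (intro norm_triangle_le add_mono norm_triangle_le_diff that order_refl)
    show ?thesis unfolding eqs(1-3)[symmetric] by (rule tri[OF Z])
  qed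
  also have "\<dots> \<le> norm I + (\<Sum>d. real (Suc d) powr (-5/4)) * (\<Sum>m. real (Suc m) powr (-5/4 - \<alpha>)) * W
     + \<bar>Zc\<bar> * ((LBINT y:{0<..}. (if y < 1 then y powr \<alpha> else y powr (-5/4))) * W + Gamma (1 + \<alpha>) * Gamma (3 / 2) / Gamma s * W)
     + W * norm L + \<bar>A * (1 + \<alpha>)\<bar> * (Gamma (1 + \<alpha>) * Gamma (3 / 2) / Gamma s * W) + \<bar>B\<bar> * (W / (s - 1))"
  proof -
    note mb = minor_bounds[OF w1, folded W_def]
    have "norm H1 \<le> W / (s - 1)"
      unfolding norm_H1 W_def using w1 \<alpha> by (intro divide_right_mono powr_mono) auto
    then show ?thesis by (intro add_mono mult_left_mono mult_right_mono mb order_refl) auto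
  qed
  also have "\<dots> = norm I + minor_const \<alpha> L A B * W"
    unfolding minor_const_def Zc_def by (simp only: distrib_left distrib_right mult_ac times_divide_eq_right add_ac)
  finally show ?thesis unfolding I_def W_def .
qed

lemma Osc_lower:
  assumes T1: "Re T \<ge> 6" "Im T \<le> Re T / 2"
    and cs: "\<And>n. n < K0 \<Longrightarrow> cos (4 * pi * sqrt (real (Suc n)) * Re T) \<ge> 1 / 2"
    and tail: "3 / 2 * exp (- 2 * pi * Im T * sqrt (real K0)) * damped_sum \<alpha> (2 * pi * Im T) \<le> damped_sum \<alpha> (4 * pi * Im T) / 4"
  shows "norm Osc \<ge> c0 * sqrt pi * (2 * pi) powr (-3/2) * damped_sum \<alpha> (4 * pi * Im T) / norm T ^ 2"
proof -
  define P where "P = damped_sum \<alpha> (4 * pi * Im T)"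
  define C1 where "C1 = c0 * sqrt pi * (2 * pi) powr (-3/2)"
  define S where "S = pair_sum wave_term"
  have C1: "C1 > 0" using c0_pos by (simp add: C1_def)
  have \<alpha>1: "\<alpha> < 1" using \<alpha> by simp
  have Feq: "wave_term = (\<lambda>k l. of_real (real (Suc k) powr \<alpha> * gmean k l) * exp (4 * pi * \<i> * of_real (gmean k l) * Complex (Re T) (Im T)))"
    by (intro ext) (simp only: wave_term_def)
  have "P / 2 - 3 / 2 * exp (- 2 * pi * Im T * sqrt (real K0)) * damped_sum \<alpha> (2 * pi * Im T) \<le> Re S"
    unfolding S_def Feq P_def by (rule aligned_sum_lower(3)[OF \<alpha>(1) \<alpha>1 T(2) cs])
  then have ReS: "P / 4 \<le> norm S" using tail complex_Re_le_cmod[of S] unfolding P_def by linarith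
  have T6: "norm T \<ge> 6" using T1 complex_Re_le_cmod[of T] by linarith
  have P0: "P \<ge> 0"
    unfolding P_def by (intro damped_sum_nonneg \<alpha> \<alpha>1) (use T in auto)
  have T1': "Re T \<ge> 1" using T1 by simp
  obtain R where R: "norm R \<le> 3 * P"
    and O: "Osc = of_real C1 * cis (3 * pi / 4) / T ^ 3 * (R - 2 * of_real pi * \<i> * T * S)"
    using Osc_eq[OF T1' T1(2), folded P_def C1_def S_def] by (elim exE conjE) (rule that; assumption)
  have "norm T * P \<le> (2 * pi) * norm T * (P / 4) - 3 * P"
  proof -
    \<comment> \<open>The real part of the wave sum is at least P / 2 - P / 4, so the main term is
      at least (pi / 2) norm T P, against a remainder of at most 3 P. With pi > 3 and norm T \<ge> 6
      the surplus (pi / 2 - 1) norm T is at least 3, and norm T P is left.\<close>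
    have "3 * 6 / 6 \<le> (pi / 2 - 1) * norm T"
    proof -
      have "(1 / 2) * 6 \<le> (pi / 2 - 1) * norm T" using T6 pi_gt3 by (intro mult_mono) auto
      then show ?thesis by simp
    qed
    then have "3 * P \<le> (pi / 2 - 1) * norm T * P" using P0 by (intro mult_right_mono) auto
    then show ?thesis by (simp add: algebra_simps)
  qed
  also have "\<dots> \<le> (2 * pi) * norm T * norm S - norm R"
    by (intro diff_mono mult_left_mono ReS R) auto
  also have "(2 * pi) * norm T * norm S = norm (2 * of_real pi * \<i> * T * S)" by (simp add: norm_mult)
  also have "\<dots> - norm R \<le> norm (R - 2 * of_real pi * \<i> * T * S)"
    by (metis norm_minus_commute norm_triangle_ineq2)
  finally have big: "norm T * P \<le> norm (R - 2 * of_real pi * \<i> * T * S)" .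
  have "C1 * P / norm T ^ 2 = C1 / norm T ^ 3 * (norm T * P)"
    using T6 by (simp add: field_simps power2_eq_square power3_eq_cube)
  also have "\<dots> \<le> C1 / norm T ^ 3 * norm (R - 2 * of_real pi * \<i> * T * S)"
    using C1 by (intro mult_left_mono big) auto
  also have "\<dots> = norm Osc"
    unfolding O norm_mult norm_divide norm_power norm_cis norm_of_real using C1 by (simp only: abs_of_pos mult_1_right)
  finally show ?thesis unfolding C1_def P_def .
qed

end

section \<open>The Omega result\<close>

text \<open>The arctangent is a primitive; pi / \<kappa> is the integral over the whole
  line.\<close>

lemma poisson_integral_half_line:
  fixes u \<kappa> :: real
  assumes \<kappa>: "\<kappa> > 0"
  shows "set_integrable lborel {0<..} (\<lambda>x. 1 / ((x - u)\<^sup>2 + \<kappa>\<^sup>2))"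
    and "(LBINT x:{0<..}. 1 / ((x - u)\<^sup>2 + \<kappa>\<^sup>2)) \<le> pi / \<kappa>"
proof -
  define F where "F = (\<lambda>x. arctan ((x - u) / \<kappa>) / \<kappa>)"
  have D: "(F has_real_derivative 1 / ((x - u)\<^sup>2 + \<kappa>\<^sup>2)) (at x)" for x
  proof -
    have "((\<lambda>x. (x - u) / \<kappa>) has_real_derivative 1 / \<kappa>) (at x)"
      using \<kappa> by (auto intro!: derivative_eq_intros)
    from DERIV_cdivide[OF DERIV_chain2[OF DERIV_arctan this], of \<kappa>]
    have "(F has_real_derivative inverse (1 + ((x - u) / \<kappa>)\<^sup>2) * (1 / \<kappa>) / \<kappa>) (at x)"
      unfolding F_def .
    also have "inverse (1 + ((x - u) / \<kappa>)\<^sup>2) * (1 / \<kappa>) / \<kappa> = 1 / (\<kappa>\<^sup>2 * (1 + ((x - u) / \<kappa>)\<^sup>2))"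
      by (simp add: divide_inverse power2_eq_square)
    also have "\<kappa>\<^sup>2 * (1 + ((x - u) / \<kappa>)\<^sup>2) = (x - u)\<^sup>2 + \<kappa>\<^sup>2"
      using \<kappa> by (simp add: power_divide distrib_left)
    finally show ?thesis .
  qed
  have nz: "(x - u)\<^sup>2 + \<kappa>\<^sup>2 \<noteq> 0" for x using \<kappa> zero_le_power2[of "x - u"] zero_less_power[OF \<kappa>, of 2] by linarith
  have cF: "isCont F x" for x using D DERIV_isCont by blast
  have lim: "((F \<circ> real_of_ereal) \<longlongrightarrow> F 0) (at_right 0)"
    using cF[of 0] by (simp add: zero_ereal_def ereal_tendsto_simps isCont_def filterlim_at_split)
  have "filterlim (\<lambda>x. (x - u) / \<kappa>) at_top at_top" using \<kappa> by real_asymp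
  then have "(F \<longlongrightarrow> pi / 2 / \<kappa>) at_top"
    unfolding F_def by (intro tendsto_divide tendsto_const filterlim_compose[OF tendsto_arctan_at_top]) (use \<kappa> in auto)
  then have lim2: "((F \<circ> real_of_ereal) \<longlongrightarrow> pi / 2 / \<kappa>) (at_left \<infinity>)"
    by (simp add: ereal_tendsto_simps)
  have c: "isCont (\<lambda>x. 1 / ((x - u)\<^sup>2 + \<kappa>\<^sup>2)) x" for x by (intro continuous_intros nz)
  have e: "einterval 0 \<infinity> = {0<..}" by (auto simp: einterval_def zero_ereal_def)
  have "set_integrable lborel (einterval 0 \<infinity>) (\<lambda>x. 1 / ((x - u)\<^sup>2 + \<kappa>\<^sup>2))"
    by (rule interval_integral_FTC_nonneg(1)[OF _ D c _ lim lim2]) auto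
  then show "set_integrable lborel {0<..} (\<lambda>x. 1 / ((x - u)\<^sup>2 + \<kappa>\<^sup>2))" unfolding e .
  have "(LBINT x=0..\<infinity>. 1 / ((x - u)\<^sup>2 + \<kappa>\<^sup>2)) = pi / 2 / \<kappa> - F 0"
    by (rule interval_integral_FTC_nonneg(2)[OF _ D c _ lim lim2]) auto
  then have "(LBINT x:{0<..}. 1 / ((x - u)\<^sup>2 + \<kappa>\<^sup>2)) = pi / 2 / \<kappa> - F 0"
    by (simp add: interval_lebesgue_integral_def e)
  also have "\<dots> \<le> pi / \<kappa>"
  proof -
    have "- (pi / 2) / \<kappa> \<le> F 0"
      unfolding F_def using arctan_lbound[of "(0 - u) / \<kappa>"] \<kappa> by (intro divide_right_mono) auto
    moreover have "pi / 2 / \<kappa> - - (pi / 2) / \<kappa> = pi / \<kappa>" by simp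
    ultimately show ?thesis by linarith
  qed
  finally show "(LBINT x:{0<..}. 1 / ((x - u)\<^sup>2 + \<kappa>\<^sup>2)) \<le> pi / \<kappa>" .
qed

context voronoi
begin

text \<open>Up to Y the error is bounded by P and the norm of \<open>kd\<close> by \<kappa> powr (1
  - s) times a Poisson kernel of width \<kappa> = Im w, which integrates to pi / \<kappa>. Beyond Y
  the distance from x to w is at least x / 2, and the crude bound for E leaves x powr (1/2 +
  \<alpha> - s - 1) = x powr (-3).\<close>

lemma kd_integral_bound:
  fixes E :: "real \<Rightarrow> real"
  assumes Y: "Y \<ge> 2 * norm w" "Y > 0" and P: "P \<ge> 0" "\<And>x. 0 < x \<Longrightarrow> x \<le> Y \<Longrightarrow> \<bar>E x\<bar> \<le> P"
    and Q: "Q \<ge> 0" "\<And>x. x > Y \<Longrightarrow> \<bar>E x\<bar> \<le> Q * x powr (1 / 2 + \<alpha>)"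
  shows "norm (LBINT x:{0<..}. of_real (E x) * kd x)
     \<le> P * s * pi * Im w powr (- s) + Q * s * 2 powr (s + 1) * Y powr (-2)"
proof -
  define \<kappa> where "\<kappa> = Im w"
  have \<kappa>: "\<kappa> > 0" using Imw by (simp add: \<kappa>_def)
  define g1 where "g1 = (\<lambda>x. P * s * \<kappa> powr (1 - s) * (1 / ((x - Re w)\<^sup>2 + \<kappa>\<^sup>2)))"
  define g2 where "g2 = (\<lambda>x. Q * s * 2 powr (s + 1) * (indicator {Y<..} x * x powr (-3)))"
  have i1: "set_integrable lborel {0<..} g1"
    unfolding g1_def by (intro set_integrable_mult_right poisson_integral_half_line(1) \<kappa>)
  have p3: "set_integrable lborel {Y<..} (\<lambda>x. x powr (-3))" "(LBINT x:{Y<..}. x powr (-3)) = Y powr (-2) / 2"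
    using set_integrable_powr_at_top[of "-3" Y] Y(2) by simp_all
  have i2': "set_integrable lborel {0<..} (\<lambda>x. indicator {Y<..} x * x powr (-3))"
    using p3(1) unfolding set_integrable_def by (rule Bochner_Integration.integrable_cong[THEN iffD1, rotated -1])
      (use Y(2) in \<open>auto simp: indicator_def\<close>)
  have v2': "(LBINT x:{0<..}. indicator {Y<..} x * x powr (-3)) = Y powr (-2) / 2"
    unfolding p3(2) [symmetric] set_lebesgue_integral_def
    by (rule Bochner_Integration.integral_cong) (use Y(2) in \<open>auto simp: indicator_def\<close>)
  have i2: "set_integrable lborel {0<..} g2"
    unfolding g2_def by (intro set_integrable_mult_right i2')
  have nx: "norm (of_real x - w) \<ge> \<kappa>" for x
    using abs_Im_le_cmod[of "of_real x - w"] by (simp add: \<kappa>_def)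
  have sq: "norm (of_real x - w) ^ 2 = (x - Re w)\<^sup>2 + \<kappa>\<^sup>2" for x
    by (simp add: cmod_power2 \<kappa>_def)
  have A: "norm (kd x) \<le> s * \<kappa> powr (1 - s) * (1 / ((x - Re w)\<^sup>2 + \<kappa>\<^sup>2))" for x
  proof -
    have n0: "norm (of_real x - w) > 0" using nx[of x] \<kappa> by linarith
    have e: "- s - 1 = (1 - s) + - real 2" by simp
    have "norm (kd x) = s * (norm (of_real x - w) powr (1 - s) * (1 / ((x - Re w)\<^sup>2 + \<kappa>\<^sup>2)))"
      unfolding norm_kd e powr_add powr_minus_divide powr_realpow[OF n0] sq ..
    also have "\<dots> \<le> s * (\<kappa> powr (1 - s) * (1 / ((x - Re w)\<^sup>2 + \<kappa>\<^sup>2)))"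
      using nx[of x] \<kappa> \<alpha> by (intro mult_left_mono mult_right_mono powr_mono2') auto
    finally show ?thesis by (simp only: mult.assoc)
  qed
  have B: "norm (kd x) \<le> s * (2 powr (s + 1) * x powr (- s - 1))" if x: "x > Y" for x
  proof -
    have "x / 2 \<le> norm (of_real x - w)"
      using norm_triangle_ineq2[of "of_real x" w] Y x by simp
    then have "norm (of_real x - w) powr (- s - 1) \<le> (x / 2) powr (- s - 1)"
      using x Y(2) s_pos by (intro powr_mono2') auto
    also have "\<dots> = 2 powr (s + 1) * x powr (- s - 1)"
    proof -
      have e: "- s - 1 = - (s + 1)" by simp
      show ?thesis unfolding e powr_minus using x Y(2) by (simp add: powr_divide field_simps)
    qed
    finally show ?thesis unfolding norm_kd using s_pos by (intro mult_left_mono) auto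
  qed
  have "norm (of_real (E x) * kd x) \<le> g1 x + g2 x" if x: "x \<in> {0<..}" for x
  proof (cases "x \<le> Y")
    case True
    have "norm (of_real (E x) * kd x) \<le> P * (s * \<kappa> powr (1 - s) * (1 / ((x - Re w)\<^sup>2 + \<kappa>\<^sup>2)))"
      unfolding norm_mult norm_of_real using True x P by (intro mult_mono A) auto
    also have "\<dots> = g1 x" by (simp add: g1_def)
    finally show ?thesis using True by (simp add: g2_def)
  next
    case False
    have "norm (of_real (E x) * kd x) \<le> (Q * x powr (1 / 2 + \<alpha>)) * (s * (2 powr (s + 1) * x powr (- s - 1)))"
      unfolding norm_mult norm_of_real using False Q by (intro mult_mono B) auto
    also have "\<dots> = Q * s * 2 powr (s + 1) * (x powr (1 / 2 + \<alpha>) * x powr (- s - 1))"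
      by (simp only: mult_ac)
    also have "x powr (1 / 2 + \<alpha>) * x powr (- s - 1) = x powr (-3)"
    proof -
      have e: "(1 / 2 + \<alpha>) + (- s - 1) = -3" by simp
      show ?thesis unfolding powr_add[symmetric] e ..
    qed
    also have "Q * s * 2 powr (s + 1) * x powr (-3) = g2 x" using False by (simp add: g2_def)
    also have "\<dots> \<le> g1 x + g2 x" using P(1) s_pos by (simp add: g1_def)
    finally show ?thesis .
  qed
  then have "norm (LBINT x:{0<..}. of_real (E x) * kd x) \<le> (LBINT x:{0<..}. g1 x + g2 x)"
    by (intro set_integral_norm_bound' set_integral_add(1) i1 i2)
  also have "\<dots> = (LBINT x:{0<..}. g1 x) + (LBINT x:{0<..}. g2 x)"
    by (rule set_integral_add(2)[OF i1 i2])
  also have "(LBINT x:{0<..}. g1 x) \<le> P * s * \<kappa> powr (1 - s) * (pi / \<kappa>)"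
    unfolding g1_def set_integral_mult_right using P(1) s_pos
    by (intro mult_left_mono poisson_integral_half_line(2) \<kappa>) auto
  also have "P * s * \<kappa> powr (1 - s) * (pi / \<kappa>) = P * s * pi * \<kappa> powr (- s)"
  proof -
    have e: "1 - s = - s + 1" by simp
    have k1: "\<kappa> powr (1 - s) = \<kappa> powr (- s) * \<kappa>"
      unfolding e powr_add using \<kappa> by simp
    have k2: "a * (k' * \<kappa>) * (pi / \<kappa>) = a * pi * k'" for a k' :: real using \<kappa> by simp
    show ?thesis unfolding k1 by (rule k2)
  qed
  also have "(LBINT x:{0<..}. g2 x) = Q * s * 2 powr (s + 1) * (Y powr (-2) / 2)"
    unfolding g2_def set_integral_mult_right v2' ..
  also have "\<dots> \<le> Q * s * 2 powr (s + 1) * Y powr (-2)"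
    using Q(1) s_pos by (intro mult_left_mono) auto
  finally show ?thesis unfolding \<kappa>_def by simp
qed

end

text \<open>Both bounds for \<open>Osc\<close> are evaluated at T = t + i \<eta> with \<eta> = 1 /
  sqrt (2 M) and t from Dirichlet's theorem. Every estimate carries the common factor t powr (-2);
  after its cancellation t has disappeared and an inequality in M alone remains.\<close>

lemma omega_inequality:
  fixes \<alpha> A B \<epsilon> C :: real and M n :: nat
  defines "E \<equiv> \<lambda>x. (\<Sum>n | 1 \<le> n \<and> real n \<le> x. divisor_sigma \<alpha> n) - (A * x powr (1 + \<alpha>) + B * x)"
    and "\<gamma> \<equiv> 1 / 4 + \<alpha> / 2"
  assumes \<alpha>: "0 < \<alpha>" "\<alpha> < 1 / 2" and L: "voronoi.tau_powr \<alpha> \<longlonglongrightarrow> L"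
    and n: "n > 0" and M: "M \<ge> 6" and \<epsilon>: "\<epsilon> \<ge> 0" and C: "C \<ge> 0"
    and tail: "3 / 2 * exp (- 2 * pi * (1 / sqrt (2 * real M)) * sqrt (real (n\<^sup>2 * (2 * M)))) * damped_sum \<alpha> (2 * pi * (1 / sqrt (2 * real M)))
       \<le> damped_sum \<alpha> (4 * pi * (1 / sqrt (2 * real M))) / 4"
    and E1: "\<And>x Y. 0 < x \<Longrightarrow> x \<le> Y \<Longrightarrow> \<bar>E x\<bar> \<le> C + \<epsilon> * (Y * ln Y) powr \<gamma>"
    and E2: "\<And>x. 1 \<le> x \<Longrightarrow> \<bar>E x\<bar> \<le> (C + \<epsilon>) * x powr (1 / 2 + \<alpha>)"
  shows "voronoi.c0 \<alpha> * sqrt pi * (2 * pi) powr (-3/2) * exp (- 4 * pi) / 2 * real M powr (2 * \<gamma> + 1)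
    \<le> (5 / 2 + \<alpha>) * pi * 2 powr (\<gamma> + 1) * (C * real M powr (1 - \<gamma>) + \<epsilon> * (112 * real n ^ 2) powr \<gamma> * real M powr (2 * \<gamma> + 1))
      + (C + \<epsilon>) * (5 / 2 + \<alpha>) * 2 powr (5 / 2 + \<alpha> + 1) + \<bar>minor_const \<alpha> L A B\<bar>"
proof -
  define K0 where "K0 = n\<^sup>2 * (2 * M)"
  define \<eta> where "\<eta> = 1 / sqrt (2 * real M)"
  have M0: "real M > 0" using M by simp
  have \<eta>0: "\<eta> > 0" using M0 by (simp add: \<eta>_def)
  have \<eta>1: "\<eta> \<le> 1" using M by (simp add: \<eta>_def)
  have \<gamma>0: "\<gamma> > 0" using \<alpha> by (simp add: \<gamma>_def)
  have sg: "5 / 2 + \<alpha> = 2 * (\<gamma> + 1)" "3 / 2 + \<alpha> = 2 * \<gamma> + 1" "1 / 2 + \<alpha> = 2 * \<gamma>" by (simp_all add: \<gamma>_def)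
  obtain t where t: "exp (real K0) \<le> t" "ln t \<le> 3 * real K0"
    "\<And>n. n < K0 \<Longrightarrow> cos (4 * pi * sqrt (real (Suc n)) * t) \<ge> 1 / 2"
    by (rule Dirichlet_aligned_time) (rule that; assumption)
  have KM: "real K0 \<ge> real M"
  proof -
    have "1 * (1 * M) \<le> K0" unfolding K0_def using n by (intro mult_le_mono) (auto intro: Suc_leI)
    then show ?thesis by simp
  qed
  have tM: "t \<ge> real M" using exp_ge_add_one_self[of "real K0"] t(1) KM by linarith
  have t6: "t \<ge> 6" using tM M by simp
  define T where "T = Complex t \<eta>"
  interpret voronoi \<alpha> T
    by unfold_locales (use \<alpha> t6 \<eta>0 in \<open>auto simp: T_def\<close>)
  have nT: "norm T ^ 2 = t\<^sup>2 + \<eta>\<^sup>2" by (simp add: T_def cmod_power2)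
  have \<eta>2: "\<eta>\<^sup>2 \<le> 1" using \<eta>0 \<eta>1 by (simp add: power_le_one)
  have t2: "t\<^sup>2 \<ge> 6 * t" using t6 by (simp add: power2_eq_square)
  have nw: "norm w = t\<^sup>2 + \<eta>\<^sup>2" by (simp only: w_def norm_power nT)
  have Rw: "Re w \<ge> 0"
  proof -
    have "Re w = t\<^sup>2 - \<eta>\<^sup>2" unfolding w_def by (simp add: T_def power2_eq_square)
    then show ?thesis using \<eta>2 t2 t6 by linarith
  qed
  have Iw: "Im w = 2 * t * \<eta>" unfolding w_def by (simp add: T_def power2_eq_square)
  define u where "u = t powr (-2)"
  have u: "u = 1 / t\<^sup>2" "u > 0" using t6 by (simp_all add: u_def powr_minus_divide)

  have lower: "voronoi.c0 \<alpha> * sqrt pi * (2 * pi) powr (-3/2) * exp (- 4 * pi) / 2 * real M powr (2 * \<gamma> + 1) * u \<le> norm Osc"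
  proof -
    define C1 where "C1 = c0 * sqrt pi * (2 * pi) powr (-3/2)"
    have C1: "C1 > 0" using c0_pos by (simp add: C1_def)
    have "C1 * damped_sum \<alpha> (4 * pi * \<eta>) / norm T ^ 2 \<le> norm Osc"
    proof -
      have "Re T \<ge> 6" "Im T \<le> Re T / 2" using t6 \<eta>1 by (simp_all add: T_def)
      moreover have "cos (4 * pi * sqrt (real (Suc k)) * Re T) \<ge> 1 / 2" if "k < K0" for k
        using t(3)[OF that] by (simp add: T_def)
      moreover have "3 / 2 * exp (- 2 * pi * Im T * sqrt (real K0)) * damped_sum \<alpha> (2 * pi * Im T) \<le> damped_sum \<alpha> (4 * pi * Im T) / 4"
        using tail unfolding T_def complex.sel \<eta>_def K0_def .
      ultimately have "C1 * damped_sum \<alpha> (4 * pi * Im T) / norm T ^ 2 \<le> norm Osc"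
        unfolding C1_def by (rule Osc_lower)
      then show ?thesis by (simp add: T_def)
    qed
    moreover have "C1 * (exp (- 4 * pi) * real M powr (2 * \<gamma> + 1)) / (2 * t\<^sup>2) \<le> C1 * damped_sum \<alpha> (4 * pi * \<eta>) / norm T ^ 2"
    proof (intro frac_le mult_left_mono)
      show "exp (- 4 * pi) * real M powr (2 * \<gamma> + 1) \<le> damped_sum \<alpha> (4 * pi * \<eta>)"
        using damped_sum_lower[of \<alpha> M] \<alpha> M by (simp add: \<eta>_def sg)
      show "0 \<le> C1 * damped_sum \<alpha> (4 * pi * \<eta>)"
        using C1 \<eta>0 \<alpha> by (intro mult_nonneg_nonneg damped_sum_nonneg) auto
      show "norm T ^ 2 \<le> 2 * t\<^sup>2" "0 < norm T ^ 2" unfolding nT using \<eta>2 t2 t6 zero_le_power2[of \<eta>] by linarith+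
    qed (use C1 in auto)
    moreover have "C1 * (exp (- 4 * pi) * real M powr (2 * \<gamma> + 1)) / (2 * t\<^sup>2) = C1 * exp (- 4 * pi) / 2 * real M powr (2 * \<gamma> + 1) * u"
      unfolding u(1) by simp
    ultimately show ?thesis unfolding C1_def by linarith
  qed

  \<comment> \<open>At least 2 norm w, as the tail estimate requires, and above 1, so that ln Y is
    positive. Since t \<ge> 6 and \<eta> \<le> 1, Y stays below 7 t^2; together with ln Y \<le> 8 K0
    and K0 = 2 n^2 M this produces the constant 7 * 8 * 2 = 112.\<close>
  define Y where "Y = 2 * norm w + 3"
  have "t \<le> 2 * (a + b) + 3 \<and> 1 < 2 * (a + b) + 3 \<and> 2 * (a + b) + 3 \<le> 7 * a"
    if "b \<le> 1" "6 * t \<le> a" "0 \<le> b" for a b :: real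
    using that t6 by auto
  from this[OF \<eta>2 t2] have Yt: "Y \<ge> t" "Y > 1" "Y \<le> 7 * t\<^sup>2" unfolding Y_def nw by auto
  define P where "P = C + \<epsilon> * (Y * ln Y) powr \<gamma>"
  have P0: "P \<ge> 0" using C \<epsilon> by (simp add: P_def)
  have "norm (LBINT x:{0<..}. of_real (E x) * kd x) \<le> P * s * pi * Im w powr (- s) + (C + \<epsilon>) * s * 2 powr (s + 1) * Y powr (-2)"
  proof (rule kd_integral_bound)
    show "\<bar>E x\<bar> \<le> P" if "0 < x" "x \<le> Y" for x unfolding P_def using that by (rule E1)
    show "\<bar>E x\<bar> \<le> (C + \<epsilon>) * x powr (1 / 2 + \<alpha>)" if "Y < x" for x using that Yt by (intro E2) auto
  qed (use Yt P0 C \<epsilon> in \<open>auto simp: Y_def\<close>)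
  moreover have "norm Osc \<le> norm (LBINT x:{0<..}. of_real (E x) * kd x) + minor_const \<alpha> L A B * norm w powr (-5/4)"
    unfolding E_def Dsum_def [symmetric] using nw t2 t6 \<eta>2 zero_le_power2[of \<eta>] by (intro Osc_upper L Rw) linarith
  moreover have "minor_const \<alpha> L A B * norm w powr (-5/4) \<le> \<bar>minor_const \<alpha> L A B\<bar> * u"
  proof (intro mult_mono)
    have "norm w powr (-5/4) \<le> (t\<^sup>2) powr (-5/4)" unfolding nw using t6 by (intro powr_mono2') auto
    also have "\<dots> = t powr (2 * (-5/4))" using t6 by (simp only: powr_powr flip: powr_numeral)
    also have "\<dots> \<le> u" unfolding u_def using t6 by (intro powr_mono) auto
    finally show "norm w powr (-5/4) \<le> u" .
  qed auto
  moreover have "(C + \<epsilon>) * s * 2 powr (s + 1) * Y powr (-2) \<le> (C + \<epsilon>) * s * 2 powr (s + 1) * u"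
    unfolding u_def using Yt t6 C \<epsilon> s_pos by (intro mult_left_mono powr_mono2') auto
  moreover have "P * s * pi * Im w powr (- s) \<le>
      s * pi * 2 powr (\<gamma> + 1) * (C * real M powr (1 - \<gamma>) + \<epsilon> * (112 * real n ^ 2) powr \<gamma> * real M powr (2 * \<gamma> + 1)) * u"
  proof -
    define q where "q = (112 * real n ^ 2) powr \<gamma>"
    have lnY: "ln Y \<le> 8 * real K0"
    proof -
      have "ln Y \<le> ln (7 * t\<^sup>2)" using Yt by (intro ln_mono) auto
      also have "\<dots> = ln 7 + 2 * ln t" using t6 by (simp add: ln_mult ln_realpow)
      also have "ln (7 :: real) \<le> 6" using ln_le_minus_one[of "7 :: real"] by simp
      finally show ?thesis using t(2) KM M by linarith
    qed
    have "Y * ln Y \<le> (7 * t\<^sup>2) * (8 * real K0)" using Yt lnY by (intro mult_mono) auto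
    also have "\<dots> = 112 * real n ^ 2 * (real M * t\<^sup>2)" by (simp add: K0_def)
    finally have "(Y * ln Y) powr \<gamma> \<le> (112 * real n ^ 2 * (real M * t\<^sup>2)) powr \<gamma>"
      using Yt \<gamma>0 by (intro powr_mono2) auto
    also have "\<dots> = q * (real M powr \<gamma> * t powr (2 * \<gamma>))"
    proof -
      have "(t\<^sup>2) powr \<gamma> = t powr (2 * \<gamma>)" using t6 by (simp only: powr_powr flip: powr_numeral)
      then show ?thesis unfolding q_def by (simp only: powr_mult)
    qed
    finally have Pq: "P \<le> C + \<epsilon> * (q * (real M powr \<gamma> * t powr (2 * \<gamma>)))"
      unfolding P_def using \<epsilon> by (intro add_left_mono mult_left_mono) auto
    \<comment> \<open>Here s = 2 (\<gamma> + 1) fits the exponent of the theorem: (t \<eta>) powr (-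
      s) contains t powr (- 2 \<gamma>), which cancels the growth t powr (2 \<gamma>) of the bound
      for E, and leaves t powr (-2) and a power of M.\<close>
    have kq: "Im w powr (- s) \<le> 2 powr (\<gamma> + 1) * real M powr (\<gamma> + 1) * (t powr (- 2 * \<gamma>) * u)"
    proof -
      have \<eta>p: "\<eta> = (2 * real M) powr (- (1 / 2))"
        unfolding \<eta>_def powr_minus_divide by (simp only: powr_half_sqrt of_nat_0_le_iff zero_le_numeral mult_nonneg_nonneg)
      have e1: "- (1 / 2) * - s = \<gamma> + 1" and e2: "- s = - 2 * \<gamma> + (-2)" by (simp_all add: \<gamma>_def field_simps)
      have "\<eta> powr (- s) = 2 powr (\<gamma> + 1) * real M powr (\<gamma> + 1)"
        unfolding \<eta>p powr_powr e1 powr_mult ..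
      moreover have "t powr (- s) = t powr (- 2 * \<gamma>) * u" unfolding e2 powr_add u_def ..
      moreover have "Im w powr (- s) \<le> (t * \<eta>) powr (- s)"
        unfolding Iw using t6 \<eta>0 s_pos by (intro powr_mono2') auto
      ultimately show ?thesis by (simp only: powr_mult mult_ac)
    qed
    have tg: "t powr (- 2 * \<gamma>) \<le> real M powr (- 2 * \<gamma>)" using tM M0 \<gamma>0 by (intro powr_mono2') auto
    have m1: "real M powr (\<gamma> + 1) * real M powr (- 2 * \<gamma>) = real M powr (1 - \<gamma>)"
      by (simp add: algebra_simps flip: powr_add)
    have m2: "real M powr \<gamma> * real M powr (\<gamma> + 1) = real M powr (2 * \<gamma> + 1)"
      by (simp add: algebra_simps flip: powr_add)
    have t1: "t powr (2 * \<gamma>) * t powr (- 2 * \<gamma>) = 1" using t6 by (simp flip: powr_add)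
    have "P * s * pi * Im w powr (- s) \<le> (C + \<epsilon> * (q * (real M powr \<gamma> * t powr (2 * \<gamma>)))) * s * pi *
        (2 powr (\<gamma> + 1) * real M powr (\<gamma> + 1) * (t powr (- 2 * \<gamma>) * u))"
      using P0 s_pos Pq kq by (intro mult_mono mult_right_mono mult_nonneg_nonneg order_trans[OF P0 Pq]) auto
    also have "\<dots> = s * pi * 2 powr (\<gamma> + 1) * (C * (real M powr (\<gamma> + 1) * t powr (- 2 * \<gamma>)) +
        \<epsilon> * q * ((real M powr \<gamma> * real M powr (\<gamma> + 1)) * (t powr (2 * \<gamma>) * t powr (- 2 * \<gamma>)))) * u"
    proof -
      have "(C + \<epsilon> * (q * (a * b))) * r * p * (k * d * (e * u)) = r * p * k * (C * (d * e) + \<epsilon> * q * ((a * d) * (b * e))) * u"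
        for a b r p k d e :: real by (simp only: algebra_simps)
      then show ?thesis .
    qed
    also have "\<dots> \<le> s * pi * 2 powr (\<gamma> + 1) * (C * (real M powr (\<gamma> + 1) * real M powr (- 2 * \<gamma>)) +
        \<epsilon> * q * (real M powr (2 * \<gamma> + 1))) * u"
      unfolding m2 t1 mult_1_right using s_pos u C tg by (intro mult_right_mono mult_left_mono add_mono order_refl) auto
    finally show ?thesis unfolding m1 q_def .
  qed
  ultimately have "voronoi.c0 \<alpha> * sqrt pi * (2 * pi) powr (-3/2) * exp (- 4 * pi) / 2 * real M powr (2 * \<gamma> + 1) * u \<le>
      s * pi * 2 powr (\<gamma> + 1) * (C * real M powr (1 - \<gamma>) + \<epsilon> * (112 * real n ^ 2) powr \<gamma> * real M powr (2 * \<gamma> + 1)) * u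
      + (C + \<epsilon>) * s * 2 powr (s + 1) * u + \<bar>minor_const \<alpha> L A B\<bar> * u"
    using lower by linarith
  then have "voronoi.c0 \<alpha> * sqrt pi * (2 * pi) powr (-3/2) * exp (- 4 * pi) / 2 * real M powr (2 * \<gamma> + 1) * u \<le>
      (s * pi * 2 powr (\<gamma> + 1) * (C * real M powr (1 - \<gamma>) + \<epsilon> * (112 * real n ^ 2) powr \<gamma> * real M powr (2 * \<gamma> + 1))
      + (C + \<epsilon>) * s * 2 powr (s + 1) + \<bar>minor_const \<alpha> L A B\<bar>) * u"
    by (simp only: distrib_right)
  then show ?thesis using u(2) by (simp only: mult_le_cancel_right_pos)
qed

text \<open>The limit is read off from the Voronoi formula at a single T, here 1 + i, and divided by
  h(0), which is nonzero.\<close>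

lemma tau_powr_convergent:
  assumes "0 < \<alpha>" "\<alpha> < 1 / 2"
  obtains L where "voronoi.tau_powr \<alpha> \<longlonglongrightarrow> L"
proof -
  interpret voronoi \<alpha> "Complex 1 1" by unfold_locales (use assms in auto)
  from tendsto_mult_left[OF tau_powr_tendsto, of "1 / h 0"] h0_nonzero show thesis
    by (intro that) simp
qed

text \<open>Below the threshold of the eventual bound E is bounded by a constant, which becomes C.
  Above it, monotonicity replaces x by Y in the first bound, and ln x \<le> x - 1 gives the pure
  power in the second.\<close>

lemma error_bound_everywhere:
  fixes \<alpha> A B \<epsilon> \<gamma> :: real
  defines "E \<equiv> \<lambda>x. (\<Sum>n | 1 \<le> n \<and> real n \<le> x. divisor_sigma \<alpha> n) - (A * x powr (1 + \<alpha>) + B * x)"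
  assumes \<alpha>: "\<alpha> > 0" and \<gamma>: "\<gamma> > 0" and \<epsilon>: "\<epsilon> > 0"
    and small: "eventually (\<lambda>x. \<bar>E x\<bar> \<le> \<epsilon> * (x * ln x) powr \<gamma>) at_top"
  obtains C where "C \<ge> 0" "\<And>x Y. 0 < x \<Longrightarrow> x \<le> Y \<Longrightarrow> \<bar>E x\<bar> \<le> C + \<epsilon> * (Y * ln Y) powr \<gamma>"
    "\<And>x. 1 \<le> x \<Longrightarrow> \<bar>E x\<bar> \<le> (C + \<epsilon>) * x powr (2 * \<gamma>)"
proof -
  obtain x0 where x0: "\<And>x. x \<ge> x0 \<Longrightarrow> \<bar>E x\<bar> \<le> \<epsilon> * (x * ln x) powr \<gamma>"
    using small by (auto simp: eventually_at_top_linorder)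
  define x1 where "x1 = max 1 x0"
  define D where "D = (\<lambda>x. \<Sum>n | 1 \<le> n \<and> real n \<le> x. divisor_sigma \<alpha> n)"
  have nn: "divisor_sigma \<alpha> n \<ge> 0" for n by (auto simp: divisor_sigma_def intro: sum_nonneg)
  have fin: "finite {n. 1 \<le> n \<and> real n \<le> x}" for x
    by (rule finite_subset[of _ "{..nat \<lfloor>x\<rfloor>}"]) (auto simp: le_nat_floor)
  have D0: "D x \<ge> 0" for x unfolding D_def by (intro sum_nonneg nn)
  define C where "C = D x1 + \<bar>A\<bar> * x1 powr (1 + \<alpha>) + \<bar>B\<bar> * x1"
  have C0: "C \<ge> 0" using D0[of x1] by (simp add: C_def x1_def)
  have low: "\<bar>E x\<bar> \<le> C" if x: "0 < x" "x \<le> x1" for x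
  proof -
    have "D x \<le> D x1" unfolding D_def using x by (intro sum_mono2 fin nn) auto
    moreover have "\<bar>A * x powr (1 + \<alpha>)\<bar> \<le> \<bar>A\<bar> * x1 powr (1 + \<alpha>)"
      unfolding abs_mult using x \<alpha> by (intro mult_mono) (auto intro: powr_mono2)
    moreover have "\<bar>B * x\<bar> \<le> \<bar>B\<bar> * x1"
      unfolding abs_mult using x by (intro mult_mono) auto
    moreover have "E x = D x - (A * x powr (1 + \<alpha>) + B * x)" by (simp only: E_def D_def)
    ultimately show ?thesis using D0[of x] unfolding C_def by linarith
  qed
  show thesis
  proof (rule that[OF C0])
    fix x Y :: real assume x: "0 < x" "x \<le> Y"
    show "\<bar>E x\<bar> \<le> C + \<epsilon> * (Y * ln Y) powr \<gamma>"
    proof (cases "x \<le> x1")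
      case True
      then show ?thesis using low[OF x(1) True] \<epsilon> by (simp add: add_increasing2)
    next
      case False
      then have "\<bar>E x\<bar> \<le> \<epsilon> * (x * ln x) powr \<gamma>" by (intro x0) (simp add: x1_def)
      also have "\<dots> \<le> \<epsilon> * (Y * ln Y) powr \<gamma>"
        using x False \<epsilon> \<gamma> by (intro mult_left_mono powr_mono2 mult_mono ln_mono) (auto simp: x1_def)
      finally show ?thesis using C0 by simp
    qed
  next
    fix x :: real assume x: "1 \<le> x"
    show "\<bar>E x\<bar> \<le> (C + \<epsilon>) * x powr (2 * \<gamma>)"
    proof (cases "x \<le> x1")
      case True
      have "\<bar>E x\<bar> \<le> (C + \<epsilon>) * 1" using low[of x] x True \<epsilon> by simp
      also have "\<dots> \<le> (C + \<epsilon>) * x powr (2 * \<gamma>)"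
        using C0 \<epsilon> x \<gamma> by (intro mult_left_mono ge_one_powr_ge_zero) auto
      finally show ?thesis .
    next
      case False
      then have "\<bar>E x\<bar> \<le> \<epsilon> * (x * ln x) powr \<gamma>" by (intro x0) (simp add: x1_def)
      also have "(x * ln x) powr \<gamma> \<le> (x * x) powr \<gamma>"
        using x \<gamma> ln_le_minus_one[of x] by (intro powr_mono2 mult_left_mono) auto
      also have "(x * x) powr \<gamma> = x powr (2 * \<gamma>)"
        unfolding powr_mult by (simp flip: powr_add)
      also have "\<epsilon> * x powr (2 * \<gamma>) \<le> (C + \<epsilon>) * x powr (2 * \<gamma>)"
        using C0 by (intro mult_right_mono) auto
      finally show ?thesis using \<epsilon> by simp
    qed
  qed
qed

text \<open>Division of \<open>omega_inequality\<close> by M powr (2 \<gamma> + 1) leaves c \<le> S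
  D \<epsilon> plus terms with M powr (- 3 \<gamma>) and M powr (- 2 \<gamma> - 1), which vanish as
  M tends to infinity although C depends on \<epsilon>.\<close>

lemma error_not_small:
  fixes \<alpha> A B :: real
  defines "E \<equiv> \<lambda>x. (\<Sum>n | 1 \<le> n \<and> real n \<le> x. divisor_sigma \<alpha> n) - (A * x powr (1 + \<alpha>) + B * x)"
  assumes \<alpha>: "0 < \<alpha>" "\<alpha> < 1 / 2"
  shows "\<exists>\<epsilon>>0. \<not> eventually (\<lambda>x. \<bar>E x\<bar> \<le> \<epsilon> * (x * ln x) powr (1 / 4 + \<alpha> / 2)) at_top"
proof (rule ccontr)
  define \<gamma> where "\<gamma> = 1 / 4 + \<alpha> / 2"
  assume "\<not> ?thesis"
  then have small: "eventually (\<lambda>x. \<bar>E x\<bar> \<le> \<epsilon> * (x * ln x) powr \<gamma>) at_top" if "\<epsilon> > 0" for \<epsilon>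
    using that by (auto simp: \<gamma>_def)
  have \<gamma>: "\<gamma> > 0" "\<gamma> < 1" using \<alpha> by (simp_all add: \<gamma>_def)
  have \<alpha>1: "\<alpha> < 1" using \<alpha> by simp
  obtain L where L: "voronoi.tau_powr \<alpha> \<longlonglongrightarrow> L" using tau_powr_convergent[OF \<alpha>] .
  obtain n :: nat where n: "n > 0" and tail:
    "\<And>M :: nat. M > 0 \<Longrightarrow> 3 / 2 * exp (- 2 * pi * (1 / sqrt (2 * real M)) * sqrt (real (n\<^sup>2 * (2 * M)))) * damped_sum \<alpha> (2 * pi * (1 / sqrt (2 * real M)))
       \<le> damped_sum \<alpha> (4 * pi * (1 / sqrt (2 * real M))) / 4"
    by (rule damped_sum_tail_small[OF \<alpha>(1) \<alpha>1]) (rule that; assumption)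
  define c where "c = voronoi.c0 \<alpha> * sqrt pi * (2 * pi) powr (-3/2) * exp (- 4 * pi) / 2"
  define S where "S = (5 / 2 + \<alpha>) * pi * 2 powr (\<gamma> + 1)"
  define D where "D = (112 * real n ^ 2) powr \<gamma>"
  have c: "c > 0"
  proof -
    interpret voronoi \<alpha> "Complex 1 1" by unfold_locales (use \<alpha> in auto)
    show ?thesis using c0_pos by (simp add: c_def)
  qed
  have S: "S > 0" using \<alpha> by (simp add: S_def)
  have D: "D > 0" using n by (simp add: D_def)
  \<comment> \<open>Half of the critical value c / (S D), so that the limit reads c \<le> c / 2. The
    constants c, S and D are all fixed before \<epsilon>; in particular n does not depend on
    it.\<close>
  define \<epsilon> where "\<epsilon> = c / (2 * (S * D))"
  have \<epsilon>: "\<epsilon> > 0" using c S D by (simp add: \<epsilon>_def)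
  obtain C where C: "C \<ge> 0" "\<And>x Y. 0 < x \<Longrightarrow> x \<le> Y \<Longrightarrow> \<bar>E x\<bar> \<le> C + \<epsilon> * (Y * ln Y) powr \<gamma>"
    "\<And>x. 1 \<le> x \<Longrightarrow> \<bar>E x\<bar> \<le> (C + \<epsilon>) * x powr (2 * \<gamma>)"
    unfolding E_def by (rule error_bound_everywhere[OF \<alpha>(1) \<gamma>(1) \<epsilon> small[OF \<epsilon>, unfolded E_def]]) (rule that[unfolded E_def]; assumption)
  define R where "R = (C + \<epsilon>) * (5 / 2 + \<alpha>) * 2 powr (5 / 2 + \<alpha> + 1) + \<bar>minor_const \<alpha> L A B\<bar>"
  have g2: "1 / 2 + \<alpha> = 2 * \<gamma>" by (simp add: \<gamma>_def)
  have ineq: "c \<le> S * (C * real M powr (- (3 * \<gamma>)) + \<epsilon> * D) + R * real M powr (- (2 * \<gamma> + 1))" if M: "M \<ge> 6" for M :: nat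
  proof -
    define m where "m = real M powr (2 * \<gamma> + 1)"
    have M0: "M > 0" "real M > 0" using M by simp_all
    have m: "m > 0" using M0 by (simp add: m_def)
    have "c * m \<le> S * (C * real M powr (1 - \<gamma>) + \<epsilon> * D * m) + R"
      unfolding c_def S_def D_def R_def m_def \<gamma>_def add.assoc[symmetric]
      by (intro omega_inequality \<alpha> L n M tail M0 C(1) less_imp_le[OF \<epsilon>]
          C(2)[unfolded E_def \<gamma>_def] C(3)[unfolded E_def, folded g2])
    also have "real M powr (1 - \<gamma>) = real M powr (- (3 * \<gamma>)) * m"
      unfolding m_def by (simp flip: powr_add)
    also have "S * (C * (real M powr (- (3 * \<gamma>)) * m) + \<epsilon> * D * m) + R =
        (S * (C * real M powr (- (3 * \<gamma>)) + \<epsilon> * D) + R * (1 / m)) * m"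
      using m by (simp add: algebra_simps)
    also have "1 / m = real M powr (- (2 * \<gamma> + 1))"
      unfolding m_def powr_minus_divide ..
    finally show ?thesis using m by (simp only: mult_le_cancel_right_pos)
  qed
  have lim: "((\<lambda>M. real M powr (- a)) \<longlongrightarrow> 0) sequentially" if "a > 0" for a
    using that by (intro tendsto_neg_powr filterlim_real_sequentially) auto
  have "((\<lambda>M. S * (C * real M powr (- (3 * \<gamma>)) + \<epsilon> * D) + R * real M powr (- (2 * \<gamma> + 1))) \<longlongrightarrow>
      S * (C * 0 + \<epsilon> * D) + R * 0) sequentially"
    by (intro tendsto_intros lim) (use \<gamma> in auto)
  then have "c \<le> S * (C * 0 + \<epsilon> * D) + R * 0"
    by (rule tendsto_lowerbound)
      (use ineq in \<open>auto intro: eventually_mono[OF eventually_ge_at_top[of 6]]\<close>)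
  also have "\<dots> = c / 2" using S D by (simp add: \<epsilon>_def)
  finally show False using c by simp
qed

theorem theorem1:
  fixes \<alpha> :: real
  assumes "0 < \<alpha>" and "\<alpha> < 1 / 2"
  shows "is_Omega_at_top (divisor_error \<alpha>) (\<lambda>x. (x * ln x) powr (1 / 4 + \<alpha> / 2))"
proof -
  define A where "A = Re (riemann_zeta (of_real (1 + \<alpha>))) / (1 + \<alpha>)"
  define B where "B = Re (riemann_zeta (of_real (1 - \<alpha>)))"
  have err: "divisor_error \<alpha> x = (\<Sum>n | 1 \<le> n \<and> real n \<le> x. divisor_sigma \<alpha> n) - (A * x powr (1 + \<alpha>) + B * x)" for x
    unfolding divisor_error_def A_def B_def by simp
  obtain \<epsilon> where \<epsilon>: "\<epsilon> > 0" and
    not_small: "\<not> eventually (\<lambda>x. \<bar>divisor_error \<alpha> x\<bar> \<le> \<epsilon> * (x * ln x) powr (1 / 4 + \<alpha> / 2)) at_top"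
    unfolding err using error_not_small[OF assms] by blast
  show ?thesis
    unfolding is_Omega_at_top_def
  proof (rule ccontr)
    assume "\<not> 0 < Limsup at_top (\<lambda>x. ereal (\<bar>divisor_error \<alpha> x\<bar> / (x * ln x) powr (1 / 4 + \<alpha> / 2)))"
    then have "Limsup at_top (\<lambda>x. ereal (\<bar>divisor_error \<alpha> x\<bar> / (x * ln x) powr (1 / 4 + \<alpha> / 2))) < ereal \<epsilon>"
      using \<epsilon> by (metis ereal_less(2) leI le_less_trans)
    then have "eventually (\<lambda>x. \<bar>divisor_error \<alpha> x\<bar> / (x * ln x) powr (1 / 4 + \<alpha> / 2) < \<epsilon>) at_top"
      by (auto dest!: Limsup_lessD)
    then have "eventually (\<lambda>x. \<bar>divisor_error \<alpha> x\<bar> \<le> \<epsilon> * (x * ln x) powr (1 / 4 + \<alpha> / 2)) at_top"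
      using eventually_gt_at_top[of 1]
    proof eventually_elim
      case (elim x)
      then have "(x * ln x) powr (1 / 4 + \<alpha> / 2) > 0" by simp
      with elim(1) show ?case by (simp add: divide_less_eq)
    qed
    with not_small show False ..
  qed
qed

end
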